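(* Let $F:(M^m,g)\to(B^n,g')$ be a Clairaut conformal submersion between Riemannian manifolds with $r=e^f$. If $n\neq 2$, then there exists a function $\rho$ on $B$ such that $F:(M,g)\to(B,\rho^2 g')$ is a harmonic Clairaut conformal submersion with $r=e^f$.
   Context: All manifolds, maps and functions are smooth; $\dim M=m$, $\dim B=n$. For a submersion $F:(M,g)\to(B,g')$, the vertical distribution is $\ker F_\ast$ and the horizontal distribution is its $g$-orthogonal complement. $F$ is a conformal submersion with dilation $\lambda:M\to\mathbb{R}^+$ if $g'(F_\ast X,F_\ast Y)=\lambda^2 g(X,Y)$ for all horizontal $X,Y$. A conformal submersion $F$ is a Clairaut conformal submersion with function $r:M\to\mathbb{R}^+$ if for every geodesic $\alpha$ on $(M,g)$ the function $t\mapsto r(\alpha(t))\sin\omega(t)$ is constant, where $\omega(t)\in[0,\pi/2]$ is the angle between $\dot\alpha(t)$ and the horizontal space at $\alpha(t)$. Writing $r=e^f$ means that $f:M\to\mathbb{R}$ is the function $\log r$. A smooth map between Riemannian manifolds is harmonic if its tension field (the trace, with respect to the domain metric, of its second fundamental form $\nabla F_\ast$) vanishes identically.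
   Formalization: The formal theorem additionally assumes that F is surjective and that all fibres of F are connected; without either one the claim fails (e.g. a double cover of circles with a non-invariant metric, or an inclusion (0,1) into R with metric x^{-4}dx^2). *)

theory Defs
  imports "HOL-Analysis.Analysis"
begin

section \<open>Smooth functions between normed spaces\<close>

text \<open>Used for open \<open>S\<close> only; for functions on a Euclidean space this is \<open>C\<^sup>k\<close> resp. \<open>C\<^sup>\<infinity>\<close> on \<open>S\<close>.\<close>

primrec ck_on :: "nat \<Rightarrow> 'a::real_normed_vector set \<Rightarrow> ('a \<Rightarrow> 'b::real_normed_vector) \<Rightarrow> bool" where
  "ck_on 0 S f \<longleftrightarrow> continuous_on S f"
| "ck_on (Suc k) S f \<longleftrightarrow>
     (\<forall>x\<in>S. f differentiable at x) \<and> (\<forall>v. ck_on k S (\<lambda>x. frechet_derivative f (at x) v))"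

definition smooth_on :: "'a::real_normed_vector set \<Rightarrow> ('a \<Rightarrow> 'b::real_normed_vector) \<Rightarrow> bool" where
  "smooth_on S f \<longleftrightarrow> (\<forall>k. ck_on k S f)"

definition partial :: "'m::finite \<Rightarrow> (real^'m \<Rightarrow> real) \<Rightarrow> real^'m \<Rightarrow> real" where
  "partial i h x = frechet_derivative h (at x) (axis i 1)"


section \<open>Smooth manifolds\<close>

text \<open>
  The point set of a manifold is a whole type; the type classes \<open>t2_space\<close> and
  \<open>second_countable_topology\<close>, imposed where manifolds are introduced, make it Hausdorff and
  second countable. The dimension is \<open>CARD('m)\<close>. A chart is an open domain together with a
  coordinate map, whose values outside the domain are irrelevant.
\<close>

type_synonym ('a, 'm) chart = "'a set \<times> ('a \<Rightarrow> real^'m)"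

abbreviation chart_dom :: "('a, 'm) chart \<Rightarrow> 'a set" where
  "chart_dom c \<equiv> fst c"

abbreviation chart_map :: "('a, 'm) chart \<Rightarrow> 'a \<Rightarrow> real^'m" where
  "chart_map c \<equiv> snd c"

definition chart_image :: "('a, 'm) chart \<Rightarrow> (real^'m) set" where
  "chart_image c = chart_map c ` chart_dom c"

definition chart_inv :: "('a, 'm) chart \<Rightarrow> real^'m \<Rightarrow> 'a" where
  "chart_inv c = inv_into (chart_dom c) (chart_map c)"

definition is_chart :: "('a::topological_space, 'm::finite) chart \<Rightarrow> bool" where
  "is_chart c \<longleftrightarrow> open (chart_dom c) \<and> open (chart_image c) \<and>
     homeomorphism (chart_dom c) (chart_image c) (chart_map c) (chart_inv c)"

definition smooth_atlas :: "('a::{t2_space,second_countable_topology}, 'm::finite) chart set \<Rightarrow> bool" where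
  "smooth_atlas A \<longleftrightarrow>
     (\<forall>c\<in>A. is_chart c) \<and> (\<Union>c\<in>A. chart_dom c) = UNIV \<and>
     (\<forall>c\<in>A. \<forall>d\<in>A. smooth_on (chart_map c ` (chart_dom c \<inter> chart_dom d)) (chart_map d \<circ> chart_inv c))"

definition smooth_fun :: "('a, 'm::finite) chart set \<Rightarrow> ('a \<Rightarrow> real) \<Rightarrow> bool" where
  "smooth_fun A h \<longleftrightarrow> (\<forall>c\<in>A. smooth_on (chart_image c) (h \<circ> chart_inv c))"

definition local_rep ::
    "('a, 'm) chart \<Rightarrow> ('b, 'n) chart \<Rightarrow> ('a \<Rightarrow> 'b) \<Rightarrow> real^'m \<Rightarrow> real^'n" where
  "local_rep c d F = chart_map d \<circ> F \<circ> chart_inv c"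

definition smooth_map ::
    "('a::topological_space, 'm::finite) chart set \<Rightarrow> ('b::topological_space, 'n::finite) chart set
      \<Rightarrow> ('a \<Rightarrow> 'b) \<Rightarrow> bool" where
  "smooth_map A B F \<longleftrightarrow> continuous_on UNIV F \<and>
     (\<forall>c\<in>A. \<forall>d\<in>B. smooth_on (chart_map c ` (chart_dom c \<inter> F -` chart_dom d)) (local_rep c d F))"


section \<open>Tangent vectors\<close>

text \<open>
  The tangent space at \<open>p\<close> is modelled by the full coordinate space \<open>real^'m\<close>: a tangent vector is
  identified with its components in one chart around \<open>p\<close>, chosen once and for all. The function
  \<open>from_chart A c p\<close> turns the components of a tangent vector at \<open>p\<close> in an arbitrary chart \<open>c\<close>
  into the components in the chosen chart.
\<close>

definition chart_at :: "('a, 'm) chart set \<Rightarrow> 'a \<Rightarrow> ('a, 'm) chart" where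
  "chart_at A p = (SOME c. c \<in> A \<and> p \<in> chart_dom c)"

definition from_chart :: "('a, 'm::finite) chart set \<Rightarrow> ('a, 'm) chart \<Rightarrow> 'a \<Rightarrow> real^'m \<Rightarrow> real^'m" where
  "from_chart A c p =
     frechet_derivative (chart_map (chart_at A p) \<circ> chart_inv c) (at (chart_map c p))"

text \<open>The differential \<open>F\<^sub>*\<close> at \<open>p\<close>, from the tangent space at \<open>p\<close> to the one at \<open>F p\<close>.\<close>

definition differential ::
    "('a, 'm::finite) chart set \<Rightarrow> ('b, 'n::finite) chart set \<Rightarrow> ('a \<Rightarrow> 'b) \<Rightarrow> 'a
      \<Rightarrow> real^'m \<Rightarrow> real^'n" where
  "differential A B F p =
     frechet_derivative (local_rep (chart_at A p) (chart_at B (F p)) F) (at (chart_map (chart_at A p) p))"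

definition velocity :: "('a, 'm::finite) chart set \<Rightarrow> (real \<Rightarrow> 'a) \<Rightarrow> real \<Rightarrow> real^'m" where
  "velocity A \<alpha> t = vector_derivative (chart_map (chart_at A (\<alpha> t)) \<circ> \<alpha>) (at t)"


section \<open>Riemannian metrics, Christoffel symbols, geodesics\<close>

type_synonym ('a, 'm) metric_field = "'a \<Rightarrow> real^'m \<Rightarrow> real^'m \<Rightarrow> real"

text \<open>The coefficients \<open>g\<^sub>i\<^sub>j\<close> in the chart \<open>c\<close>, as a matrix-valued function of the coordinates.\<close>

definition metric_matrix ::
    "('a, 'm::finite) chart set \<Rightarrow> ('a, 'm) metric_field \<Rightarrow> ('a, 'm) chart \<Rightarrow> real^'m \<Rightarrow> real^'m^'m" where
  "metric_matrix A g c x =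
     (\<chi> i j. g (chart_inv c x) (from_chart A c (chart_inv c x) (axis i 1))
                              (from_chart A c (chart_inv c x) (axis j 1)))"

definition riemannian_metric :: "('a, 'm::finite) chart set \<Rightarrow> ('a, 'm) metric_field \<Rightarrow> bool" where
  "riemannian_metric A g \<longleftrightarrow>
     (\<forall>p. bilinear (g p) \<and> (\<forall>v w. g p v w = g p w v) \<and> (\<forall>v. v \<noteq> 0 \<longrightarrow> g p v v > 0)) \<and>
     (\<forall>c\<in>A. \<forall>i j. smooth_on (chart_image c) (\<lambda>x. metric_matrix A g c x $ i $ j))"

definition riemannian_manifold ::
    "('a::{t2_space,second_countable_topology}, 'm::finite) chart set \<Rightarrow> ('a, 'm) metric_field \<Rightarrow> bool" where
  "riemannian_manifold A g \<longleftrightarrow> smooth_atlas A \<and> riemannian_metric A g"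

text \<open>\<open>christoffel A g c k i j x\<close> is \<open>\<Gamma>\<^sup>k\<^sub>i\<^sub>j\<close> of the Levi-Civita connection in the chart \<open>c\<close>.\<close>

definition christoffel ::
    "('a, 'm::finite) chart set \<Rightarrow> ('a, 'm) metric_field \<Rightarrow> ('a, 'm) chart
      \<Rightarrow> 'm \<Rightarrow> 'm \<Rightarrow> 'm \<Rightarrow> real^'m \<Rightarrow> real" where
  "christoffel A g c k i j x =
     (1/2) * (\<Sum>l\<in>UNIV. matrix_inv (metric_matrix A g c x) $ k $ l *
        (partial i (\<lambda>y. metric_matrix A g c y $ j $ l) x
       + partial j (\<lambda>y. metric_matrix A g c y $ i $ l) x
       - partial l (\<lambda>y. metric_matrix A g c y $ i $ j) x))"

text \<open>
  \<open>coord_geodesic\<close>: in the chart \<open>c\<close>, the curve \<open>\<alpha>\<close> satisfies \<open>x\<^sup>k'' + \<Gamma>\<^sup>k\<^sub>i\<^sub>j x\<^sup>i' x\<^sup>j' = 0\<close> on the open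
  set \<open>J\<close>. Since this equation does not depend on the coordinates, asking for it locally in
  some chart around each point is the same as asking for it in all charts. Constant
  curves are included.
\<close>

definition coord_geodesic ::
    "('a, 'm::finite) chart set \<Rightarrow> ('a, 'm) metric_field \<Rightarrow> ('a, 'm) chart \<Rightarrow> real set
      \<Rightarrow> (real \<Rightarrow> 'a) \<Rightarrow> bool" where
  "coord_geodesic A g c J \<alpha> \<longleftrightarrow>
     \<alpha> ` J \<subseteq> chart_dom c \<and> smooth_on J (chart_map c \<circ> \<alpha>) \<and>
     (let x = chart_map c \<circ> \<alpha>;
          x' = (\<lambda>s. vector_derivative x (at s));
          x'' = (\<lambda>s. vector_derivative x' (at s))
      in \<forall>s\<in>J. \<forall>k. x'' s $ k +
           (\<Sum>i\<in>UNIV. \<Sum>j\<in>UNIV. christoffel A g c k i j (x s) * (x' s $ i) * (x' s $ j)) = 0)"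

definition geodesic ::
    "('a, 'm::finite) chart set \<Rightarrow> ('a, 'm) metric_field \<Rightarrow> real set \<Rightarrow> (real \<Rightarrow> 'a) \<Rightarrow> bool" where
  "geodesic A g I \<alpha> \<longleftrightarrow> open I \<and> is_interval I \<and>
     (\<forall>t\<in>I. \<exists>c\<in>A. \<exists>J. open J \<and> t \<in> J \<and> J \<subseteq> I \<and> coord_geodesic A g c J \<alpha>)"


section \<open>Conformal and Clairaut submersions\<close>

definition submersion ::
    "('a::topological_space, 'm::finite) chart set \<Rightarrow> ('b::topological_space, 'n::finite) chart set
      \<Rightarrow> ('a \<Rightarrow> 'b) \<Rightarrow> bool" where
  "submersion A B F \<longleftrightarrow> smooth_map A B F \<and> (\<forall>p. surj (differential A B F p))"

definition vertical ::
    "('a, 'm::finite) chart set \<Rightarrow> ('b, 'n::finite) chart set \<Rightarrow> ('a \<Rightarrow> 'b) \<Rightarrow> 'a \<Rightarrow> (real^'m) set" where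
  "vertical A B F p = {v. differential A B F p v = 0}"

definition horizontal ::
    "('a, 'm::finite) chart set \<Rightarrow> ('a, 'm) metric_field \<Rightarrow> ('b, 'n::finite) chart set
      \<Rightarrow> ('a \<Rightarrow> 'b) \<Rightarrow> 'a \<Rightarrow> (real^'m) set" where
  "horizontal A g B F p = {v. \<forall>w \<in> vertical A B F p. g p v w = 0}"

definition horizontal_part ::
    "('a, 'm::finite) chart set \<Rightarrow> ('a, 'm) metric_field \<Rightarrow> ('b, 'n::finite) chart set
      \<Rightarrow> ('a \<Rightarrow> 'b) \<Rightarrow> 'a \<Rightarrow> real^'m \<Rightarrow> real^'m" where
  "horizontal_part A g B F p v = (THE h. h \<in> horizontal A g B F p \<and> v - h \<in> vertical A B F p)"

text \<open>
  The angle in \<open>[0, \<pi>/2]\<close> between \<open>v \<noteq> 0\<close> and the horizontal space. For \<open>v = 0\<close> the value is \<open>\<pi>/2\<close>,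
  so that a constant geodesic imposes no condition below.
\<close>

definition angle_horizontal ::
    "('a, 'm::finite) chart set \<Rightarrow> ('a, 'm) metric_field \<Rightarrow> ('b, 'n::finite) chart set
      \<Rightarrow> ('a \<Rightarrow> 'b) \<Rightarrow> 'a \<Rightarrow> real^'m \<Rightarrow> real" where
  "angle_horizontal A g B F p v =
     (let h = horizontal_part A g B F p v in arccos (sqrt (g p h h) / sqrt (g p v v)))"

definition conformal_submersion ::
    "('a::topological_space, 'm::finite) chart set \<Rightarrow> ('a, 'm) metric_field
      \<Rightarrow> ('b::topological_space, 'n::finite) chart set \<Rightarrow> ('b, 'n) metric_field
      \<Rightarrow> ('a \<Rightarrow> 'b) \<Rightarrow> ('a \<Rightarrow> real) \<Rightarrow> bool" where
  "conformal_submersion A g B g' F dil \<longleftrightarrow>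
     submersion A B F \<and> smooth_fun A dil \<and> (\<forall>p. dil p > 0) \<and>
     (\<forall>p. \<forall>X \<in> horizontal A g B F p. \<forall>Y \<in> horizontal A g B F p.
        g' (F p) (differential A B F p X) (differential A B F p Y) = (dil p)\<^sup>2 * g p X Y)"

definition clairaut_conformal_submersion ::
    "('a::topological_space, 'm::finite) chart set \<Rightarrow> ('a, 'm) metric_field
      \<Rightarrow> ('b::topological_space, 'n::finite) chart set \<Rightarrow> ('b, 'n) metric_field
      \<Rightarrow> ('a \<Rightarrow> 'b) \<Rightarrow> ('a \<Rightarrow> real) \<Rightarrow> bool" where
  "clairaut_conformal_submersion A g B g' F r \<longleftrightarrow>
     (\<exists>dil. conformal_submersion A g B g' F dil) \<and> smooth_fun A r \<and> (\<forall>p. r p > 0) \<and>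
     (\<forall>I \<alpha>. geodesic A g I \<alpha> \<longrightarrow>
        (\<lambda>t. r (\<alpha> t) * sin (angle_horizontal A g B F (\<alpha> t) (velocity A \<alpha> t))) constant_on I)"


section \<open>Tension field\<close>

text \<open>
  Components of \<open>(\<nabla>F\<^sub>*)(\<partial>\<^sub>i, \<partial>\<^sub>j) = \<nabla>\<^sup>F\<^bsub>\<partial>\<^sub>i\<^esub> F\<^sub>*\<partial>\<^sub>j - F\<^sub>*(\<nabla>\<^bsub>\<partial>\<^sub>i\<^esub> \<partial>\<^sub>j)\<close> at \<open>p\<close> in the charts \<open>c\<close> around \<open>p\<close> and \<open>d\<close>
  around \<open>F p\<close>.
\<close>

definition second_fundamental_form ::
    "('a, 'm::finite) chart set \<Rightarrow> ('a, 'm) metric_field \<Rightarrow> ('b, 'n::finite) chart set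
      \<Rightarrow> ('b, 'n) metric_field \<Rightarrow> ('a \<Rightarrow> 'b) \<Rightarrow> ('a, 'm) chart \<Rightarrow> ('b, 'n) chart \<Rightarrow> 'a
      \<Rightarrow> 'm \<Rightarrow> 'm \<Rightarrow> real^'n" where
  "second_fundamental_form A g B g' F c d p i j =
     (let \<Phi> = (\<lambda>\<gamma> z. local_rep c d F z $ \<gamma>); x = chart_map c p; y = chart_map d (F p)
      in \<chi> \<gamma>. partial i (partial j (\<Phi> \<gamma>)) x
           + (\<Sum>\<mu>\<in>UNIV. \<Sum>\<nu>\<in>UNIV. christoffel B g' d \<gamma> \<mu> \<nu> y * partial i (\<Phi> \<mu>) x * partial j (\<Phi> \<nu>) x)
           - (\<Sum>k\<in>UNIV. christoffel A g c k i j x * partial k (\<Phi> \<gamma>) x))"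

definition tension_field ::
    "('a, 'm::finite) chart set \<Rightarrow> ('a, 'm) metric_field \<Rightarrow> ('b, 'n::finite) chart set
      \<Rightarrow> ('b, 'n) metric_field \<Rightarrow> ('a \<Rightarrow> 'b) \<Rightarrow> 'a \<Rightarrow> real^'n" where
  "tension_field A g B g' F p =
     (let c = chart_at A p; d = chart_at B (F p)
      in \<Sum>i\<in>UNIV. \<Sum>j\<in>UNIV. (matrix_inv (metric_matrix A g c (chart_map c p)) $ i $ j)
           *\<^sub>R second_fundamental_form A g B g' F c d p i j)"

definition harmonic_map ::
    "('a::topological_space, 'm::finite) chart set \<Rightarrow> ('a, 'm) metric_field
      \<Rightarrow> ('b::topological_space, 'n::finite) chart set \<Rightarrow> ('b, 'n) metric_field
      \<Rightarrow> ('a \<Rightarrow> 'b) \<Rightarrow> bool" where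
  "harmonic_map A g B g' F \<longleftrightarrow> smooth_map A B F \<and> (\<forall>p. tension_field A g B g' F p = 0)"

end

theory Submission
  imports Defs
begin

text \<open>
  Write \<open>\<lambda>\<close> for the dilation, \<open>q(v,w) = \<lambda>\<^sup>2 g(v,w) - g'(F\<^sub>* v, F\<^sub>* w)\<close> and \<open>S\<close> for the second fundamental
  form of \<open>F\<close>. For a nonzero tangent vector \<open>v\<close>, \<open>sin\<^sup>2 \<omega> = q(v,v) / (\<lambda>\<^sup>2 g(v,v))\<close>. Differentiating
  \<open>r\<^sup>2 sin\<^sup>2 \<omega>\<close> along the geodesic with initial velocity \<open>v\<close> gives the cubic identity
  \<open>df(v) q(v,v) + d(ln \<lambda>)(v) g'(F\<^sub>* v, F\<^sub>* v) = g'(F\<^sub>* v, S(v,v))\<close>.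
  Polarise it and trace over two of the three arguments; the trace of \<open>g'(F\<^sub>* \<cdot>, S(u,\<cdot>))\<close> is known because
  the energy density of \<open>F\<close> is \<open>n \<lambda>\<^sup>2\<close>. For vertical \<open>u\<close> the outcome is \<open>df(u) = d\<lambda>(u) = 0\<close>, for
  horizontal \<open>u\<close> it is \<open>g'(F\<^sub>* u, \<tau>) = \<lambda>\<^sup>2 ((m - n) df(u) + (2 - n) d(ln \<lambda>)(u))\<close>, so \<open>F\<close> is harmonic as soon
  as \<open>\<lambda> = exp(k f)\<close> with \<open>k = (m - n) / (n - 2)\<close>. The function \<open>exp(k f) / \<lambda>\<close> is constant on the connected
  fibres, hence of the form \<open>\<rho> \<circ> F\<close>, and the metric \<open>\<rho>\<^sup>2 g'\<close> has dilation \<open>exp(k f)\<close> while the angles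
  \<open>\<omega>\<close> do not change.
\<close>

section \<open>Calculus of smooth maps\<close>

text \<open>The tension field for the rescaled target metric is never computed from the old one.
  Horizontal spaces and angles depend on \<open>F\<close> and the domain metric only, so the
  rescaled map satisfies the same Clairaut relation and the trace formula is applied to it afresh;
  the application with \<open>g'\<close> itself supplies the vanishing vertical derivatives that let
  the factor descend. Substituting d(ln \<lambda>) = k df into the tension gives (m - n) + (2 - n) k
  = 0. For n = 2 the dilation drops out of this equation, so rescaling has no influence on the
  tension: hence the excluded dimension. The form g'(dF u, S(v,w)) is symmetric in v and w only.
  Polarisation therefore yields a cyclic sum, and its trace contains the tension once and a mixed
  trace twice; the derivative of the energy density is what removes the mixed one. The cubic
  identity is needed at every tangent vector, so geodesics with arbitrary initial velocity must
  exist; this is the purpose of the differential equation part.\<close>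

lemma ck_on_cong:
  assumes "open S" "\<And>x. x \<in> S \<Longrightarrow> f x = g x"
  shows "ck_on k S f \<longleftrightarrow> ck_on k S g"
  using assms(2)
proof (induction k arbitrary: f g)
  case 0
  then show ?case by (simp cong: continuous_on_cong)
next
  case (Suc k)
  have hd: "(f has_derivative D) (at x) \<longleftrightarrow> (g has_derivative D) (at x)" if "x \<in> S" for D x
    using has_derivative_transform_within_open[OF _ \<open>open S\<close> that, of f D UNIV g]
      has_derivative_transform_within_open[OF _ \<open>open S\<close> that, of g D UNIV f] Suc.prems by auto
  then have fd: "frechet_derivative f (at x) = frechet_derivative g (at x)" if "x \<in> S" for x
    using that by (simp add: frechet_derivative_def)
  have "ck_on k S (\<lambda>x. frechet_derivative f (at x) v) = ck_on k S (\<lambda>x. frechet_derivative g (at x) v)" for v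
    by (rule Suc.IH) (simp add: fd)
  then show ?case
    using hd by (simp add: differentiable_def)
qed

lemma ck_on_subset: "ck_on k S f \<Longrightarrow> T \<subseteq> S \<Longrightarrow> ck_on k T f"
  by (induction k arbitrary: f) (auto intro: continuous_on_subset)

lemma ck_on_continuous: "ck_on k S f \<Longrightarrow> continuous_on S f"
  by (cases k) (auto intro!: continuous_at_imp_continuous_on differentiable_imp_continuous_within)

lemma ck_on_SucD: "ck_on (Suc k) S f \<Longrightarrow> ck_on k S f"
proof (induction k arbitrary: f)
  case 0
  then show ?case using ck_on_continuous ck_on.simps(1) by blast
qed simp

text \<open>\<open>frechet_derivative\<close> is defined by choice. On an open set any explicit
  formula for the derivative may stand in for it, and most closure properties below go through this
  rule.\<close>

lemma ck_on_SucI: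
  assumes "open S" "\<And>x. x \<in> S \<Longrightarrow> (f has_derivative f' x) (at x)" "\<And>v. ck_on k S (\<lambda>x. f' x v)"
  shows "ck_on (Suc k) S f"
proof -
  have eq: "frechet_derivative f (at x) = f' x" if "x \<in> S" for x
    using frechet_derivative_at[OF assms(2)[OF that]] by simp
  have "ck_on k S (\<lambda>x. frechet_derivative f (at x) v)" for v
    using assms(3)[of v] ck_on_cong[OF assms(1), of "\<lambda>x. frechet_derivative f (at x) v" "\<lambda>x. f' x v"] eq by simp
  then show ?thesis using assms(2) by (auto simp: differentiable_def)
qed

lemma ck_on_has_derivative:
  "ck_on (Suc k) S f \<Longrightarrow> x \<in> S \<Longrightarrow> (f has_derivative frechet_derivative f (at x)) (at x)"
  by (simp add: frechet_derivative_works[symmetric])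

lemma ck_on_local:
  assumes "\<And>x. x \<in> S \<Longrightarrow> \<exists>T. open T \<and> x \<in> T \<and> ck_on k T f"
  shows "ck_on k S f"
  using assms
proof (induction k arbitrary: f)
  case 0
  show ?case
    unfolding ck_on.simps
  proof (rule continuous_at_imp_continuous_on, rule ballI)
    fix x assume "x \<in> S"
    then obtain T where "open T" "x \<in> T" "continuous_on T f" using 0 by auto
    then show "isCont f x" by (simp add: continuous_on_eq_continuous_at)
  qed
next
  case (Suc k)
  have "f differentiable at x" if "x \<in> S" for x
    using Suc.prems[OF that] by auto
  moreover have "ck_on k S (\<lambda>x. frechet_derivative f (at x) v)" for v
  proof (rule Suc.IH)
    fix x assume "x \<in> S"
    from Suc.prems[OF this] show "\<exists>T. open T \<and> x \<in> T \<and> ck_on k T (\<lambda>x. frechet_derivative f (at x) v)"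
      by auto
  qed
  ultimately show ?case by simp
qed

lemma ck_on_const: "ck_on k S (\<lambda>x. c)"
  by (induction k arbitrary: c) (auto simp: frechet_derivative_const)

lemma ck_on_linear:
  assumes "open S" "bounded_linear f" shows "ck_on k S f"
proof (cases k)
  case 0
  then show ?thesis using assms by (simp add: linear_continuous_on)
next
  case (Suc j)
  have "ck_on (Suc j) S f"
    by (rule ck_on_SucI[OF assms(1) bounded_linear_imp_has_derivative[OF assms(2)] ck_on_const])
  then show ?thesis using Suc by simp
qed

lemma ck_on_bounded_linear:
  assumes "open S" "bounded_linear L" "ck_on k S f" shows "ck_on k S (\<lambda>x. L (f x))"
  using assms(3)
proof (induction k arbitrary: f)
  case 0
  then show ?case by (simp add: bounded_linear.continuous_on[OF assms(2)])
next
  case (Suc k)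
  show ?case
  proof (rule ck_on_SucI[OF assms(1)])
    show "((\<lambda>x. L (f x)) has_derivative (\<lambda>v. L (frechet_derivative f (at x) v))) (at x)" if "x \<in> S" for x
      by (rule bounded_linear.has_derivative[OF assms(2) ck_on_has_derivative[OF Suc.prems that]])
    show "ck_on k S (\<lambda>x. L (frechet_derivative f (at x) v))" for v
      using Suc by simp
  qed
qed

lemma ck_on_add:
  assumes "open S" "ck_on k S f" "ck_on k S g" shows "ck_on k S (\<lambda>x. f x + g x)"
  using assms(2,3)
proof (induction k arbitrary: f g)
  case 0
  then show ?case by (simp add: continuous_on_add)
next
  case (Suc k)
  show ?case
  proof (rule ck_on_SucI[OF assms(1)])
    show "((\<lambda>x. f x + g x) has_derivative (\<lambda>v. frechet_derivative f (at x) v + frechet_derivative g (at x) v)) (at x)" if "x \<in> S" for x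
      by (rule has_derivative_add; rule ck_on_has_derivative[OF _ that]; fact Suc.prems)
    show "ck_on k S (\<lambda>x. frechet_derivative f (at x) v + frechet_derivative g (at x) v)" for v
      using Suc by simp
  qed
qed

lemma ck_on_bilinear:
  assumes "open S" "bounded_bilinear L" "ck_on k S f" "ck_on k S g"
  shows "ck_on k S (\<lambda>x. L (f x) (g x))"
  using assms(3,4)
proof (induction k arbitrary: f g)
  case 0
  then show ?case by (simp add: bounded_bilinear.continuous_on[OF assms(2)])
next
  case (Suc k)
  show ?case
  proof (rule ck_on_SucI[OF assms(1)])
    show "((\<lambda>x. L (f x) (g x)) has_derivative
        (\<lambda>v. L (f x) (frechet_derivative g (at x) v) + L (frechet_derivative f (at x) v) (g x))) (at x)" if "x \<in> S" for x
      by (rule bounded_bilinear.FDERIV[OF assms(2)]; rule ck_on_has_derivative[OF _ that]; fact Suc.prems)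
    show "ck_on k S (\<lambda>x. L (f x) (frechet_derivative g (at x) v) + L (frechet_derivative f (at x) v) (g x))" for v
      using Suc.prems by (intro ck_on_add[OF assms(1)] Suc.IH) (simp_all add: ck_on_SucD)
  qed
qed

lemma ck_on_mult:
  fixes f g :: "_ \<Rightarrow> real"
  shows "open S \<Longrightarrow> ck_on k S f \<Longrightarrow> ck_on k S g \<Longrightarrow> ck_on k S (\<lambda>x. f x * g x)"
  by (rule ck_on_bilinear[OF _ bounded_bilinear_mult])

lemma ck_on_minus: "open S \<Longrightarrow> ck_on k S f \<Longrightarrow> ck_on k S (\<lambda>x. - f x)"
  by (rule ck_on_bounded_linear[OF _ bounded_linear_minus[OF bounded_linear_ident]])

lemma ck_on_diff: "open S \<Longrightarrow> ck_on k S f \<Longrightarrow> ck_on k S g \<Longrightarrow> ck_on k S (\<lambda>x. f x - g x)"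
  using ck_on_add[of S k f "\<lambda>x. - g x"] ck_on_minus[of S k g] by simp

lemma ck_on_sum:
  "open S \<Longrightarrow> (\<And>i. i \<in> I \<Longrightarrow> ck_on k S (f i)) \<Longrightarrow> ck_on k S (\<lambda>x. \<Sum>i\<in>I. f i x)"
  by (induction I rule: infinite_finite_induct) (auto intro: ck_on_add simp: ck_on_const)

lemma ck_on_prod:
  fixes f :: "'i \<Rightarrow> 'a::real_normed_vector \<Rightarrow> real"
  shows "open S \<Longrightarrow> (\<And>i. i \<in> I \<Longrightarrow> ck_on k S (f i)) \<Longrightarrow> ck_on k S (\<lambda>x. \<Prod>i\<in>I. f i x)"
  by (induction I rule: infinite_finite_induct) (auto intro: ck_on_mult simp: ck_on_const)

text \<open>The chain rule applies the derivative of \<open>g\<close> to a vector that moves with x.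
  Expanding that vector in \<open>Basis\<close> leaves derivatives of \<open>g\<close> in fixed
  directions, to which the induction hypothesis applies; hence the Euclidean codomain of
  \<open>f\<close>.\<close>

lemma ck_on_compose:
  fixes f :: "'a::real_normed_vector \<Rightarrow> 'b::euclidean_space"
  assumes "open S" "open T" "f ` S \<subseteq> T" "ck_on k S f" "ck_on k T g"
  shows "ck_on k S (\<lambda>x. g (f x))"
  using assms(4,5)
proof (induction k arbitrary: g)
  case 0
  then show ?case
    using continuous_on_compose2[of T g S f] assms(3) by simp
next
  case (Suc k)
  show ?case
  proof (rule ck_on_SucI[OF assms(1)])
    fix x assume x: "x \<in> S"
    then have fx: "f x \<in> T" using assms(3) by auto
    have lin: "linear (frechet_derivative g (at (f x)))"
      using ck_on_has_derivative[OF Suc.prems(2) fx] has_derivative_linear by blast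
    have "((\<lambda>x. g (f x)) has_derivative
        (\<lambda>v. frechet_derivative g (at (f x)) (frechet_derivative f (at x) v))) (at x)"
      by (rule has_derivative_compose[OF ck_on_has_derivative[OF Suc.prems(1) x]
            ck_on_has_derivative[OF Suc.prems(2) fx]])
    also have "(\<lambda>v. frechet_derivative g (at (f x)) (frechet_derivative f (at x) v)) =
        (\<lambda>v. \<Sum>b\<in>Basis. (frechet_derivative f (at x) v \<bullet> b) *\<^sub>R frechet_derivative g (at (f x)) b)"
    proof
      fix v
      have "frechet_derivative g (at (f x)) (frechet_derivative f (at x) v) =
        frechet_derivative g (at (f x)) (\<Sum>b\<in>Basis. (frechet_derivative f (at x) v \<bullet> b) *\<^sub>R b)"
        by (simp add: euclidean_representation)
      also have "\<dots> = (\<Sum>b\<in>Basis. (frechet_derivative f (at x) v \<bullet> b) *\<^sub>R frechet_derivative g (at (f x)) b)"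
        by (simp add: linear_sum[OF lin] linear_cmul[OF lin])
      finally show "frechet_derivative g (at (f x)) (frechet_derivative f (at x) v) = \<dots>" .
    qed
    finally show "((\<lambda>x. g (f x)) has_derivative
       (\<lambda>v. \<Sum>b\<in>Basis. (frechet_derivative f (at x) v \<bullet> b) *\<^sub>R frechet_derivative g (at (f x)) b)) (at x)" .
  next
    fix v
    have "ck_on k S (\<lambda>x. frechet_derivative g (at (f x)) b)" for b
      using Suc.prems(2) by (intro Suc.IH ck_on_SucD[OF Suc.prems(1)]) simp
    moreover have "ck_on k S (\<lambda>x. frechet_derivative f (at x) v \<bullet> b)" for b
      using Suc.prems by (intro ck_on_bounded_linear[OF assms(1) bounded_linear_inner_left]) simp
    ultimately show "ck_on k S (\<lambda>x. \<Sum>b\<in>Basis. (frechet_derivative f (at x) v \<bullet> b) *\<^sub>R frechet_derivative g (at (f x)) b)"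
      by (intro ck_on_sum[OF assms(1)] ck_on_bilinear[OF assms(1) bounded_bilinear_scaleR])
  qed
qed

lemma ck_on_inverse: "ck_on k (- {0}) (inverse :: real \<Rightarrow> real)"
proof (induction k)
  case (Suc k)
  have o: "open (- {0::real})" by auto
  show ?case
  proof (rule ck_on_SucI[OF o])
    show "(inverse has_derivative (\<lambda>v. - (inverse x * v * inverse x))) (at x)" if "x \<in> -{0::real}" for x :: real
      using that by (intro has_derivative_inverse') auto
    show "ck_on k (-{0}) (\<lambda>x::real. - (inverse x * v * inverse x))" for v
      by (intro ck_on_minus[OF o] ck_on_mult[OF o] Suc ck_on_const)
  qed
qed (auto intro!: continuous_intros)

lemma ck_on_exp: "ck_on k UNIV (exp :: real \<Rightarrow> real)"
proof (induction k)
  case (Suc k)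
  show ?case
  proof (rule ck_on_SucI[OF open_UNIV])
    show "(exp has_derivative (\<lambda>v. v * exp x)) (at x)" for x :: real
      by (auto intro!: derivative_eq_intros)
    show "ck_on k UNIV (\<lambda>x::real. v * exp x)" for v
      by (intro ck_on_mult[OF open_UNIV] Suc ck_on_const)
  qed
qed (auto intro!: continuous_intros)

lemma ck_on_ln: "ck_on k {0<..} (ln :: real \<Rightarrow> real)"
proof (cases k)
  case (Suc k)
  have "ck_on (Suc k) {0<..} (ln :: real \<Rightarrow> real)"
  proof (rule ck_on_SucI)
    show "(ln has_derivative (\<lambda>v. v * inverse x)) (at x)" if "x \<in> {0<..}" for x :: real
      using that by (auto intro!: derivative_eq_intros simp: field_simps)
    show "ck_on k {0<..} (\<lambda>x::real. v * inverse x)" for v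
      by (intro ck_on_mult ck_on_const ck_on_subset[OF ck_on_inverse]) auto
  qed auto
  with Suc show ?thesis by simp
qed (auto intro!: continuous_intros)

lemma smooth_on_cong:
  "open S \<Longrightarrow> (\<And>x. x \<in> S \<Longrightarrow> f x = g x) \<Longrightarrow> smooth_on S f \<longleftrightarrow> smooth_on S g"
  unfolding smooth_on_def by (simp add: ck_on_cong[of S f g])

lemma smooth_on_subset: "smooth_on S f \<Longrightarrow> T \<subseteq> S \<Longrightarrow> smooth_on T f"
  unfolding smooth_on_def by (blast intro: ck_on_subset)

lemma smooth_on_local:
  assumes "\<And>x. x \<in> S \<Longrightarrow> \<exists>T. open T \<and> x \<in> T \<and> smooth_on T f"
  shows "smooth_on S f"
  unfolding smooth_on_def
proof (intro allI ck_on_local)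
  fix k x assume "x \<in> S"
  from assms[OF this] show "\<exists>T. open T \<and> x \<in> T \<and> ck_on k T f"
    unfolding smooth_on_def by blast
qed

lemma smooth_on_const: "smooth_on S (\<lambda>x. c)"
  by (simp add: smooth_on_def ck_on_const)

lemma smooth_on_linear: "open S \<Longrightarrow> bounded_linear f \<Longrightarrow> smooth_on S f"
  by (simp add: smooth_on_def ck_on_linear)

lemma smooth_on_bounded_linear:
  "open S \<Longrightarrow> bounded_linear L \<Longrightarrow> smooth_on S f \<Longrightarrow> smooth_on S (\<lambda>x. L (f x))"
  by (simp add: smooth_on_def ck_on_bounded_linear)

lemma smooth_on_add: "open S \<Longrightarrow> smooth_on S f \<Longrightarrow> smooth_on S g \<Longrightarrow> smooth_on S (\<lambda>x. f x + g x)"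
  by (simp add: smooth_on_def ck_on_add)

lemma smooth_on_minus: "open S \<Longrightarrow> smooth_on S f \<Longrightarrow> smooth_on S (\<lambda>x. - f x)"
  by (simp add: smooth_on_def ck_on_minus)

lemma smooth_on_diff: "open S \<Longrightarrow> smooth_on S f \<Longrightarrow> smooth_on S g \<Longrightarrow> smooth_on S (\<lambda>x. f x - g x)"
  by (simp add: smooth_on_def ck_on_diff)

lemma smooth_on_mult:
  fixes f g :: "_ \<Rightarrow> real"
  shows "open S \<Longrightarrow> smooth_on S f \<Longrightarrow> smooth_on S g \<Longrightarrow> smooth_on S (\<lambda>x. f x * g x)"
  by (simp add: smooth_on_def ck_on_mult)

lemma smooth_on_sum:
  "open S \<Longrightarrow> (\<And>i. i \<in> I \<Longrightarrow> smooth_on S (f i)) \<Longrightarrow> smooth_on S (\<lambda>x. \<Sum>i\<in>I. f i x)"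
  by (simp add: smooth_on_def ck_on_sum)

lemma smooth_on_prod:
  fixes f :: "'i \<Rightarrow> 'a::real_normed_vector \<Rightarrow> real"
  shows "open S \<Longrightarrow> (\<And>i. i \<in> I \<Longrightarrow> smooth_on S (f i)) \<Longrightarrow> smooth_on S (\<lambda>x. \<Prod>i\<in>I. f i x)"
  by (simp add: smooth_on_def ck_on_prod)

lemma smooth_on_compose:
  fixes f :: "'a::real_normed_vector \<Rightarrow> 'b::euclidean_space"
  shows "open S \<Longrightarrow> open T \<Longrightarrow> f ` S \<subseteq> T \<Longrightarrow> smooth_on S f \<Longrightarrow> smooth_on T g \<Longrightarrow> smooth_on S (\<lambda>x. g (f x))"
  by (simp add: smooth_on_def ck_on_compose)

lemma smooth_on_inverse:
  fixes f :: "'a::real_normed_vector \<Rightarrow> real"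
  assumes "open S" "smooth_on S f" "\<And>x. x \<in> S \<Longrightarrow> f x \<noteq> 0"
  shows "smooth_on S (\<lambda>x. inverse (f x))"
  by (rule smooth_on_compose[of _ "-{0}"]) (use assms in \<open>auto simp: smooth_on_def ck_on_inverse\<close>)

lemma smooth_on_divide:
  fixes f :: "'a::real_normed_vector \<Rightarrow> real"
  assumes "open S" "smooth_on S f" "smooth_on S g" "\<And>x. x \<in> S \<Longrightarrow> g x \<noteq> 0"
  shows "smooth_on S (\<lambda>x. f x / g x)"
  unfolding divide_inverse by (intro smooth_on_mult smooth_on_inverse assms)

lemma smooth_on_exp:
  fixes f :: "'a::real_normed_vector \<Rightarrow> real"
  assumes "open S" "smooth_on S f"
  shows "smooth_on S (\<lambda>x. exp (f x))"
  by (rule smooth_on_compose[of _ UNIV]) (use assms in \<open>auto simp: smooth_on_def ck_on_exp\<close>)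

lemma smooth_on_ln:
  fixes f :: "'a::real_normed_vector \<Rightarrow> real"
  assumes "open S" "smooth_on S f" "\<And>x. x \<in> S \<Longrightarrow> f x > 0"
  shows "smooth_on S (\<lambda>x. ln (f x))"
  by (rule smooth_on_compose[of _ "{0<..}"]) (use assms in \<open>auto simp: smooth_on_def ck_on_ln\<close>)

lemma smooth_on_has_derivative:
  "smooth_on S f \<Longrightarrow> x \<in> S \<Longrightarrow> (f has_derivative frechet_derivative f (at x)) (at x)"
  unfolding smooth_on_def using ck_on_has_derivative by blast

lemma smooth_on_frechet_derivative:
  "smooth_on S f \<Longrightarrow> smooth_on S (\<lambda>x. frechet_derivative f (at x) v)"
  unfolding smooth_on_def using ck_on.simps(2) by blast

lemma smooth_on_continuous: "smooth_on S f \<Longrightarrow> continuous_on S f"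
  unfolding smooth_on_def using ck_on_continuous by blast

lemma bounded_linear_axis: "bounded_linear (axis i :: 'b::euclidean_space \<Rightarrow> 'b^'n::finite)"
  by (simp add: linear_conv_bounded_linear[symmetric], rule linearI) (auto simp: vec_eq_iff axis_def)

lemma ck_on_vec:
  fixes f :: "'a::real_normed_vector \<Rightarrow> 'b::euclidean_space ^'n::finite"
  assumes "open S" "\<And>i. ck_on k S (\<lambda>x. f x $ i)"
  shows "ck_on k S f"
  using assms(2)
proof (induction k arbitrary: f)
  case 0
  then show ?case using continuous_on_vec_lambda[of S "\<lambda>i x. f x $ i"] by simp
next
  case (Suc k)
  let ?D = "\<lambda>x v. \<chi> i. frechet_derivative (\<lambda>x. f x $ i) (at x) v"
  show ?case
  proof (rule ck_on_SucI[OF assms(1)])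
    show "(f has_derivative ?D x) (at x)" if "x \<in> S" for x
    proof -
      have "((\<lambda>x. \<Sum>i\<in>UNIV. axis i (f x $ i)) has_derivative
          (\<lambda>v. \<Sum>i\<in>UNIV. axis i (frechet_derivative (\<lambda>x. f x $ i) (at x) v))) (at x)"
        by (intro has_derivative_sum bounded_linear.has_derivative[OF bounded_linear_axis]
            ck_on_has_derivative[OF Suc.prems that])
      moreover have "(\<Sum>i\<in>UNIV. axis i (y i)) = (\<chi> i. y i)" for y :: "'n \<Rightarrow> 'b"
        by (simp add: vec_eq_iff axis_def if_distrib cong: if_cong)
      ultimately show ?thesis by simp
    qed
    show "ck_on k S (\<lambda>x. ?D x v)" for v
      by (rule Suc.IH) (use Suc.prems in simp)
  qed
qed

lemma smooth_on_vec:
  fixes f :: "'a::real_normed_vector \<Rightarrow> real ^'n::finite"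
  shows "open S \<Longrightarrow> (\<And>i. smooth_on S (\<lambda>x. f x $ i)) \<Longrightarrow> smooth_on S f"
  by (simp add: smooth_on_def ck_on_vec)

lemma smooth_on_partial: "smooth_on S h \<Longrightarrow> smooth_on S (partial i h)"
  using smooth_on_frechet_derivative[of S h "axis i 1"] by (simp add: partial_def[abs_def])

section \<open>Determinants and inverses of matrices depending smoothly on parameters\<close>

lemma smooth_on_det:
  fixes A :: "'a::real_normed_vector \<Rightarrow> real^'n^'n::finite"
  assumes "open S" "\<And>i j. smooth_on S (\<lambda>x. A x $ i $ j)"
  shows "smooth_on S (\<lambda>x. det (A x))"
  unfolding det_def by (intro smooth_on_sum smooth_on_mult smooth_on_prod smooth_on_const assms)

lemma matrix_inv_right:
  assumes "invertible (A :: real^'n^'n)" shows "A ** matrix_inv A = mat 1"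
  using someI_ex[OF assms[unfolded invertible_def]] by (simp add: matrix_inv_def)

lemma matrix_inv_left:
  assumes "invertible (A :: real^'n^'n)" shows "matrix_inv A ** A = mat 1"
  using someI_ex[OF assms[unfolded invertible_def]] by (simp add: matrix_inv_def)

text \<open>By Cramer's rule the entries are quotients of determinants, hence rational functions of
  the entries of \<open>A\<close>.\<close>

lemma smooth_on_matrix_inv:
  fixes A :: "'a::real_normed_vector \<Rightarrow> real^'n^'n::finite"
  assumes S: "open S" and sm: "\<And>i j. smooth_on S (\<lambda>x. A x $ i $ j)"
    and inv: "\<And>x. x \<in> S \<Longrightarrow> invertible (A x)"
  shows "smooth_on S (\<lambda>x. matrix_inv (A x) $ i $ j)"
proof -
  \<comment> \<open>\<open>?B x\<close> is \<open>A x\<close> with column \<open>i\<close> replaced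
    by the \<open>j\<close>-th unit vector.\<close>
  let ?B = "\<lambda>x. \<chi> a b. if b = i then axis j 1 $ a else A x $ a $ b"
  have eq: "matrix_inv (A x) $ i $ j = det (?B x) / det (A x)" if "x \<in> S" for x
  proof -
    have d: "det (A x) \<noteq> 0" using inv[OF that] invertible_det_nz by blast
    have "A x *v column j (matrix_inv (A x)) = axis j 1"
    proof -
      have "A x *v (matrix_inv (A x) *v axis j 1) = axis j 1"
        using inv[OF that] by (simp add: matrix_vector_mul_assoc matrix_inv_right)
      then show ?thesis by (simp add: matrix_vector_mult_basis)
    qed
    from this[unfolded cramer[OF d]] show ?thesis
      by (simp add: column_def vec_eq_iff)
  qed
  have sB: "smooth_on S (\<lambda>x. ?B x $ a $ b)" for a b
    using sm by (cases "b = i") (simp_all add: smooth_on_const)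
  have "smooth_on S (\<lambda>x. det (?B x) / det (A x))"
    using inv invertible_det_nz by (intro smooth_on_divide smooth_on_det S sB sm) blast
  with eq show ?thesis using smooth_on_cong[OF S, of "\<lambda>x. matrix_inv (A x) $ i $ j"] by simp
qed

section \<open>Symmetry of second derivatives and the Picard-Lindeloef theorem\<close>

text \<open>Two applications of the mean value theorem to the second difference on a parallelogram,
  first along \<open>a\<close>, then along \<open>b\<close>. The second difference is symmetric in
  \<open>a\<close> and \<open>b\<close>, the right-hand side visibly is not.\<close>

lemma second_derivative_approx:
  fixes f :: "'a::real_normed_vector \<Rightarrow> real"
  assumes S: "open S" and f: "ck_on 2 S f" and h: "h > 0"
    and sub: "\<And>s t. 0 \<le> s \<Longrightarrow> s \<le> h \<Longrightarrow> 0 \<le> t \<Longrightarrow> t \<le> h \<Longrightarrow> x + s *\<^sub>R a + t *\<^sub>R b \<in> S"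
  obtains s t where "0 \<le> s" "s \<le> h" "0 \<le> t" "t \<le> h"
    "f (x + h *\<^sub>R a + h *\<^sub>R b) - f (x + h *\<^sub>R a) - f (x + h *\<^sub>R b) + f x =
      h * h * frechet_derivative (\<lambda>y. frechet_derivative f (at y) a) (at (x + s *\<^sub>R a + t *\<^sub>R b)) b"
proof -
  let ?D = "\<lambda>y. frechet_derivative f (at y) a"
  have f2: "ck_on (Suc (Suc 0)) S f" using f by (simp only: numeral_2_eq_2)
  have D1: "((\<lambda>s. f (z + s *\<^sub>R a)) has_real_derivative ?D (z + s *\<^sub>R a)) (at s)" if "z + s *\<^sub>R a \<in> S" for z s
  proof -
    have "((\<lambda>s. z + s *\<^sub>R a) has_derivative (\<lambda>v. v *\<^sub>R a)) (at s)"
      by (auto intro!: derivative_eq_intros)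
    from has_derivative_compose[OF this ck_on_has_derivative[OF f2 that]]
    have *: "((\<lambda>s. f (z + s *\<^sub>R a)) has_derivative (\<lambda>v. frechet_derivative f (at (z + s *\<^sub>R a)) (v *\<^sub>R a))) (at s)" .
    have "linear (frechet_derivative f (at (z + s *\<^sub>R a)))"
      using ck_on_has_derivative[OF f2 that] has_derivative_linear by blast
    with * show ?thesis by (simp add: has_field_derivative_def linear_cmul mult.commute[of "?D _"] mult_commute_abs)
  qed
  have ckD: "ck_on (Suc 0) S ?D" using f2 by simp
  have D2: "((\<lambda>t. ?D (z + t *\<^sub>R b)) has_real_derivative frechet_derivative ?D (at (z + t *\<^sub>R b)) b) (at t)"
    if "z + t *\<^sub>R b \<in> S" for z t
  proof -
    have "((\<lambda>s. z + s *\<^sub>R b) has_derivative (\<lambda>v. v *\<^sub>R b)) (at t)"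
      by (auto intro!: derivative_eq_intros)
    from has_derivative_compose[OF this ck_on_has_derivative[OF ckD that]]
    have *: "((\<lambda>s. ?D (z + s *\<^sub>R b)) has_derivative (\<lambda>v. frechet_derivative ?D (at (z + t *\<^sub>R b)) (v *\<^sub>R b))) (at t)" .
    have "linear (frechet_derivative ?D (at (z + t *\<^sub>R b)))"
      using ck_on_has_derivative[OF ckD that] has_derivative_linear by blast
    with * show ?thesis by (simp add: has_field_derivative_def linear_cmul mult_commute_abs)
  qed
  have "\<exists>s. 0 < s \<and> s < h \<and> (f ((x + h *\<^sub>R b) + h *\<^sub>R a) - f (x + h *\<^sub>R a)) - (f ((x + h *\<^sub>R b) + 0 *\<^sub>R a) - f (x + 0 *\<^sub>R a))
     = (h - 0) * (?D ((x + h *\<^sub>R b) + s *\<^sub>R a) - ?D (x + s *\<^sub>R a))"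
  proof (rule MVT2[OF h])
    fix s assume s: "0 \<le> s" "s \<le> h"
    show "((\<lambda>s. f (x + h *\<^sub>R b + s *\<^sub>R a) - f (x + s *\<^sub>R a)) has_real_derivative
         ?D (x + h *\<^sub>R b + s *\<^sub>R a) - ?D (x + s *\<^sub>R a)) (at s)"
      using sub[OF s, of h] sub[OF s, of 0] h
      by (intro derivative_intros D1) (simp_all add: algebra_simps)
  qed
  then obtain s where s: "0 < s" "s < h" and e1:
    "(f ((x + h *\<^sub>R b) + h *\<^sub>R a) - f (x + h *\<^sub>R a)) - (f ((x + h *\<^sub>R b) + 0 *\<^sub>R a) - f (x + 0 *\<^sub>R a))
     = (h - 0) * (?D ((x + h *\<^sub>R b) + s *\<^sub>R a) - ?D (x + s *\<^sub>R a))" by blast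
  have "\<exists>t. 0 < t \<and> t < h \<and> ?D ((x + s *\<^sub>R a) + h *\<^sub>R b) - ?D ((x + s *\<^sub>R a) + 0 *\<^sub>R b)
     = (h - 0) * frechet_derivative ?D (at (x + s *\<^sub>R a + t *\<^sub>R b)) b"
    by (rule MVT2[OF h]) (use s sub in \<open>auto intro!: D2\<close>)
  then obtain t where t: "0 < t" "t < h" and e2: "?D ((x + s *\<^sub>R a) + h *\<^sub>R b) - ?D ((x + s *\<^sub>R a) + 0 *\<^sub>R b)
     = (h - 0) * frechet_derivative ?D (at (x + s *\<^sub>R a + t *\<^sub>R b)) b" by blast
  show ?thesis
  proof (rule that)
    have "f (x + h *\<^sub>R a + h *\<^sub>R b) - f (x + h *\<^sub>R a) - f (x + h *\<^sub>R b) + f x =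
      h * (?D ((x + s *\<^sub>R a) + h *\<^sub>R b) - ?D ((x + s *\<^sub>R a) + 0 *\<^sub>R b))"
      using e1 by (simp add: algebra_simps)
    then show "f (x + h *\<^sub>R a + h *\<^sub>R b) - f (x + h *\<^sub>R a) - f (x + h *\<^sub>R b) + f x =
      h * h * frechet_derivative ?D (at (x + s *\<^sub>R a + t *\<^sub>R b)) b"
      using e2 by simp
  qed (use s t in auto)
qed

text \<open>The second difference is the same for both orders, so one mixed derivative at some point
  near \<open>x\<close> equals the other at another point near \<open>x\<close>; continuity moves
  the equality to \<open>x\<close>.\<close>

lemma second_derivative_symmetric:
  fixes f :: "'a::real_normed_vector \<Rightarrow> real"
  assumes S: "open S" and f: "ck_on 2 S f" and x: "x \<in> S"
  shows "frechet_derivative (\<lambda>y. frechet_derivative f (at y) a) (at x) b =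
         frechet_derivative (\<lambda>y. frechet_derivative f (at y) b) (at x) a"
proof -
  define P where "P = (\<lambda>y. frechet_derivative (\<lambda>y. frechet_derivative f (at y) a) (at y) b)"
  define Q where "Q = (\<lambda>y. frechet_derivative (\<lambda>y. frechet_derivative f (at y) b) (at y) a)"
  have f2: "ck_on (Suc (Suc 0)) S f" using f by (simp only: numeral_2_eq_2)
  have cP: "isCont P x" and cQ: "isCont Q x"
    using f2 S x by (auto simp: P_def Q_def continuous_on_eq_continuous_at)
  have "\<bar>P x - Q x\<bar> \<le> 2 * e" if e: "e > 0" for e
  proof -
    obtain d where d: "d > 0" "\<And>y. dist y x < d \<Longrightarrow> dist (P y) (P x) < e \<and> dist (Q y) (Q x) < e \<and> y \<in> S"
    proof -
      have "\<forall>\<^sub>F y in nhds x. dist (P y) (P x) < e \<and> dist (Q y) (Q x) < e \<and> y \<in> S"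
        using cP cQ e S x by (intro eventually_conj)
          (auto simp: isCont_def tendsto_iff eventually_nhds_conv_at dest: eventually_nhds_in_open)
      then show ?thesis using that by (auto simp: eventually_nhds_metric)
    qed
    \<comment> \<open>All points of the parallelogram then lie within d/2 of \<open>x\<close>; the
      summand 1 keeps the denominator positive when \<open>a\<close> and \<open>b\<close>
      vanish.\<close>
    define h where "h = d / (2 * (norm a + norm b + 1))"
    have n: "norm a + norm b + 1 > 0" by (simp add: add_nonneg_pos)
    have h: "h > 0" using d n by (simp add: h_def)
    have near: "dist (x + s *\<^sub>R a + t *\<^sub>R b) x < d" if "0 \<le> s" "s \<le> h" "0 \<le> t" "t \<le> h" for s t
    proof -
      have "dist (x + s *\<^sub>R a + t *\<^sub>R b) x \<le> s * norm a + t * norm b"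
        using norm_triangle_ineq[of "s *\<^sub>R a" "t *\<^sub>R b"] that by (simp add: dist_norm add.assoc)
      also have "\<dots> \<le> h * norm a + h * norm b"
        using that by (intro add_mono mult_right_mono) auto
      also have "\<dots> \<le> h * (norm a + norm b + 1)" using h by (simp add: algebra_simps)
      also have "\<dots> = d / 2" using n by (simp add: h_def field_simps)
      also have "\<dots> < d" using d by simp
      finally show ?thesis .
    qed
    obtain s t where st: "0 \<le> s" "s \<le> h" "0 \<le> t" "t \<le> h" and
      1: "f (x + h *\<^sub>R a + h *\<^sub>R b) - f (x + h *\<^sub>R a) - f (x + h *\<^sub>R b) + f x = h * h * P (x + s *\<^sub>R a + t *\<^sub>R b)"
      unfolding P_def by (rule second_derivative_approx[OF S f h]) (use near d in blast)+
    obtain s' t' where st': "0 \<le> s'" "s' \<le> h" "0 \<le> t'" "t' \<le> h" and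
      2: "f (x + h *\<^sub>R b + h *\<^sub>R a) - f (x + h *\<^sub>R b) - f (x + h *\<^sub>R a) + f x = h * h * Q (x + s' *\<^sub>R b + t' *\<^sub>R a)"
      unfolding Q_def
    proof (rule second_derivative_approx[OF S f h])
      fix s t assume "0 \<le> s" "s \<le> h" "0 \<le> t" "t \<le> h"
      then show "x + s *\<^sub>R b + t *\<^sub>R a \<in> S" using near[of t s] d by (simp add: algebra_simps)
    qed blast
    have "h * h * P (x + s *\<^sub>R a + t *\<^sub>R b) = h * h * Q (x + s' *\<^sub>R b + t' *\<^sub>R a)"
      using 1 2 by (simp add: algebra_simps)
    then have eq: "P (x + s *\<^sub>R a + t *\<^sub>R b) = Q (x + s' *\<^sub>R b + t' *\<^sub>R a)" using h by simp
    have "dist (P (x + s *\<^sub>R a + t *\<^sub>R b)) (P x) < e" using d near st by blast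
    moreover have "dist (Q (x + s' *\<^sub>R b + t' *\<^sub>R a)) (Q x) < e"
      using d near[of t' s'] st' by (simp add: algebra_simps)
    ultimately show ?thesis unfolding eq dist_real_def by linarith
  qed
  \<comment> \<open>With e a quarter of the distance, the bound 2 e is only half of it, so the
    distance is 0.\<close>
  from this[of "\<bar>P x - Q x\<bar> / 4"] have "P x = Q x" by (cases "P x = Q x") auto
  then show ?thesis by (simp add: P_def Q_def)
qed

text \<open>\<open>ck_on\<close> provides continuity of the derivative in each fixed direction only.
  The sum of its norms over \<open>Basis\<close> is therefore what is bounded on the compact ball;
  it dominates the operator norm, and convexity allows the mean value inequality.\<close>

lemma ck1_Lipschitz_on_cball:
  fixes V :: "'a::euclidean_space \<Rightarrow> 'a"
  assumes S: "open S" and V: "ck_on 1 S V" and sub: "cball y b \<subseteq> S"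
  obtains L where "L > 0" "\<And>u v. u \<in> cball y b \<Longrightarrow> v \<in> cball y b \<Longrightarrow> norm (V u - V v) \<le> L * norm (u - v)"
proof -
  let ?n = "\<lambda>x. \<Sum>i\<in>Basis. norm (frechet_derivative V (at x) i)"
  have V1: "ck_on (Suc 0) S V" using V by simp
  have "continuous_on (cball y b) ?n"
    using V1 sub by (intro continuous_intros) (auto intro: continuous_on_subset)
  then have "compact (?n ` cball y b)" by (intro compact_continuous_image) auto
  then have "bounded (?n ` cball y b)" by (rule compact_imp_bounded)
  then obtain L where L: "L > 0" "\<And>x. x \<in> cball y b \<Longrightarrow> norm (?n x) \<le> L"
    unfolding bounded_pos by blast
  show ?thesis
  proof (rule that[OF L(1)])
    fix u v assume uv: "u \<in> cball y b" "v \<in> cball y b"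
    show "norm (V u - V v) \<le> L * norm (u - v)"
    proof (rule differentiable_bound[OF convex_cball _ _ uv(1) uv(2)])
      fix x assume x: "x \<in> cball y b"
      then have d: "(V has_derivative frechet_derivative V (at x)) (at x)"
        using ck_on_has_derivative[OF V1] sub by blast
      then show "(V has_derivative frechet_derivative V (at x)) (at x within cball y b)"
        by (rule has_derivative_at_withinI)
      have lin: "linear (frechet_derivative V (at x))" using d has_derivative_linear by blast
      show "onorm (frechet_derivative V (at x)) \<le> L"
      proof (rule onorm_le)
        fix w
        have "frechet_derivative V (at x) w = frechet_derivative V (at x) (\<Sum>i\<in>Basis. (w \<bullet> i) *\<^sub>R i)"
          by (simp add: euclidean_representation)
        also have "\<dots> = (\<Sum>i\<in>Basis. (w \<bullet> i) *\<^sub>R frechet_derivative V (at x) i)"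
          by (simp add: linear_sum[OF lin] linear_cmul[OF lin])
        also have "norm \<dots> \<le> (\<Sum>i\<in>Basis. norm w * norm (frechet_derivative V (at x) i))"
          by (intro sum_norm_le) (simp add: mult_right_mono Basis_le_norm)
        also have "\<dots> = norm w * ?n x" by (simp add: sum_distrib_left)
        also have "\<dots> \<le> norm w * L" using L(2)[OF x] by (intro mult_left_mono) auto
        finally show "norm (frechet_derivative V (at x) w) \<le> L * norm w" by (simp add: mult.commute)
      qed
    qed
  qed
qed

text \<open>The fixed point is sought among bounded continuous curves on the whole line with values
  in a closed ball, a complete set; time is clamped so that only the interval from -e to e
  matters.\<close>

lemma picard_lindeloef:
  fixes V :: "'a::euclidean_space \<Rightarrow> 'a"
  assumes S: "open S" and V: "ck_on 1 S V" and y0: "y0 \<in> S"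
  obtains e y where "e > 0" "y 0 = y0" "\<And>t. t \<in> {-e<..<e} \<Longrightarrow> y t \<in> S"
    "\<And>t. t \<in> {-e<..<e} \<Longrightarrow> (y has_vector_derivative V (y t)) (at t)"
proof -
  obtain b where b: "b > 0" "cball y0 b \<subseteq> S" using S y0 open_contains_cball by blast
  obtain L where L: "L > 0" "\<And>u v. u \<in> cball y0 b \<Longrightarrow> v \<in> cball y0 b \<Longrightarrow> norm (V u - V v) \<le> L * norm (u - v)"
    using ck1_Lipschitz_on_cball[OF S V b(2)] by blast
  have cV: "continuous_on (cball y0 b) V"
    using ck_on_continuous[OF V] b(2) continuous_on_subset by blast
  then have "bounded (V ` cball y0 b)" by (intro compact_imp_bounded compact_continuous_image compact_cball)
  then obtain K where K: "K > 0" "\<And>x. x \<in> cball y0 b \<Longrightarrow> norm (V x) \<le> K"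
    unfolding bounded_pos by blast
  \<comment> \<open>The bound 4 K e \<le> b keeps the integral operator inside the ball, 4 L e \<le>
    1/2 makes it a contraction. The 4 stems from two integrals, each over an interval of length at
    most 2 e.\<close>
  define e where "e = min (b / (4 * K)) (1 / (8 * L))"
  have e: "e > 0" "4 * K * e \<le> b" "4 * L * e \<le> 1/2"
    using b(1) K(1) L(1) by (auto simp: e_def min_def field_simps)
  define X where "X = (PiC UNIV (\<lambda>_. cball y0 b) :: (real \<Rightarrow>\<^sub>C 'a) set)"
  have uX: "apply_bcontfun u t \<in> cball y0 b" if "u \<in> X" for u t
    using that by (auto simp: X_def mem_PiC_iff)
  define cl where "cl = (\<lambda>t. max (-e) (min e t))"
  have cl: "cl t \<in> {-e..e}" for t using e(1) by (auto simp: cl_def)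
  \<comment> \<open>The lower limit -e serves both signs of time: \<open>I w s - I w 0\<close> is
    the oriented integral from 0 to s.\<close>
  define I where "I = (\<lambda>w::real\<Rightarrow>'a. \<lambda>s. integral {-e..s} w)"
  define T where "T = (\<lambda>w::real\<Rightarrow>'a. \<lambda>t. y0 + (I w (cl t) - I w 0))"
  have Ib: "norm (I w s - I w 0) \<le> 4 * B * e"
    if w: "continuous_on UNIV w" and B: "\<And>t. norm (w t) \<le> B" and s: "s \<in> {-e..e}" for w B s
  proof -
    have B0: "B \<ge> 0" using norm_ge_zero B order_trans by blast
    have i: "norm (I w r) \<le> B * (2 * e)" if "r \<in> {-e..e}" for r
    proof -
      have "norm (I w r) \<le> B * (r - - e)"
        unfolding I_def using that B w by (intro integral_bound) (auto intro: continuous_on_subset)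
      also have "\<dots> \<le> B * (2 * e)" using that B0 by (intro mult_left_mono) auto
      finally show ?thesis .
    qed
    have "norm (I w s - I w 0) \<le> norm (I w s) + norm (I w 0)" by (rule norm_triangle_ineq4)
    also have "\<dots> \<le> 4 * B * e" using i[OF s] i[of 0] e(1) by simp
    finally show ?thesis .
  qed
  have Ic: "continuous_on {-e..e} (I w)" if "continuous_on UNIV w" for w
    unfolding I_def using that
    by (intro indefinite_integral_continuous_1 integrable_continuous_interval) (auto intro: continuous_on_subset)
  have wc: "continuous_on UNIV (\<lambda>t. V (apply_bcontfun u t))" if "u \<in> X" for u
    by (rule continuous_on_compose2[OF cV]) (use uX[OF that] in auto)
  have TX: "T (\<lambda>t. V (apply_bcontfun u t)) \<in> bcontfun \<and> (\<forall>t. T (\<lambda>t. V (apply_bcontfun u t)) t \<in> cball y0 b)" if u: "u \<in> X" for u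
  proof -
    let ?w = "\<lambda>t. V (apply_bcontfun u t)"
    have 1: "T ?w t \<in> cball y0 b" for t
      using order_trans[OF Ib[OF wc[OF u] K(2)[OF uX[OF u]] cl[of t]] e(2)]
      by (simp add: T_def dist_norm norm_minus_commute)
    have "continuous_on UNIV (\<lambda>t. I ?w (cl t))"
      by (rule continuous_on_compose2[OF Ic[OF wc[OF u]]]) (use cl in \<open>auto simp: cl_def intro!: continuous_intros\<close>)
    then have 2: "continuous_on UNIV (T ?w)" unfolding T_def by (intro continuous_intros)
    have "bounded (range (T ?w))" by (rule bounded_subset[OF bounded_cball[of y0 b]]) (use 1 in auto)
    with 1 2 show ?thesis by (simp add: bcontfun_def)
  qed
  define P where "P = (\<lambda>u. Bcontfun (T (\<lambda>t. V (apply_bcontfun u t))))"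
  have aP: "apply_bcontfun (P u) = T (\<lambda>t. V (apply_bcontfun u t))" if "u \<in> X" for u
    using TX[OF that] by (simp add: P_def Bcontfun_inverse)
  have "\<exists>!u. u \<in> X \<and> P u = u"
  proof (rule Banach_fix)
    show "complete X" unfolding X_def complete_eq_closed by (intro closed_PiC) auto
    have "const_bcontfun y0 \<in> X" using b(1) by (auto simp: X_def mem_PiC_iff const_bcontfun.rep_eq)
    then show "X \<noteq> {}" by auto
    show "P ` X \<subseteq> X" using TX aP by (auto simp: X_def mem_PiC_iff)
    show "dist (P u) (P v) \<le> 1/2 * dist u v" if u: "u \<in> X" and v: "v \<in> X" for u v
    proof (rule dist_bound)
      fix t
      let ?w = "\<lambda>t. V (apply_bcontfun u t)" let ?z = "\<lambda>t. V (apply_bcontfun v t)"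
      have diff: "I (\<lambda>t. ?w t - ?z t) s = I ?w s - I ?z s" for s
        unfolding I_def using wc[OF u] wc[OF v]
        by (intro integral_diff integrable_continuous_interval) (auto intro: continuous_on_subset)
      have "norm (I (\<lambda>t. ?w t - ?z t) (cl t) - I (\<lambda>t. ?w t - ?z t) 0) \<le> 4 * (L * dist u v) * e"
      proof (rule Ib[OF _ _ cl])
        show "continuous_on UNIV (\<lambda>t. ?w t - ?z t)" by (intro continuous_intros wc u v)
        show "norm (?w t - ?z t) \<le> L * dist u v" for t
        proof -
          have "norm (?w t - ?z t) \<le> L * dist (apply_bcontfun u t) (apply_bcontfun v t)"
            using L(2)[OF uX[OF u] uX[OF v]] by (simp add: dist_norm)
          also have "\<dots> \<le> L * dist u v" using L(1) dist_bounded by (intro mult_left_mono) auto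
          finally show ?thesis .
        qed
      qed
      also have "4 * (L * dist u v) * e \<le> 1/2 * dist u v"
        using mult_right_mono[OF e(3), of "dist u v"] by (simp add: algebra_simps)
      finally show "dist (apply_bcontfun (P u) t) (apply_bcontfun (P v) t) \<le> 1/2 * dist u v"
        by (simp add: aP u v T_def dist_norm diff algebra_simps)
    qed
  qed auto
  then obtain u where u: "u \<in> X" "P u = u" by blast
  let ?y = "apply_bcontfun u"
  let ?w = "\<lambda>t. V (?y t)"
  have yT: "?y t = y0 + (I ?w (cl t) - I ?w 0)" for t
    using fun_cong[OF aP[OF u(1)], of t] unfolding u(2) by (simp add: T_def)
  show ?thesis
  proof (rule that[OF e(1), of ?y])
    show "?y 0 = y0" using yT[of 0] e(1) by (simp add: cl_def)
    show "?y t \<in> S" for t using uX[OF u(1)] b(2) by blast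
    fix t assume t: "t \<in> {-e<..<e}"
    have "(I ?w has_vector_derivative ?w t) (at t within {-e..e})"
      unfolding I_def using t wc[OF u(1)]
      by (intro integral_has_vector_derivative) (auto intro: continuous_on_subset)
    then have "(I ?w has_vector_derivative ?w t) (at t)"
      using t by (simp add: at_within_Icc_at)
    then have "((\<lambda>t. y0 + (I ?w t - I ?w 0)) has_vector_derivative ?w t) (at t)"
      by (auto intro!: derivative_eq_intros)
    then show "(?y has_vector_derivative ?w t) (at t)"
    proof (rule has_vector_derivative_transform_within_open[of _ _ _ "{-e<..<e}"])
      show "y0 + (I ?w r - I ?w 0) = ?y r" if "r \<in> {-e<..<e}" for r
        using yT[of r] that by (auto simp: cl_def)
    qed (use t in auto)
  qed
qed

text \<open>Bootstrap: if \<open>y\<close> is of class k, so is its derivative V(y), hence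
  \<open>y\<close> is of class k + 1.\<close>

lemma ode_solution_smooth:
  fixes V :: "'a::euclidean_space \<Rightarrow> 'a"
  assumes S: "open S" and V: "smooth_on S V" and J: "open J"
    and y: "\<And>t. t \<in> J \<Longrightarrow> y t \<in> S" "\<And>t. t \<in> J \<Longrightarrow> (y has_vector_derivative V (y t)) (at t)"
  shows "smooth_on J y"
  unfolding smooth_on_def
proof
  fix k show "ck_on k J y"
  proof (induction k)
    case 0
    show ?case using y(2) by (auto intro!: continuous_at_imp_continuous_on has_vector_derivative_continuous)
  next
    case (Suc k)
    show ?case
    proof (rule ck_on_SucI[OF J])
      show "(y has_derivative (\<lambda>v. v *\<^sub>R V (y t))) (at t)" if "t \<in> J" for t
        using y(2)[OF that] by (simp add: has_vector_derivative_def)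
      have "ck_on k J (\<lambda>t. V (y t))"
        by (rule ck_on_compose[OF J S _ Suc]) (use y V in \<open>auto simp: smooth_on_def\<close>)
      then show "ck_on k J (\<lambda>t. v *\<^sub>R V (y t))" for v
        by (rule ck_on_bounded_linear[OF J bounded_linear_scaleR_right])
    qed
  qed
qed

section \<open>The Levi-Civita connection in coordinates\<close>

lemma matrix_mult_add_rdistrib: "(A + B) ** C = A ** C + B ** (C :: real^'p^'n::finite)"
  by (vector matrix_matrix_mult_def sum.distrib[symmetric] field_simps)

lemma transpose_add: "transpose (A + B) = transpose A + transpose (B :: real^'n^'m)"
  by (simp add: transpose_def vec_eq_iff)

lemma bounded_linear_transpose: "bounded_linear (transpose :: real^'n^'m \<Rightarrow> real^'m^'n)"
  by (simp add: linear_conv_bounded_linear[symmetric], rule linearI) (auto simp: transpose_def vec_eq_iff)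

lemma bounded_linear_trace: "bounded_linear (trace :: real^'n^'n \<Rightarrow> real)"
  by (simp add: linear_conv_bounded_linear[symmetric], rule linearI)
    (auto simp: trace_def sum.distrib sum_distrib_left)

lemma bounded_bilinear_matrix_mult:
  "bounded_bilinear ((**) :: real^'n^'m \<Rightarrow> real^'p^'n \<Rightarrow> real^'p^'m)"
  by (simp add: bilinear_conv_bounded_bilinear[symmetric] bilinear_def, intro conjI allI linearI)
    (auto simp: matrix_matrix_mult_def vec_eq_iff sum.distrib sum_distrib_left algebra_simps)

lemma bounded_bilinear_matrix_vector_mult:
  "bounded_bilinear ((*v) :: real^'n^'m \<Rightarrow> real^'n \<Rightarrow> real^'m)"
  by (simp add: bilinear_conv_bounded_bilinear[symmetric] bilinear_def, intro conjI allI linearI)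
    (auto simp: matrix_vector_mult_def vec_eq_iff sum.distrib sum_distrib_left algebra_simps)

lemma matrix_inner_left: "(A *v x) \<bullet> y = x \<bullet> (transpose A *v (y :: real^'m))"
  by (metis dot_lmul_matrix inner_commute transpose_matrix_vector)

lemma symmetric_matrix_inner: "transpose A = A \<Longrightarrow> (A *v x) \<bullet> y = x \<bullet> (A *v (y :: real^'m))"
  by (simp add: matrix_inner_left del: transpose_matrix_vector)

lemma transpose_matrix_inv:
  assumes "invertible (A :: real^'n^'n)" shows "transpose (matrix_inv A) = matrix_inv (transpose A)"
proof -
  have i: "invertible (transpose A)" using assms by (rule transpose_invertible)
  have "transpose (matrix_inv A) ** transpose A = mat 1"
    by (metis matrix_inv_right[OF assms] matrix_transpose_mul transpose_mat)
  then have "transpose (matrix_inv A) ** (transpose A ** matrix_inv (transpose A)) = matrix_inv (transpose A)"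
    by (simp add: matrix_mul_assoc)
  then show ?thesis by (simp add: matrix_inv_right[OF i])
qed

definition posdef :: "real^'n^'n \<Rightarrow> bool" where
  "posdef A \<longleftrightarrow> transpose A = A \<and> (\<forall>v. v \<noteq> 0 \<longrightarrow> v \<bullet> (A *v v) > 0)"

lemma posdef_invertible: "posdef A \<Longrightarrow> invertible A"
  unfolding posdef_def invertible_left_inverse matrix_left_invertible_ker
  by (metis inner_zero_right less_irrefl)

lemma posdef_nth_commute: "posdef A \<Longrightarrow> A $ i $ j = A $ j $ i"
  unfolding posdef_def by (metis transpose_def vec_lambda_beta)

text \<open>The formula of \<open>christoffel\<close> for an arbitrary matrix-valued function on
  coordinate space, which keeps charts out of the local computations.\<close>

definition christoffel_symbol :: "(real^'m \<Rightarrow> real^'m^'m) \<Rightarrow> 'm::finite \<Rightarrow> 'm \<Rightarrow> 'm \<Rightarrow> real^'m \<Rightarrow> real" where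
  "christoffel_symbol G k i j x = (1/2) * (\<Sum>l\<in>UNIV. matrix_inv (G x) $ k $ l *
        (partial i (\<lambda>y. G y $ j $ l) x + partial j (\<lambda>y. G y $ i $ l) x - partial l (\<lambda>y. G y $ i $ j) x))"

text \<open>The matrix C(u) for which w' + C(u) w is the covariant derivative of a vector field w
  along a curve with velocity u.\<close>

definition connection_matrix :: "(real^'m \<Rightarrow> real^'m^'m) \<Rightarrow> real^'m::finite \<Rightarrow> real^'m \<Rightarrow> real^'m^'m" where
  "connection_matrix G x u = (\<chi> k j. \<Sum>i\<in>UNIV. christoffel_symbol G k i j x * u $ i)"

lemma connection_matrix_add: "connection_matrix G x (u + v) = connection_matrix G x u + connection_matrix G x v"
  by (simp add: connection_matrix_def vec_eq_iff sum.distrib algebra_simps)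

lemma has_derivative_vec_nth:
  fixes f :: "'a::real_normed_vector \<Rightarrow> 'b::euclidean_space^'n::finite"
  assumes "(f has_derivative f') F" shows "((\<lambda>x. f x $ i) has_derivative (\<lambda>v. f' v $ i)) F"
  by (rule bounded_linear.has_derivative[OF bounded_linear_vec_nth assms])

lemma smooth_on_nth:
  fixes f :: "'a::real_normed_vector \<Rightarrow> 'b::euclidean_space^'n::finite"
  shows "open S \<Longrightarrow> smooth_on S f \<Longrightarrow> smooth_on S (\<lambda>x. f x $ i)"
  by (rule smooth_on_bounded_linear[OF _ bounded_linear_vec_nth])

lemma smooth_on_matrix:
  fixes f :: "'a::real_normed_vector \<Rightarrow> real^'n::finite^'m::finite"
  shows "open S \<Longrightarrow> (\<And>i j. smooth_on S (\<lambda>x. f x $ i $ j)) \<Longrightarrow> smooth_on S f"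
  unfolding smooth_on_def by (intro allI ck_on_vec) auto

lemma frechet_nth:
  fixes f :: "'a::real_normed_vector \<Rightarrow> 'b::euclidean_space^'n::finite"
  assumes "(f has_derivative f') (at x)"
  shows "frechet_derivative (\<lambda>x. f x $ i) (at x) v = f' v $ i"
  using frechet_derivative_at[OF has_derivative_vec_nth[OF assms, of i]] by metis

lemma linear_axis_sum:
  assumes "linear (f :: real^'n::finite \<Rightarrow> 'a::real_vector)"
  shows "f u = (\<Sum>i\<in>UNIV. u $ i *\<^sub>R f (axis i 1))"
proof -
  have "f u = f (\<Sum>i\<in>UNIV. u $ i *\<^sub>R axis i 1)"
    using basis_expansion[of u] by (simp add: scalar_mult_eq_scaleR)
  then show ?thesis by (simp add: linear_sum[OF assms] linear_cmul[OF assms])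
qed

lemma partial_metric_commute:
  fixes G :: "real^'m::finite \<Rightarrow> real^'m^'m"
  assumes U: "open U" "x \<in> U" and G: "smooth_on U G" and pd: "\<And>y. y \<in> U \<Longrightarrow> posdef (G y)"
  shows "partial k (\<lambda>y. G y $ i $ j) x = partial k (\<lambda>y. G y $ j $ i) x"
proof -
  have "frechet_derivative (\<lambda>y. G y $ i $ j) (at x) = frechet_derivative (\<lambda>y. G y $ j $ i) (at x)"
  proof (rule frechet_derivative_at)
    show "((\<lambda>y. G y $ j $ i) has_derivative frechet_derivative (\<lambda>y. G y $ i $ j) (at x)) (at x)"
      apply (rule has_derivative_transform_within_open[OF _ U, of "\<lambda>y. G y $ i $ j"])
       apply (rule smooth_on_has_derivative[OF _ U(2)])
       apply (intro smooth_on_nth U G)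
      using posdef_nth_commute[OF pd] by simp
  qed
  then show ?thesis by (simp add: partial_def)
qed

text \<open>The Levi-Civita connection is metric.\<close>

lemma metric_derivative:
  fixes G :: "real^'m::finite \<Rightarrow> real^'m^'m"
  assumes U: "open U" "x \<in> U" and G: "smooth_on U G" and pd: "\<And>y. y \<in> U \<Longrightarrow> posdef (G y)"
  shows "frechet_derivative G (at x) u = transpose (connection_matrix G x u) ** G x + G x ** connection_matrix G x u"
proof -
  have d: "(G has_derivative frechet_derivative G (at x)) (at x)"
    by (rule smooth_on_has_derivative[OF G U(2)])
  define D where "D = (\<lambda>k i j. partial k (\<lambda>y. G y $ i $ j) x)"
  have Dsym: "D k i j = D k j i" for k i j
    unfolding D_def by (rule partial_metric_commute[OF assms])
  have D: "frechet_derivative G (at x) u $ a $ b = (\<Sum>k\<in>UNIV. u $ k * D k a b)" for a b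
  proof -
    have lin: "linear (frechet_derivative G (at x))" using d has_derivative_linear by blast
    have "D k a b = frechet_derivative G (at x) (axis k 1) $ a $ b" for k
      using frechet_nth[OF has_derivative_vec_nth[OF d]] by (simp add: D_def partial_def)
    then show ?thesis by (subst linear_axis_sum[OF lin]) simp
  qed
  \<comment> \<open>Lowering the upper index gives the Christoffel symbol of the first kind, in
    which no inverse matrix is left.\<close>
  have low: "(\<Sum>k\<in>UNIV. G x $ l $ k * christoffel_symbol G k i j x) = (D i j l + D j i l - D l i j) / 2" for l i j
  proof -
    have GK: "G x ** matrix_inv (G x) = mat 1"
      by (rule matrix_inv_right[OF posdef_invertible[OF pd[OF U(2)]]])
    have "(\<Sum>k\<in>UNIV. G x $ l $ k * christoffel_symbol G k i j x) =
      (\<Sum>k\<in>UNIV. \<Sum>r\<in>UNIV. (G x $ l $ k * matrix_inv (G x) $ k $ r) * ((D i j r + D j i r - D r i j) / 2))"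
      by (simp add: christoffel_symbol_def D_def sum_distrib_left mult.assoc)
    also have "\<dots> = (\<Sum>r\<in>UNIV. (\<Sum>k\<in>UNIV. G x $ l $ k * matrix_inv (G x) $ k $ r) * ((D i j r + D j i r - D r i j) / 2))"
      by (subst sum.swap) (simp only: sum_distrib_right)
    also have "\<dots> = (\<Sum>r\<in>UNIV. (G x ** matrix_inv (G x)) $ l $ r * ((D i j r + D j i r - D r i j) / 2))"
      by (simp add: matrix_matrix_mult_def)
    also have "\<dots> = (\<Sum>r\<in>UNIV. if l = r then (D i j r + D j i r - D r i j) / 2 else 0)"
      by (intro sum.cong refl) (simp add: GK mat_def)
    also have "\<dots> = (D i j l + D j i l - D l i j) / 2" by simp
    finally show ?thesis .
  qed
  have GC: "(G x ** connection_matrix G x u) $ a $ b = (\<Sum>i\<in>UNIV. u $ i * ((D i b a + D b i a - D a i b) / 2))" for a b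
  proof -
    have "(G x ** connection_matrix G x u) $ a $ b = (\<Sum>k\<in>UNIV. \<Sum>i\<in>UNIV. u $ i * (G x $ a $ k * christoffel_symbol G k i b x))"
      by (simp add: matrix_matrix_mult_def connection_matrix_def sum_distrib_left algebra_simps)
    also have "\<dots> = (\<Sum>i\<in>UNIV. u $ i * (\<Sum>k\<in>UNIV. G x $ a $ k * christoffel_symbol G k i b x))"
      by (subst sum.swap) (simp only: sum_distrib_left)
    finally show ?thesis by (simp add: low)
  qed
  have "transpose (connection_matrix G x u) ** G x = transpose (G x ** connection_matrix G x u)"
    using pd[OF U(2)] by (simp add: matrix_transpose_mul posdef_def)
  then have CG: "(transpose (connection_matrix G x u) ** G x) $ a $ b = (\<Sum>i\<in>UNIV. u $ i * ((D i a b + D a i b - D b i a) / 2))" for a b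
    using GC[of b a] by (simp add: transpose_def)
  show ?thesis
    unfolding vec_eq_iff
  proof (intro allI)
    fix a b
    have "(transpose (connection_matrix G x u) ** G x + G x ** connection_matrix G x u) $ a $ b =
      (\<Sum>i\<in>UNIV. u $ i * ((D i a b + D a i b - D b i a) / 2) + u $ i * ((D i b a + D b i a - D a i b) / 2))"
      by (simp add: CG GC sum.distrib)
    \<comment> \<open>The terms in which a or b is the direction of differentiation cancel.\<close>
    also have "\<dots> = (\<Sum>i\<in>UNIV. u $ i * D i a b)"
      by (intro sum.cong refl) (simp add: Dsym[of _ b a] field_simps)
    finally show "frechet_derivative G (at x) u $ a $ b =
      (transpose (connection_matrix G x u) ** G x + G x ** connection_matrix G x u) $ a $ b" by (simp add: D)
  qed
qed

lemma christoffel_symbol_commute: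
  fixes G :: "real^'m::finite \<Rightarrow> real^'m^'m"
  assumes U: "open U" "x \<in> U" and G: "smooth_on U G" and pd: "\<And>y. y \<in> U \<Longrightarrow> posdef (G y)"
  shows "christoffel_symbol G k i j x = christoffel_symbol G k j i x"
proof -
  have "partial l (\<lambda>y. G y $ i $ j) x = partial l (\<lambda>y. G y $ j $ i) x" for l
    by (rule partial_metric_commute[OF assms])
  then show ?thesis by (simp add: christoffel_symbol_def algebra_simps)
qed

text \<open>Torsion-freeness of the connection; it is what makes the second fundamental form
  symmetric.\<close>

lemma connection_matrix_commute:
  fixes G :: "real^'m::finite \<Rightarrow> real^'m^'m"
  assumes "open U" "x \<in> U" "smooth_on U G" "\<And>y. y \<in> U \<Longrightarrow> posdef (G y)"
  shows "connection_matrix G x u *v v = connection_matrix G x v *v u"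
proof -
  have "(connection_matrix G x u *v v) $ k = (\<Sum>i\<in>UNIV. \<Sum>j\<in>UNIV. christoffel_symbol G k j i x * u $ j * v $ i)" for u v k
    by (simp add: connection_matrix_def matrix_vector_mult_def sum_distrib_right)
  note e = this
  show ?thesis
    unfolding vec_eq_iff e
    by (subst sum.swap) (simp add: christoffel_symbol_commute[OF assms] mult_ac)
qed

lemma smooth_on_christoffel_symbol:
  fixes G :: "real^'m::finite \<Rightarrow> real^'m^'m"
  assumes U: "open U" and G: "smooth_on U G" and pd: "\<And>y. y \<in> U \<Longrightarrow> posdef (G y)"
  shows "smooth_on U (christoffel_symbol G k i j)"
  unfolding christoffel_symbol_def[abs_def]
  by (intro smooth_on_mult smooth_on_sum smooth_on_matrix_inv smooth_on_add smooth_on_diff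
      smooth_on_partial smooth_on_nth smooth_on_const U G posdef_invertible pd)

lemma smooth_on_Pair:
  fixes f :: "'a::real_normed_vector \<Rightarrow> 'b::euclidean_space" and g :: "'a \<Rightarrow> 'c::euclidean_space"
  assumes "open S" "smooth_on S f" "smooth_on S g"
  shows "smooth_on S (\<lambda>x. (f x, g x))"
proof -
  have "smooth_on S (\<lambda>x. (f x, 0) + (0, g x))"
    by (intro smooth_on_add assms smooth_on_bounded_linear[OF assms(1) _ assms(2)]
        smooth_on_bounded_linear[OF assms(1) _ assms(3)] bounded_linear_Pair
        bounded_linear_ident bounded_linear_zero)
  then show ?thesis by simp
qed

text \<open>The geodesic equation as a first-order system with the velocity \<open>v\<close> as a
  separate unknown. Smoothness of \<open>x\<close> is included because \<open>coord_geodesic\<close>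
  asks for it.\<close>

definition geodesic_coords :: "(real^'m \<Rightarrow> real^'m^'m) \<Rightarrow> real set \<Rightarrow> (real \<Rightarrow> real^'m::finite) \<Rightarrow> (real \<Rightarrow> real^'m) \<Rightarrow> bool" where
  "geodesic_coords G J x v \<longleftrightarrow> smooth_on J x \<and>
    (\<forall>t\<in>J. (x has_vector_derivative v t) (at t) \<and>
      (v has_vector_derivative - (connection_matrix G (x t) (v t) *v v t)) (at t))"

text \<open>The first-order system is an autonomous equation on the product of \<open>U\<close> with
  the velocity space, with a smooth right-hand side.\<close>

lemma geodesic_coords_exists:
  fixes G :: "real^'m::finite \<Rightarrow> real^'m^'m"
  assumes U: "open U" and G: "smooth_on U G" and pd: "\<And>y. y \<in> U \<Longrightarrow> posdef (G y)" and x0: "x0 \<in> U"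
  obtains e x v where "e > 0" "x 0 = x0" "v 0 = v0" "\<And>t. t \<in> {-e<..<e} \<Longrightarrow> x t \<in> U"
    "geodesic_coords G {-e<..<e} x v"
proof -
  let ?S = "U \<times> (UNIV :: (real^'m) set)"
  let ?V = "\<lambda>z. (snd z, - (\<chi> k. \<Sum>j\<in>UNIV. (\<Sum>i\<in>UNIV. christoffel_symbol G k i j (fst z) * snd z $ i) * snd z $ j))"
  have V: "?V z = (snd z, - (connection_matrix G (fst z) (snd z) *v snd z))" for z
    by (simp add: connection_matrix_def matrix_vector_mult_def)
  have S: "open ?S" using U by (intro open_Times) auto
  have f: "smooth_on ?S fst" and s: "smooth_on ?S snd"
    by (intro smooth_on_linear S bounded_linear_fst bounded_linear_snd)+
  have c: "smooth_on ?S (\<lambda>z. christoffel_symbol G k i j (fst z))" for k i j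
    by (rule smooth_on_compose[OF S U _ f smooth_on_christoffel_symbol[OF U G pd]]) auto
  have sm: "smooth_on ?S ?V"
    apply (intro smooth_on_Pair S s smooth_on_minus smooth_on_vec)
    apply (simp, intro smooth_on_sum smooth_on_mult c smooth_on_nth s S)
    done
  then have ck: "ck_on 1 ?S ?V" by (simp add: smooth_on_def)
  obtain e y where e: "e > 0" and y0: "y 0 = (x0, v0)" and y: "\<And>t. t \<in> {-e<..<e} \<Longrightarrow> y t \<in> ?S"
    "\<And>t. t \<in> {-e<..<e} \<Longrightarrow> (y has_vector_derivative ?V (y t)) (at t)"
    using picard_lindeloef[OF S ck, of "(x0, v0)"] x0 by auto
  have ysm: "smooth_on {-e<..<e} y"
    by (rule ode_solution_smooth[OF S sm _ y]) auto
  show ?thesis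
  proof (rule that[OF e])
    show "(fst \<circ> y) 0 = x0" "(snd \<circ> y) 0 = v0" using y0 by auto
    show "(fst \<circ> y) t \<in> U" if "t \<in> {-e<..<e}" for t using y(1)[OF that] by auto
    show "geodesic_coords G {-e<..<e} (fst \<circ> y) (snd \<circ> y)"
      unfolding geodesic_coords_def
    proof (intro conjI ballI)
      show "smooth_on {-e<..<e} (fst \<circ> y)"
        using smooth_on_bounded_linear[OF _ bounded_linear_fst ysm] by (simp add: o_def)
      fix t assume t: "t \<in> {-e<..<e}"
      from bounded_linear.has_vector_derivative[OF bounded_linear_fst y(2)[OF t]]
      show "(fst \<circ> y has_vector_derivative (snd \<circ> y) t) (at t)" by (simp add: o_def)
      from bounded_linear.has_vector_derivative[OF bounded_linear_snd y(2)[OF t]]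
      show "(snd \<circ> y has_vector_derivative - (connection_matrix G ((fst \<circ> y) t) ((snd \<circ> y) t) *v (snd \<circ> y) t)) (at t)"
        unfolding V by (simp add: o_def)
    qed
  qed
qed

section \<open>Conformal submersions in coordinates\<close>

lemma has_vector_derivative_compose_curve:
  assumes "(f has_derivative f') (at (x t))" "(x has_vector_derivative u) (at t)"
  shows "((\<lambda>s. f (x s)) has_vector_derivative f' u) (at t)"
proof -
  have lin: "linear f'" using assms(1) has_derivative_linear by blast
  from has_derivative_compose[OF assms(2)[unfolded has_vector_derivative_def] assms(1)]
  show ?thesis by (simp add: has_vector_derivative_def linear_cmul[OF lin])
qed

text \<open>Inclusion-exclusion on the diagonal values extracts the sum over all six orders of the
  arguments. As \<open>c\<close> is symmetric in its last two arguments only, this collapses to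
  twice the cyclic sum and not to a single value.\<close>

lemma symmetric_trilinear_polarization:
  fixes c :: "'a::real_vector \<Rightarrow> 'a \<Rightarrow> 'a \<Rightarrow> real"
  assumes add: "\<And>u u' v w. c (u + u') v w = c u v w + c u' v w"
    "\<And>u v v' w. c u (v + v') w = c u v w + c u v' w"
    and sym: "\<And>u v w. c u v w = c u w v"
    and zero: "\<And>v. c v v v = 0"
  shows "c u v w + c v w u + c w u v = 0"
proof -
  have add3: "c u v (w + w') = c u v w + c u v w'" for u v w w'
    using add(2) sym by metis
  have "c (u + v + w) (u + v + w) (u + v + w) - c (u + v) (u + v) (u + v) - c (u + w) (u + w) (u + w)
      - c (v + w) (v + w) (v + w) + c u u u + c v v v + c w w w
    = (c u v w + c u w v) + (c v w u + c v u w) + (c w u v + c w v u)"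
    unfolding add add3 by simp
  then show ?thesis using zero sym[of u v w] sym[of v w u] sym[of w u v] by simp
qed

lemma trace_mult_sum: "trace (A ** B) = (\<Sum>i\<in>UNIV. \<Sum>j\<in>UNIV. A $ i $ j * B $ j $ i)"
  by (simp add: trace_def matrix_matrix_mult_def)

lemma inner_axis_matrix: "axis i 1 \<bullet> (A *v axis j 1) = (A::real^'n^'m) $ i $ j"
  by (simp add: matrix_vector_mult_basis inner_axis' column_def)

text \<open>With C the connection matrix, the first assumption says that Q is the covariant
  derivative of P along the curve, the second that v is parallel; in the product rule the connection
  terms cancel.\<close>

lemma has_real_derivative_bilinear_form:
  assumes P: "(P has_vector_derivative Q + transpose C ** P t + P t ** C) (at t)"
    and v: "(v has_vector_derivative - (C *v v t)) (at t)"
    and sym: "transpose (P t) = P t"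
  shows "((\<lambda>s. v s \<bullet> (P s *v (v s :: real^'m))) has_real_derivative v t \<bullet> (Q *v v t)) (at t)"
proof -
  have "((\<lambda>s. v s \<bullet> (P s *v v s)) has_vector_derivative
     v t \<bullet> (P t *v (- (C *v v t)) + (Q + transpose C ** P t + P t ** C) *v v t) + (- (C *v v t)) \<bullet> (P t *v v t)) (at t)"
    by (rule bounded_bilinear.has_vector_derivative[OF bounded_bilinear_inner v
          bounded_bilinear.has_vector_derivative[OF bounded_bilinear_matrix_vector_mult P v]])
  also have "v t \<bullet> (P t *v (- (C *v v t)) + (Q + transpose C ** P t + P t ** C) *v v t) + (- (C *v v t)) \<bullet> (P t *v v t)
    = v t \<bullet> (Q *v v t)"
    by (simp add: matrix_vector_mult_add_rdistrib inner_add_right matrix_inner_left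
        matrix_vector_mul_assoc[symmetric] linear_neg[OF matrix_vector_mul_linear]
        del: transpose_matrix_vector)
  finally show ?thesis by (simp add: has_real_derivative_iff_has_vector_derivative)
qed

text \<open>The map seen in one chart of each manifold: \<open>G\<close> and \<open>H\<close> are
  the metrics of domain and target, \<open>l\<close> stands for the dilation and
  \<open>\<phi>\<close> for f = log r. Surjectivity and conformality enter later.\<close>

locale submersion_coords =
  fixes U :: "(real^'m::finite) set" and V :: "(real^'n::finite) set"
    and \<Phi> :: "real^'m \<Rightarrow> real^'n" and G :: "real^'m \<Rightarrow> real^'m^'m" and H :: "real^'n \<Rightarrow> real^'n^'n"
    and l :: "real^'m \<Rightarrow> real" and \<phi> :: "real^'m \<Rightarrow> real"
  assumes U: "open U" and V: "open V" and \<Phi>V: "\<Phi> ` U \<subseteq> V"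
    and \<Phi>: "smooth_on U \<Phi>" and G: "smooth_on U G" and H: "smooth_on V H"
    and l: "smooth_on U l" and \<phi>: "smooth_on U \<phi>"
    and Gpd: "\<And>x. x \<in> U \<Longrightarrow> posdef (G x)" and Hpd: "\<And>y. y \<in> V \<Longrightarrow> posdef (H y)"
    and lpos: "\<And>x. x \<in> U \<Longrightarrow> l x > 0"
begin

text \<open>\<open>p\<close> is the pulled back metric \<open>\<Phi>\<^sup>* H\<close>, and column \<open>j\<close> of \<open>sff x u\<close> is the value \<open>S(u, \<partial>\<^sub>j)\<close> of the second
  fundamental form of \<open>\<Phi>\<close>. \<open>Q x u\<close> is the covariant derivative of \<open>p\<close> in direction \<open>u\<close>.\<close>

definition J :: "real^'m \<Rightarrow> real^'m^'n" where "J x = matrix (frechet_derivative \<Phi> (at x))"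
definition K :: "real^'m \<Rightarrow> real^'m^'m" where "K x = matrix_inv (G x)"
definition p :: "real^'m \<Rightarrow> real^'m^'m" where "p x = transpose (J x) ** (H (\<Phi> x) ** J x)"
definition sff :: "real^'m \<Rightarrow> real^'m \<Rightarrow> real^'m^'n" where
  "sff x u = frechet_derivative J (at x) u + connection_matrix H (\<Phi> x) (J x *v u) ** J x - J x ** connection_matrix G x u"
definition Q :: "real^'m \<Rightarrow> real^'m \<Rightarrow> real^'m^'m" where
  "Q x u = transpose (sff x u) ** (H (\<Phi> x) ** J x) + transpose (J x) ** (H (\<Phi> x) ** sff x u)"

lemma Phi_deriv: "x \<in> U \<Longrightarrow> (\<Phi> has_derivative (\<lambda>v. J x *v v)) (at x)"
  using smooth_on_has_derivative[OF \<Phi>, of x] has_derivative_linear[of \<Phi> "frechet_derivative \<Phi> (at x)" "at x"]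
  by (simp add: J_def)

lemma J_mult: "x \<in> U \<Longrightarrow> J x *v v = frechet_derivative \<Phi> (at x) v"
  using frechet_derivative_at[OF Phi_deriv] by metis

lemma smooth_J: "smooth_on U J"
proof (rule smooth_on_matrix[OF U])
  fix i j
  show "smooth_on U (\<lambda>x. J x $ i $ j)"
    unfolding J_def matrix_def using smooth_on_nth[OF U smooth_on_frechet_derivative[OF \<Phi>]] by simp
qed

lemma J_deriv: "x \<in> U \<Longrightarrow> (J has_derivative frechet_derivative J (at x)) (at x)"
  by (rule smooth_on_has_derivative[OF smooth_J])

text \<open>Equality of mixed second derivatives, for each component of
  \<open>\<Phi>\<close>.\<close>

lemma dJ_commute: assumes x: "x \<in> U"
  shows "frechet_derivative J (at x) u *v v = frechet_derivative J (at x) v *v u"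
proof -
  have e: "(frechet_derivative J (at x) u *v v) $ k =
     frechet_derivative (\<lambda>y. frechet_derivative (\<lambda>z. \<Phi> z $ k) (at y) v) (at x) u" for u v k
  proof -
    have "((\<lambda>y. (J y *v v) $ k) has_derivative (\<lambda>u. (frechet_derivative J (at x) u *v v) $ k)) (at x)"
      by (intro has_derivative_vec_nth bounded_linear.has_derivative[OF _ J_deriv[OF x]]
          bounded_bilinear.bounded_linear_left[OF bounded_bilinear_matrix_vector_mult])
    then have "((\<lambda>y. frechet_derivative (\<lambda>z. \<Phi> z $ k) (at y) v) has_derivative
        (\<lambda>u. (frechet_derivative J (at x) u *v v) $ k)) (at x)"
    proof (rule has_derivative_transform_within_open[OF _ U x])
      fix y assume "y \<in> U"
      from frechet_nth[OF Phi_deriv[OF this]] show "(J y *v v) $ k = frechet_derivative (\<lambda>z. \<Phi> z $ k) (at y) v"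
        by simp
    qed
    from frechet_derivative_at[OF this] show ?thesis by metis
  qed
  have "ck_on 2 U (\<lambda>z. \<Phi> z $ k)" for k
    using smooth_on_nth[OF U \<Phi>] by (simp add: smooth_on_def)
  from second_derivative_symmetric[OF U this x] show ?thesis
    by (simp add: vec_eq_iff e)
qed

text \<open>Besides \<open>dJ_commute\<close> this rests on the torsion-freeness of both
  connections.\<close>

lemma sff_commute: assumes x: "x \<in> U" shows "sff x u *v v = sff x v *v u"
proof -
  have y: "\<Phi> x \<in> V" using \<Phi>V x by auto
  show ?thesis
    unfolding sff_def matrix_vector_mult_diff_rdistrib matrix_vector_mult_add_rdistrib
      matrix_vector_mul_assoc[symmetric]
    by (simp add: dJ_commute[OF x, of u v] connection_matrix_commute[OF V y H Hpd, of "J x *v u"]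
        connection_matrix_commute[OF U x G Gpd, of u v])
qed

lemma transpose_G: "x \<in> U \<Longrightarrow> transpose (G x) = G x" and transpose_H: "x \<in> U \<Longrightarrow> transpose (H (\<Phi> x)) = H (\<Phi> x)"
  using Gpd Hpd \<Phi>V by (auto simp: posdef_def)

lemma transpose_p: "x \<in> U \<Longrightarrow> transpose (p x) = p x"
  by (simp add: p_def matrix_transpose_mul transpose_H matrix_mul_assoc)

lemma GK: "x \<in> U \<Longrightarrow> G x ** K x = mat 1" and KG: "x \<in> U \<Longrightarrow> K x ** G x = mat 1"
  using Gpd posdef_invertible matrix_inv_right matrix_inv_left by (auto simp: K_def)

lemma transpose_K: "x \<in> U \<Longrightarrow> transpose (K x) = K x"
  unfolding K_def by (simp only: transpose_matrix_inv[OF posdef_invertible[OF Gpd]] transpose_G)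

lemma G_curve:
  assumes "x t \<in> U" "(x has_vector_derivative u) (at t)"
  shows "((\<lambda>s. G (x s)) has_vector_derivative transpose (connection_matrix G (x t) u) ** G (x t) + G (x t) ** connection_matrix G (x t) u) (at t)"
  using has_vector_derivative_compose_curve[OF smooth_on_has_derivative[OF G assms(1)] assms(2)]
  by (simp add: metric_derivative[OF U assms(1) G Gpd])

lemma H_curve:
  assumes "x t \<in> U" "(x has_vector_derivative u) (at t)"
  defines "C \<equiv> connection_matrix H (\<Phi> (x t)) (J (x t) *v u)"
  shows "((\<lambda>s. H (\<Phi> (x s))) has_vector_derivative transpose C ** H (\<Phi> (x t)) + H (\<Phi> (x t)) ** C) (at t)"
proof -
  have y: "\<Phi> (x t) \<in> V" using \<Phi>V assms(1) by auto
  show ?thesis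
  using has_vector_derivative_compose_curve[OF smooth_on_has_derivative[OF H y]
      has_vector_derivative_compose_curve[OF Phi_deriv assms(2)]] assms(1)
  by (simp add: metric_derivative[OF V y H Hpd] C_def)
qed

text \<open>\<open>H\<close> is parallel along the image curve, so the covariant derivative of
  \<open>p\<close> comes from that of \<open>J\<close> alone, which is \<open>sff\<close>.\<close>

lemma p_curve:
  assumes x: "x t \<in> U" "(x has_vector_derivative u) (at t)"
  defines "C \<equiv> connection_matrix G (x t) u"
  shows "((\<lambda>s. p (x s)) has_vector_derivative Q (x t) u + transpose C ** p (x t) + p (x t) ** C) (at t)"
proof -
  define D where "D = connection_matrix H (\<Phi> (x t)) (J (x t) *v u)"
  define E where "E = frechet_derivative J (at (x t)) u"
  let ?J = "J (x t)" and ?H = "H (\<Phi> (x t))" and ?S = "sff (x t) u"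
  \<comment> \<open>The derivative of \<open>J\<close> corrected by the target connection only: it
    splits into the second fundamental form and a term carrying the domain connection.\<close>
  have ES: "E + D ** ?J = ?S + ?J ** C" by (simp add: sff_def C_def D_def E_def)
  have Jc: "((\<lambda>s. J (x s)) has_vector_derivative E) (at t)"
    unfolding E_def by (rule has_vector_derivative_compose_curve[OF J_deriv[OF x(1)] x(2)])
  have Hc: "((\<lambda>s. H (\<Phi> (x s))) has_vector_derivative transpose D ** ?H + ?H ** D) (at t)"
    unfolding D_def by (rule H_curve[OF x])
  have "((\<lambda>s. p (x s)) has_vector_derivative
     transpose ?J ** (?H ** E + (transpose D ** ?H + ?H ** D) ** ?J) + transpose E ** (?H ** ?J)) (at t)"
    unfolding p_def
    by (rule bounded_bilinear.has_vector_derivative[OF bounded_bilinear_matrix_mult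
       bounded_linear.has_vector_derivative[OF bounded_linear_transpose Jc]
       bounded_bilinear.has_vector_derivative[OF bounded_bilinear_matrix_mult Hc Jc]])
  also have "transpose ?J ** (?H ** E + (transpose D ** ?H + ?H ** D) ** ?J) + transpose E ** (?H ** ?J)
    = transpose ?J ** (?H ** (E + D ** ?J)) + transpose (E + D ** ?J) ** (?H ** ?J)"
    by (simp add: matrix_add_ldistrib matrix_mult_add_rdistrib transpose_add matrix_transpose_mul matrix_mul_assoc)
  also have "\<dots> = Q (x t) u + transpose C ** p (x t) + p (x t) ** C"
    unfolding ES Q_def p_def
    by (simp add: matrix_add_ldistrib matrix_mult_add_rdistrib transpose_add matrix_transpose_mul matrix_mul_assoc)
  finally show ?thesis .
qed

text \<open>The metric is parallel, which is the case Q = 0: geodesics have constant speed.\<close>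

lemma G_along_geodesic:
  assumes "geodesic_coords G I x v" "t \<in> I" "x t \<in> U"
  shows "((\<lambda>s. v s \<bullet> (G (x s) *v v s)) has_real_derivative 0) (at t)"
proof -
  have "((\<lambda>s. v s \<bullet> (G (x s) *v v s)) has_real_derivative v t \<bullet> (0 *v v t)) (at t)"
    apply (rule has_real_derivative_bilinear_form[where C = "connection_matrix G (x t) (v t)" and P = "\<lambda>s. G (x s)"])
    using assms G_curve[of x t "v t"] by (auto simp: geodesic_coords_def transpose_G)
  then show ?thesis by simp
qed

lemma p_along_geodesic:
  assumes "geodesic_coords G I x v" "t \<in> I" "x t \<in> U"
  shows "((\<lambda>s. v s \<bullet> (p (x s) *v v s)) has_real_derivative v t \<bullet> (Q (x t) (v t) *v v t)) (at t)"
  apply (rule has_real_derivative_bilinear_form[where C = "connection_matrix G (x t) (v t)" and P = "\<lambda>s. p (x s)"])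
  using assms p_curve[of x t "v t"] by (auto simp: geodesic_coords_def transpose_p)

lemma Q_form: assumes x: "x \<in> U"
  shows "w \<bullet> (Q x u *v w) = 2 * ((J x *v w) \<bullet> (H (\<Phi> x) *v (sff x u *v w)))"
proof -
  have "w \<bullet> (Q x u *v w) = (sff x u *v w) \<bullet> (H (\<Phi> x) *v (J x *v w)) + (J x *v w) \<bullet> (H (\<Phi> x) *v (sff x u *v w))"
    by (simp add: Q_def matrix_vector_mult_add_rdistrib inner_add_right matrix_inner_left
        matrix_vector_mul_assoc[symmetric] del: transpose_matrix_vector)
  also have "(sff x u *v w) \<bullet> (H (\<Phi> x) *v (J x *v w)) = (J x *v w) \<bullet> (H (\<Phi> x) *v (sff x u *v w))"
    by (subst inner_commute) (simp add: symmetric_matrix_inner[OF transpose_H[OF x]])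
  finally show ?thesis by simp
qed

text \<open>The two summands of \<open>Q\<close> are transposes of each other and, multiplied by the
  symmetric \<open>K\<close>, have the same trace.\<close>

lemma trace_Q: assumes x: "x \<in> U"
  shows "trace (K x ** Q x u) = 2 * trace (K x ** (transpose (J x) ** (H (\<Phi> x) ** sff x u)))"
proof -
  have tt: "trace (transpose A) = trace A" for A :: "real^'m^'m" by (simp add: trace_def transpose_def)
  have "trace (K x ** (transpose (sff x u) ** (H (\<Phi> x) ** J x))) =
     trace (transpose (K x ** (transpose (sff x u) ** (H (\<Phi> x) ** J x))))" by (simp add: tt)
  also have "\<dots> = trace ((transpose (J x) ** (H (\<Phi> x) ** sff x u)) ** K x)"
    by (simp add: matrix_transpose_mul transpose_K[OF x] transpose_H[OF x] matrix_mul_assoc)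
  also have "\<dots> = trace (K x ** (transpose (J x) ** (H (\<Phi> x) ** sff x u)))" by (rule trace_mul_sym)
  finally show ?thesis by (simp add: Q_def matrix_add_ldistrib trace_add)
qed

lemma smooth_K: "smooth_on U K"
  unfolding K_def
  by (rule smooth_on_matrix[OF U], rule smooth_on_matrix_inv[OF U smooth_on_nth[OF U smooth_on_nth[OF U G]]])
    (rule posdef_invertible[OF Gpd])

text \<open>The terms with the connection matrix cancel, as the trace is taken with respect to the metric.\<close>

lemma energy_curve:
  assumes x: "x t \<in> U" "(x has_vector_derivative u) (at t)"
  shows "((\<lambda>s. trace (K (x s) ** p (x s))) has_real_derivative trace (K (x t) ** Q (x t) u)) (at t)"
proof -
  define C where "C = connection_matrix G (x t) u"
  define K' where "K' = frechet_derivative K (at (x t)) u"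
  let ?G = "G (x t)" and ?K = "K (x t)" and ?p = "p (x t)" and ?Q = "Q (x t) u"
  have Kc: "((\<lambda>s. K (x s)) has_vector_derivative K') (at t)"
    unfolding K'_def by (rule has_vector_derivative_compose_curve[OF smooth_on_has_derivative[OF smooth_K x(1)] x(2)])
  have Gc: "((\<lambda>s. G (x s)) has_vector_derivative transpose C ** ?G + ?G ** C) (at t)"
    unfolding C_def by (rule G_curve[OF x])
  have pc: "((\<lambda>s. p (x s)) has_vector_derivative ?Q + transpose C ** ?p + ?p ** C) (at t)"
    unfolding C_def by (rule p_curve[OF x])
  have "((\<lambda>s. K (x s) ** G (x s)) has_vector_derivative ?K ** (transpose C ** ?G + ?G ** C) + K' ** ?G) (at t)"
    by (rule bounded_bilinear.has_vector_derivative[OF bounded_bilinear_matrix_mult Kc Gc])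
  moreover have "((\<lambda>s. K (x s) ** G (x s)) has_vector_derivative 0) (at t)"
  proof -
    have "continuous (at t) x" by (rule has_vector_derivative_continuous[OF x(2)])
    then have "\<exists>T. open T \<and> t \<in> T \<and> (\<forall>s\<in>T. x s \<in> U)"
      using U x(1) by (simp add: continuous_at_open)
    then obtain T where T: "open T" "t \<in> T" "\<And>s. s \<in> T \<Longrightarrow> x s \<in> U"
      by (elim exE conjE) simp
    show ?thesis
      by (rule has_vector_derivative_transform_within_open[OF has_vector_derivative_const T(1,2), of "mat 1"])
        (simp add: KG T(3))
  qed
  ultimately have "?K ** (transpose C ** ?G + ?G ** C) + K' ** ?G = 0"
    by (rule vector_derivative_unique_at)
  \<comment> \<open>Multiplying by K p on the right isolates K' p; in effect K' = -(K C^T + C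
    K).\<close>
  then have "(?K ** (transpose C ** ?G + ?G ** C) + K' ** ?G) ** (?K ** ?p) = 0" by simp
  moreover have "(?K ** (transpose C ** ?G + ?G ** C) + K' ** ?G) ** (?K ** ?p)
    = ?K ** transpose C ** (?G ** ?K) ** ?p + (?K ** ?G) ** C ** ?K ** ?p + K' ** (?G ** ?K) ** ?p"
    by (simp add: matrix_add_ldistrib matrix_mult_add_rdistrib matrix_mul_assoc)
  ultimately have "?K ** transpose C ** ?p + C ** ?K ** ?p + K' ** ?p = 0"
    by (simp add: GK KG x(1))
  then have "trace (?K ** transpose C ** ?p) + trace (C ** ?K ** ?p) + trace (K' ** ?p) = 0"
    using trace_0 by (simp flip: trace_add)
  moreover have "trace (C ** ?K ** ?p) = trace (?K ** ?p ** C)"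
    using trace_mul_sym[of C "?K ** ?p"] by (simp add: matrix_mul_assoc)
  ultimately have eq: "trace (?K ** (?Q + transpose C ** ?p + ?p ** C) + K' ** ?p) = trace (?K ** ?Q)"
    by (simp add: matrix_add_ldistrib trace_add matrix_mul_assoc)
  have "((\<lambda>s. trace (K (x s) ** p (x s))) has_vector_derivative
      trace (?K ** (?Q + transpose C ** ?p + ?p ** C) + K' ** ?p)) (at t)"
    by (rule bounded_linear.has_vector_derivative[OF bounded_linear_trace
        bounded_bilinear.has_vector_derivative[OF bounded_bilinear_matrix_mult Kc pc]])
  then show ?thesis unfolding eq by (simp add: has_real_derivative_iff_has_vector_derivative)
qed

end


section \<open>Consequences of the Clairaut relation in coordinates\<close>

lemma trace_mat: "trace (mat c :: real^'n^'n) = real CARD('n) * c"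
  by (simp add: trace_def mat_def)

lemma mat_eq_scaleR: "(mat c :: real^'n^'n) = c *\<^sub>R mat 1"
  by (simp add: vec_eq_iff mat_def)

lemma sum_matrix_axis:
  fixes K :: "real^'m^'m::finite"
  assumes lin: "linear f"
  shows "(\<Sum>i\<in>UNIV. \<Sum>j\<in>UNIV. K $ i $ j * (f (axis i 1) * (axis j 1 \<bullet> w))) = f (K *v w)"
proof -
  have "f (K *v w) = (\<Sum>i\<in>UNIV. (K *v w) $ i * f (axis i 1))"
    using linear_axis_sum[OF lin, of "K *v w"] by simp
  also have "\<dots> = (\<Sum>i\<in>UNIV. \<Sum>j\<in>UNIV. K $ i $ j * (f (axis i 1) * (axis j 1 \<bullet> w)))"
    by (simp add: matrix_vector_mult_def inner_axis' sum_distrib_left mult_ac)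
  finally show ?thesis by simp
qed

text \<open>\<open>conf\<close> states conformality without naming horizontal vectors: the
  horizontal space is the range of K J^T, and J K J^T is the inverse metric pushed forward to the
  target. \<open>clairaut\<close> is the square of the conserved quantity, which is a rational
  function of the velocity.\<close>

locale clairaut_coords = submersion_coords U V \<Phi> G H l \<phi>
  for U :: "(real^'m::finite) set" and V :: "(real^'n::finite) set"
    and \<Phi> :: "real^'m \<Rightarrow> real^'n" and G :: "real^'m \<Rightarrow> real^'m^'m" and H :: "real^'n \<Rightarrow> real^'n^'n"
    and l :: "real^'m \<Rightarrow> real" and \<phi> :: "real^'m \<Rightarrow> real" +
  assumes conf: "x \<in> U \<Longrightarrow> H (\<Phi> x) ** (J x ** (K x ** transpose (J x))) = mat ((l x)\<^sup>2)"
    and clairaut: "\<And>e x v. e > 0 \<Longrightarrow> (\<And>t. t \<in> {-e<..<e} \<Longrightarrow> x t \<in> U) \<Longrightarrow> geodesic_coords G {-e<..<e} x v \<Longrightarrow>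
      \<exists>c. \<forall>t\<in>{-e<..<e}. exp (2 * \<phi> (x t)) *
        (1 - v t \<bullet> (p (x t) *v v t) / ((l (x t))\<^sup>2 * (v t \<bullet> (G (x t) *v v t)))) = c"
begin

abbreviation "d\<phi> x \<equiv> frechet_derivative \<phi> (at x)"
abbreviation "dl x \<equiv> frechet_derivative l (at x)"

text \<open>Cyclicity of the trace turns K p into the matrix of \<open>conf\<close>, which acts on
  the n-dimensional target.\<close>

lemma energy: assumes x: "x \<in> U" shows "trace (K x ** p x) = real CARD('n) * (l x)\<^sup>2"
proof -
  have "trace (K x ** p x) = trace ((K x ** transpose (J x)) ** (H (\<Phi> x) ** J x))"
    by (simp add: p_def matrix_mul_assoc)
  also have "\<dots> = trace (H (\<Phi> x) ** (J x ** (K x ** transpose (J x))))"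
    by (subst trace_mul_sym) (simp add: matrix_mul_assoc)
  finally show ?thesis by (simp add: conf[OF x] trace_mat)
qed

lemma phi_has_derivative: "x \<in> U \<Longrightarrow> (\<phi> has_derivative d\<phi> x) (at x)"
  and l_has_derivative: "x \<in> U \<Longrightarrow> (l has_derivative dl x) (at x)"
  using smooth_on_has_derivative[OF \<phi>] smooth_on_has_derivative[OF l] by auto

lemma linear_dphi: "x \<in> U \<Longrightarrow> linear (d\<phi> x)" and linear_dl: "x \<in> U \<Longrightarrow> linear (dl x)"
  by (rule has_derivative_linear[OF phi_has_derivative], assumption,
      rule has_derivative_linear[OF l_has_derivative], assumption)

text \<open>The energy density is differentiated in two ways: by \<open>energy_curve\<close>, and as
  n l^2. A straight coordinate line will do, since \<open>energy_curve\<close> is not restricted to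
  geodesics.\<close>

lemma energy_derivative: assumes x: "x \<in> U"
  shows "trace (K x ** Q x u) = 2 * real CARD('n) * l x * dl x u"
proof -
  let ?c = "\<lambda>t. x + t *\<^sub>R u"
  have c: "(?c has_vector_derivative u) (at 0)" by (auto intro!: derivative_eq_intros)
  have 1: "((\<lambda>s. trace (K (?c s) ** p (?c s))) has_real_derivative trace (K x ** Q x u)) (at 0)"
    using energy_curve[of ?c 0 u] x c by simp
  have lc: "((\<lambda>s. l (?c s)) has_real_derivative dl x u) (at 0)"
    using has_vector_derivative_compose_curve[of l "dl x" ?c 0 u] l_has_derivative[OF x] c
    by (simp add: has_real_derivative_iff_has_vector_derivative)
  have 2: "((\<lambda>s. real CARD('n) * (l (?c s))\<^sup>2) has_real_derivative 2 * real CARD('n) * l x * dl x u) (at 0)"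
    by (auto intro!: derivative_eq_intros lc)
  have "open (?c -` U)" by (intro open_vimage U continuous_intros)
  moreover have "0 \<in> ?c -` U" using x by simp
  ultimately have "((\<lambda>s. real CARD('n) * (l (?c s))\<^sup>2) has_real_derivative trace (K x ** Q x u)) (at 0)"
    by (rule has_field_derivative_transform_within_open[OF 1]) (simp add: energy)
  from DERIV_unique[OF this 2] show ?thesis .
qed

lemma clear_denominator: "a * (1 - P / D) = R / D \<Longrightarrow> D \<noteq> 0 \<Longrightarrow> a * (D - P) = (R::real)"
  by (simp add: field_simps)

lemma clairaut_cubic: assumes x0: "x0 \<in> U"
  shows "d\<phi> x0 v0 * ((l x0)\<^sup>2 * (v0 \<bullet> (G x0 *v v0)) - v0 \<bullet> (p x0 *v v0)) + dl x0 v0 / l x0 * (v0 \<bullet> (p x0 *v v0))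
    = (J x0 *v v0) \<bullet> (H (\<Phi> x0) *v (sff x0 v0 *v v0))"
\<comment> \<open>For the zero vector the Clairaut relation carries no information, but both sides
  vanish.\<close>
proof (cases "v0 = 0")
  case True
  then show ?thesis by simp
next
  case False
  obtain e x v where e: "e > 0" and i: "x 0 = x0" "v 0 = v0" and xU: "\<And>t. t \<in> {-e<..<e} \<Longrightarrow> x t \<in> U"
    and geo: "geodesic_coords G {-e<..<e} x v"
    using geodesic_coords_exists[OF U G Gpd x0] by metis
  have t0: "0 \<in> {-e<..<e}" using e by auto
  have x': "(x has_vector_derivative v0) (at 0)"
    using geo t0 i by (auto simp: geodesic_coords_def)
  let ?P = "\<lambda>t. v t \<bullet> (p (x t) *v v t)" and ?E = "\<lambda>t. v t \<bullet> (G (x t) *v v t)"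
  let ?f = "\<lambda>t. exp (2 * \<phi> (x t)) * (1 - ?P t / ((l (x t))\<^sup>2 * ?E t))"
  obtain c where c: "\<And>t. t \<in> {-e<..<e} \<Longrightarrow> ?f t = c" using clairaut[OF e xU geo] by blast
  have phc: "((\<lambda>t. \<phi> (x t)) has_real_derivative d\<phi> x0 v0) (at 0)"
    using has_vector_derivative_compose_curve[of \<phi> "d\<phi> x0" x 0 v0] phi_has_derivative[OF x0] x' i
    by (simp add: has_real_derivative_iff_has_vector_derivative)
  have lc: "((\<lambda>t. l (x t)) has_real_derivative dl x0 v0) (at 0)"
    using has_vector_derivative_compose_curve[of l "dl x0" x 0 v0] l_has_derivative[OF x0] x' i
    by (simp add: has_real_derivative_iff_has_vector_derivative)
  have Pc: "(?P has_real_derivative v0 \<bullet> (Q x0 v0 *v v0)) (at 0)"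
    using p_along_geodesic[OF geo t0 xU[OF t0]] i by simp
  have Ec: "(?E has_real_derivative 0) (at 0)"
    by (rule G_along_geodesic[OF geo t0 xU[OF t0]])
  have E0: "v0 \<bullet> (G x0 *v v0) > 0" using Gpd[OF x0] False by (simp add: posdef_def)
  have l0: "l x0 > 0" by (rule lpos[OF x0])
  let ?P0 = "v0 \<bullet> (p x0 *v v0)" and ?E0 = "v0 \<bullet> (G x0 *v v0)" and ?Q0 = "v0 \<bullet> (Q x0 v0 *v v0)"
  have "(?f has_real_derivative exp (2 * \<phi> x0) * (2 * d\<phi> x0 v0) * (1 - ?P0 / ((l x0)\<^sup>2 * ?E0)) +
      exp (2 * \<phi> x0) * (0 - (?Q0 * ((l x0)\<^sup>2 * ?E0) - ?P0 * (2 * l x0 * dl x0 v0 * ?E0)) / ((l x0)\<^sup>2 * ?E0)\<^sup>2)) (at 0)"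
    apply (rule derivative_eq_intros phc lc Pc Ec refl)+
    using E0 l0 by (auto simp: i power2_eq_square algebra_simps)
  moreover have "(?f has_real_derivative 0) (at 0)"
    by (rule has_field_derivative_transform_within_open[OF DERIV_const[of c] _ t0]) (simp_all add: c)
  ultimately have "exp (2 * \<phi> x0) * (2 * d\<phi> x0 v0) * (1 - ?P0 / ((l x0)\<^sup>2 * ?E0)) +
      exp (2 * \<phi> x0) * (0 - (?Q0 * ((l x0)\<^sup>2 * ?E0) - ?P0 * (2 * l x0 * dl x0 v0 * ?E0)) / ((l x0)\<^sup>2 * ?E0)\<^sup>2) = 0"
    by (rule DERIV_unique)
  then have "exp (2 * \<phi> x0) * ((2 * d\<phi> x0 v0) * (1 - ?P0 / ((l x0)\<^sup>2 * ?E0)) -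
      (?Q0 * ((l x0)\<^sup>2 * ?E0) - ?P0 * (2 * l x0 * dl x0 v0 * ?E0)) / ((l x0)\<^sup>2 * ?E0)\<^sup>2) = 0"
    by (simp add: algebra_simps)
  then have "(2 * d\<phi> x0 v0) * (1 - ?P0 / ((l x0)\<^sup>2 * ?E0)) =
      (?Q0 * ((l x0)\<^sup>2 * ?E0) - ?P0 * (2 * l x0 * dl x0 v0 * ?E0)) / ((l x0)\<^sup>2 * ?E0)\<^sup>2"
    by simp
  also have "\<dots> = (?Q0 - ?P0 * 2 * dl x0 v0 / l x0) / ((l x0)\<^sup>2 * ?E0)"
    using E0 l0 by (simp add: field_simps power2_eq_square)
  finally have "(2 * d\<phi> x0 v0) * ((l x0)\<^sup>2 * ?E0 - ?P0) = ?Q0 - ?P0 * 2 * dl x0 v0 / l x0"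
  proof (rule clear_denominator)
    show "(l x0)\<^sup>2 * ?E0 \<noteq> 0" using E0 l0 by simp
  qed
  \<comment> \<open>\<open>Q_form\<close> contributes a factor 2, which cancels the factor 2 of the
    other terms.\<close>
  then show ?thesis using Q_form[OF x0, of v0 v0] by (simp add: field_simps)
qed

text \<open>\<open>c\<close> is the defect of the cubic identity and \<open>B\<close> its part with
  the second fundamental form. After tracing with K, the cyclic sum has one summand with
  \<open>u\<close> in the first place, \<open>S1\<close>, which contains \<open>\<tau>\<close>, and
  two equal ones where a traced index stands there, \<open>S2\<close>.\<close>

lemma tension_identity:
  assumes x: "x \<in> U"
  defines "\<tau> \<equiv> \<Sum>i\<in>UNIV. \<Sum>j\<in>UNIV. (K x $ i $ j) *\<^sub>R (sff x (axis i 1) *v axis j 1)"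
  shows "d\<phi> x u * (l x)\<^sup>2 * (real CARD('m) - real CARD('n) + 2) - real CARD('n) * l x * dl x u
    + 2 * (dl x (K x *v (p x *v u)) / l x - d\<phi> x (K x *v (p x *v u)))
    = (J x *v u) \<bullet> (H (\<Phi> x) *v \<tau>)"
proof -
  define B where "B = (\<lambda>u v w. (J x *v u) \<bullet> (H (\<Phi> x) *v (sff x v *v w)))"
  define q where "q = (\<lambda>v w. (l x)\<^sup>2 * (v \<bullet> (G x *v w)) - v \<bullet> (p x *v w))"
  define pp where "pp = (\<lambda>v w. v \<bullet> (p x *v w))"
  define c where "c = (\<lambda>u v w. d\<phi> x u * q v w + dl x u / l x * pp v w - B u v w)"
  have Sadd: "sff x (v + v') = sff x v + sff x v'" for v v'
    unfolding sff_def
    by (simp add: linear_add[OF has_derivative_linear[OF J_deriv[OF x]]] connection_matrix_add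
        matrix_vector_right_distrib matrix_add_ldistrib matrix_mult_add_rdistrib)
  have B: "B (u + u') v w = B u v w + B u' v w" "B u (v + v') w = B u v w + B u v' w" "B u v w = B u w v" for u u' v v' w
    using sff_commute[OF x, of v w]
    by (simp_all add: B_def Sadd matrix_vector_right_distrib matrix_vector_mult_add_rdistrib inner_add_left inner_add_right)
  have qs: "q (v + v') w = q v w + q v' w" "q v w = q w v" "pp (v + v') w = pp v w + pp v' w" "pp v w = pp w v" for v v' w
    using symmetric_matrix_inner[OF transpose_G[OF x], of v w] symmetric_matrix_inner[OF transpose_p[OF x], of v w]
    by (auto simp: q_def pp_def inner_add_left algebra_simps inner_commute)
  have pol: "c u v w + c v w u + c w u v = 0" for u v w
  proof (rule symmetric_trilinear_polarization[where c = c])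
    show "c (u + u') v w = c u v w + c u' v w" for u u' v w
      by (simp add: c_def B(1) linear_add[OF linear_dphi[OF x]] linear_add[OF linear_dl[OF x]] add_divide_distrib algebra_simps)
    show "c u (v + v') w = c u v w + c u v' w" for u v v' w
      by (simp add: c_def B(2) qs(1,3) add_divide_distrib algebra_simps)
    show "c u v w = c u w v" for u v w
      using B(3)[of u v w] qs(2)[of v w] qs(4)[of v w] by (simp add: c_def)
    show "c v v v = 0" for v
      using clairaut_cubic[OF x, of v] by (simp add: c_def q_def pp_def B_def)
  qed
  have csym: "c u v w = c u w v" for u v w
    using B(3)[of u v w] qs(2)[of v w] qs(4)[of v w] by (simp add: c_def)
  let ?K = "\<lambda>i j. K x $ i $ j" and ?e = "\<lambda>i. axis i 1 :: real^'m"
  have Ksym: "?K i j = ?K j i" for i j using transpose_K[OF x] by (metis transpose_def vec_lambda_beta)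
  have tr: "(\<Sum>i\<in>UNIV. \<Sum>j\<in>UNIV. ?K i j * (?e i \<bullet> (A *v ?e j))) = trace (K x ** A)" for A
    unfolding inner_axis_matrix trace_mult_sum by (subst sum.swap) (simp add: Ksym)
  define S1 where "S1 = (\<Sum>i\<in>UNIV. \<Sum>j\<in>UNIV. ?K i j * c u (?e i) (?e j))"
  define S2 where "S2 = (\<Sum>i\<in>UNIV. \<Sum>j\<in>UNIV. ?K i j * c (?e i) (?e j) u)"
  \<comment> \<open>Symmetry of K and of the last two arguments of \<open>c\<close> identifies the
    third cyclic term with the second.\<close>
  have S3: "(\<Sum>i\<in>UNIV. \<Sum>j\<in>UNIV. ?K i j * c (?e j) u (?e i)) = S2"
  proof -
    have "(\<Sum>i\<in>UNIV. \<Sum>j\<in>UNIV. ?K i j * c (?e j) u (?e i)) = (\<Sum>j\<in>UNIV. \<Sum>i\<in>UNIV. ?K i j * c (?e j) u (?e i))"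
      by (rule sum.swap)
    also have "\<dots> = S2"
      unfolding S2_def by (intro sum.cong refl) (simp add: csym[of "?e _" u] Ksym)
    finally show ?thesis .
  qed
  have "S1 + S2 + S2 = S1 + S2 + (\<Sum>i\<in>UNIV. \<Sum>j\<in>UNIV. ?K i j * c (?e j) u (?e i))"
    by (simp only: S3)
  also have "\<dots> = (\<Sum>i\<in>UNIV. \<Sum>j\<in>UNIV. ?K i j * (c u (?e i) (?e j) + c (?e i) (?e j) u + c (?e j) u (?e i)))"
    by (simp only: S1_def S2_def sum.distrib distrib_left)
  finally have S0: "S1 + 2 * S2 = 0" by (simp add: pol)
  have trG: "(\<Sum>i\<in>UNIV. \<Sum>j\<in>UNIV. ?K i j * (?e i \<bullet> (G x *v ?e j))) = real CARD('m)"
    unfolding tr by (simp add: KG[OF x] trace_mat)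
  have trp: "(\<Sum>i\<in>UNIV. \<Sum>j\<in>UNIV. ?K i j * pp (?e i) (?e j)) = real CARD('n) * (l x)\<^sup>2"
    unfolding pp_def tr by (rule energy[OF x])
  have trq: "(\<Sum>i\<in>UNIV. \<Sum>j\<in>UNIV. ?K i j * q (?e i) (?e j)) = (l x)\<^sup>2 * (real CARD('m) - real CARD('n))"
  proof -
    have "(\<Sum>i\<in>UNIV. \<Sum>j\<in>UNIV. ?K i j * q (?e i) (?e j)) =
       (l x)\<^sup>2 * (\<Sum>i\<in>UNIV. \<Sum>j\<in>UNIV. ?K i j * (?e i \<bullet> (G x *v ?e j))) - (\<Sum>i\<in>UNIV. \<Sum>j\<in>UNIV. ?K i j * pp (?e i) (?e j))"
      by (simp only: q_def pp_def right_diff_distrib sum_subtractf sum_distrib_left mult.left_commute)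
    then show ?thesis unfolding trG trp by (simp add: algebra_simps)
  qed
  have trB: "(\<Sum>i\<in>UNIV. \<Sum>j\<in>UNIV. ?K i j * B u (?e i) (?e j)) = (J x *v u) \<bullet> (H (\<Phi> x) *v \<tau>)"
    unfolding B_def \<tau>_def
    by (simp add: linear_sum[OF matrix_vector_mul_linear] inner_sum_right matrix_vector_mult_scaleR)
  have "S1 = d\<phi> x u * (\<Sum>i\<in>UNIV. \<Sum>j\<in>UNIV. ?K i j * q (?e i) (?e j)) + dl x u / l x * (\<Sum>i\<in>UNIV. \<Sum>j\<in>UNIV. ?K i j * pp (?e i) (?e j))
     - (\<Sum>i\<in>UNIV. \<Sum>j\<in>UNIV. ?K i j * B u (?e i) (?e j))"
    by (simp only: S1_def c_def right_diff_distrib distrib_left sum_subtractf sum.distrib sum_distrib_left mult.left_commute)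
  then have S1: "S1 = d\<phi> x u * (l x)\<^sup>2 * (real CARD('m) - real CARD('n)) + dl x u * l x * real CARD('n) - (J x *v u) \<bullet> (H (\<Phi> x) *v \<tau>)"
    unfolding trp trq trB using lpos[OF x] by (simp add: field_simps power2_eq_square)
  \<comment> \<open>Contracting with K raises an index, so \<open>f\<close> is evaluated at K p u.
    This vector is l^2 u for horizontal u and 0 for vertical u.\<close>
  have trq2: "(\<Sum>i\<in>UNIV. \<Sum>j\<in>UNIV. ?K i j * (f (?e i) * pp (?e j) u)) = f (K x *v (p x *v u))" if "linear f" for f :: "real^'m \<Rightarrow> real"
    unfolding pp_def by (rule sum_matrix_axis[OF that])
  have trG2: "(\<Sum>i\<in>UNIV. \<Sum>j\<in>UNIV. ?K i j * (f (?e i) * (?e j \<bullet> (G x *v u)))) = f u" if "linear f" for f :: "real^'m \<Rightarrow> real"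
    using sum_matrix_axis[OF that, of "K x" "G x *v u"] by (simp add: matrix_vector_mul_assoc KG[OF x])
  \<comment> \<open>Symmetry of \<open>sff\<close> moves \<open>u\<close> into its direction
    argument; the trace is then half the derivative of the energy density.\<close>
  have trB2: "(\<Sum>i\<in>UNIV. \<Sum>j\<in>UNIV. ?K i j * B (?e i) (?e j) u) = real CARD('n) * l x * dl x u"
  proof -
    have "B (?e i) (?e j) u = ?e i \<bullet> ((transpose (J x) ** (H (\<Phi> x) ** sff x u)) *v ?e j)" for i j
      unfolding B_def sff_commute[OF x, of "?e j" u]
      by (simp add: matrix_inner_left matrix_vector_mul_assoc[symmetric] del: transpose_matrix_vector)
    then have "(\<Sum>i\<in>UNIV. \<Sum>j\<in>UNIV. ?K i j * B (?e i) (?e j) u) = trace (K x ** (transpose (J x) ** (H (\<Phi> x) ** sff x u)))"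
      by (simp only: tr)
    then show ?thesis using trace_Q[OF x, of u] energy_derivative[OF x, of u] by simp
  qed
  have "S2 = (l x)\<^sup>2 * (\<Sum>i\<in>UNIV. \<Sum>j\<in>UNIV. ?K i j * (d\<phi> x (?e i) * (?e j \<bullet> (G x *v u))))
     - (\<Sum>i\<in>UNIV. \<Sum>j\<in>UNIV. ?K i j * (d\<phi> x (?e i) * pp (?e j) u))
     + (\<Sum>i\<in>UNIV. \<Sum>j\<in>UNIV. ?K i j * (dl x (?e i) * pp (?e j) u)) / l x
     - (\<Sum>i\<in>UNIV. \<Sum>j\<in>UNIV. ?K i j * B (?e i) (?e j) u)"
    by (simp add: S2_def c_def q_def pp_def right_diff_distrib distrib_left sum_subtractf sum.distrib
        sum_distrib_left sum_divide_distrib mult.left_commute mult.assoc)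
  then have S2: "S2 = (l x)\<^sup>2 * d\<phi> x u - d\<phi> x (K x *v (p x *v u)) + dl x (K x *v (p x *v u)) / l x - real CARD('n) * l x * dl x u"
    unfolding trq2[OF linear_dphi[OF x]] trq2[OF linear_dl[OF x]] trG2[OF linear_dphi[OF x]] trB2 .
  show ?thesis using S0 unfolding S1 S2 by (simp add: algebra_simps)
qed

text \<open>At a nonzero vertical vector the cubic identity reduces to d\<phi>(u) times a positive
  number. All that is then left of \<open>tension_identity\<close> is the term n l dl(u).\<close>

lemma vertical_derivatives:
  assumes x: "x \<in> U" and u: "J x *v u = 0"
  shows "d\<phi> x u = 0" "dl x u = 0"
proof -
  have pu: "p x *v u = 0" by (simp add: p_def matrix_vector_mul_assoc[symmetric] u)
  have l0: "l x > 0" by (rule lpos[OF x])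
  show 1: "d\<phi> x u = 0"
  proof (cases "u = 0")
    case True
    then show ?thesis using linear_0[OF linear_dphi[OF x]] by simp
  next
    case False
    then have "u \<bullet> (G x *v u) > 0" using Gpd[OF x] by (simp add: posdef_def)
    then show ?thesis using clairaut_cubic[OF x, of u] l0 by (simp add: pu u)
  qed
  show "dl x u = 0"
    using tension_identity[OF x, of u] l0 linear_0[OF linear_dl[OF x]] linear_0[OF linear_dphi[OF x]]
    by (simp add: 1 pu u)
qed

text \<open>It suffices to test the tension against H J u for horizontal u, since these vectors
  exhaust the target. The hypothesis \<open>eq\<close> is d(ln l) = k d\<phi> with k = (m - n) / (n
  - 2), cleared of denominators.\<close>

lemma tension_eq_0:
  assumes x: "x \<in> U"
    and eq: "\<And>u. (real CARD('m) - real CARD('n)) * (l x * d\<phi> x u) = (real CARD('n) - 2) * dl x u"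
  shows "(\<Sum>i\<in>UNIV. \<Sum>j\<in>UNIV. (K x $ i $ j) *\<^sub>R (sff x (axis i 1) *v axis j 1)) = 0" (is "?\<tau> = 0")
proof -
  have l0: "l x > 0" by (rule lpos[OF x])
  have "\<xi> \<bullet> ?\<tau> = 0" for \<xi>
  proof -
    \<comment> \<open>A horizontal vector, mapped by J to l^2 H^-1 \<xi>.\<close>
    define u where "u = K x *v (transpose (J x) *v \<xi>)"
    have HJu: "H (\<Phi> x) *v (J x *v u) = (l x)\<^sup>2 *\<^sub>R \<xi>"
      using arg_cong[OF conf[OF x], of "\<lambda>A. A *v \<xi>"]
      by (simp add: u_def matrix_vector_mul_assoc[symmetric] mat_eq_scaleR[of "(l x)\<^sup>2"] scaleR_matrix_vector_assoc[symmetric]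
          del: transpose_matrix_vector)
    have Kpu: "K x *v (p x *v u) = (l x)\<^sup>2 *\<^sub>R u"
    proof -
      have "p x *v u = transpose (J x) *v (H (\<Phi> x) *v (J x *v u))"
        by (simp add: p_def matrix_vector_mul_assoc[symmetric] del: transpose_matrix_vector)
      then show ?thesis
        unfolding HJu by (simp add: matrix_vector_mult_scaleR u_def del: transpose_matrix_vector)
    qed
    have "(J x *v u) \<bullet> (H (\<Phi> x) *v ?\<tau>) = (l x)\<^sup>2 * (\<xi> \<bullet> ?\<tau>)"
      using symmetric_matrix_inner[OF transpose_H[OF x], of "J x *v u" ?\<tau>] unfolding HJu by simp
    \<comment> \<open>For horizontal u the summand 2 in the first coefficient cancels against the
      last term, and the combination in \<open>eq\<close> remains.\<close>
    moreover have "d\<phi> x u * (l x)\<^sup>2 * (real CARD('m) - real CARD('n) + 2) - real CARD('n) * l x * dl x u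
      + 2 * (dl x ((l x)\<^sup>2 *\<^sub>R u) / l x - d\<phi> x ((l x)\<^sup>2 *\<^sub>R u)) =
      l x * ((real CARD('m) - real CARD('n)) * (l x * d\<phi> x u) - (real CARD('n) - 2) * dl x u)"
      unfolding linear_cmul[OF linear_dphi[OF x]] linear_cmul[OF linear_dl[OF x]]
      using l0 by (simp add: power2_eq_square algebra_simps)
    ultimately have "(l x)\<^sup>2 * (\<xi> \<bullet> ?\<tau>) = 0"
      using tension_identity[OF x, of u] by (simp add: Kpu eq)
    then show ?thesis using l0 by simp
  qed
  from this[of ?\<tau>] show ?thesis by simp
qed

end

section \<open>Charts\<close>

lemma chart_open: "is_chart c \<Longrightarrow> open (chart_dom c)" "is_chart c \<Longrightarrow> open (chart_image c)"
  by (auto simp: is_chart_def)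

lemma chart_inv_map: "is_chart c \<Longrightarrow> p \<in> chart_dom c \<Longrightarrow> chart_inv c (chart_map c p) = p"
  and chart_map_inv: "is_chart c \<Longrightarrow> x \<in> chart_image c \<Longrightarrow> chart_map c (chart_inv c x) = x"
  and chart_inv_dom: "is_chart c \<Longrightarrow> x \<in> chart_image c \<Longrightarrow> chart_inv c x \<in> chart_dom c"
  and chart_map_image: "p \<in> chart_dom c \<Longrightarrow> chart_map c p \<in> chart_image c"
  unfolding is_chart_def homeomorphism_def chart_image_def by auto

lemma chart_image_Int:
  assumes "is_chart c"
  shows "chart_map c ` (chart_dom c \<inter> W) = chart_image c \<inter> chart_inv c -` W"
  using assms by (auto simp: chart_inv_map chart_map_image chart_map_inv chart_inv_dom intro!: rev_image_eqI)

lemma open_chart_image_Int: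
  assumes c: "is_chart c" and W: "open W"
  shows "open (chart_map c ` (chart_dom c \<inter> W))"
proof -
  have "continuous_on (chart_image c) (chart_inv c)"
    using c by (auto simp: is_chart_def homeomorphism_def)
  from continuous_open_preimage[OF this chart_open(2)[OF c] W] show ?thesis
    by (simp add: chart_image_Int[OF c])
qed

section \<open>Change of charts for tangent vectors\<close>

definition transition :: "('a, 'm::finite) chart \<Rightarrow> ('a, 'm) chart \<Rightarrow> 'a \<Rightarrow> real^'m \<Rightarrow> real^'m" where
  "transition c d p = frechet_derivative (chart_map d \<circ> chart_inv c) (at (chart_map c p))"

lemma from_chart_transition: "from_chart A c p = transition c (chart_at A p) p"
  by (simp add: from_chart_def transition_def)

locale atlas =
  fixes A :: "('a::{t2_space,second_countable_topology}, 'm::finite) chart set"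
  assumes atlas: "smooth_atlas A"
begin

lemma is_chart: "c \<in> A \<Longrightarrow> is_chart c" using atlas by (simp add: smooth_atlas_def)

lemma chart_at: "chart_at A p \<in> A" "p \<in> chart_dom (chart_at A p)"
proof -
  have "\<exists>c. c \<in> A \<and> p \<in> chart_dom c" using atlas by (force simp: smooth_atlas_def)
  from someI_ex[OF this] show "chart_at A p \<in> A" "p \<in> chart_dom (chart_at A p)"
    by (simp_all add: chart_at_def)
qed

lemma transition_has_derivative:
  assumes "c \<in> A" "d \<in> A" "p \<in> chart_dom c" "p \<in> chart_dom d"
  shows "((chart_map d \<circ> chart_inv c) has_derivative transition c d p) (at (chart_map c p))"
  unfolding transition_def
  by (rule smooth_on_has_derivative[of "chart_map c ` (chart_dom c \<inter> chart_dom d)"])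
    (use assms atlas in \<open>auto simp: smooth_atlas_def\<close>)

lemma linear_transition:
  assumes "c \<in> A" "d \<in> A" "p \<in> chart_dom c" "p \<in> chart_dom d"
  shows "linear (transition c d p)"
  using transition_has_derivative[OF assms] has_derivative_linear by auto

lemma transition_refl:
  assumes "c \<in> A" "p \<in> chart_dom c" shows "transition c c p v = v"
proof -
  have "((\<lambda>x. x) has_derivative (\<lambda>v. v)) (at (chart_map c p))" by simp
  then have "((chart_map c \<circ> chart_inv c) has_derivative (\<lambda>v. v)) (at (chart_map c p))"
    by (rule has_derivative_transform_within_open[OF _ chart_open(2)[OF is_chart[OF assms(1)]] chart_map_image[OF assms(2)]])
      (simp add: chart_map_inv is_chart assms(1))
  from frechet_derivative_at[OF this] show ?thesis unfolding transition_def by metis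
qed

lemma transition_trans:
  assumes cde: "c \<in> A" "d \<in> A" "e \<in> A" and p: "p \<in> chart_dom c" "p \<in> chart_dom d" "p \<in> chart_dom e"
  shows "transition d e p (transition c d p v) = transition c e p v"
proof -
  have eq: "(chart_map d \<circ> chart_inv c) (chart_map c p) = chart_map d p"
    using cde p by (simp add: chart_inv_map is_chart)
  have "((\<lambda>x. (chart_map e \<circ> chart_inv d) ((chart_map d \<circ> chart_inv c) x)) has_derivative
      (\<lambda>v. transition d e p (transition c d p v))) (at (chart_map c p))"
    using has_derivative_compose[OF transition_has_derivative[OF cde(1,2) p(1,2)], of "chart_map e \<circ> chart_inv d"]
      transition_has_derivative[OF cde(2,3) p(2,3)] by (simp add: eq[unfolded o_def] o_def)
  then have "((chart_map e \<circ> chart_inv c) has_derivative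
      (\<lambda>v. transition d e p (transition c d p v))) (at (chart_map c p))"
    by (rule has_derivative_transform_within_open[of _ _ _ _ "chart_map c ` (chart_dom c \<inter> chart_dom d)"])
      (use cde p chart_open(1)[OF is_chart[OF cde(2)]] in \<open>auto intro!: open_chart_image_Int simp: is_chart chart_inv_map\<close>)
  from frechet_derivative_at[OF this] show ?thesis unfolding transition_def[of c e] by metis
qed

lemma from_chart_bij:
  assumes "c \<in> A" "p \<in> chart_dom c"
  shows "transition (chart_at A p) c p (from_chart A c p v) = v"
    "from_chart A c p (transition (chart_at A p) c p v) = v"
  using assms chart_at by (simp_all add: from_chart_transition transition_trans transition_refl)

lemma linear_from_chart: "c \<in> A \<Longrightarrow> p \<in> chart_dom c \<Longrightarrow> linear (from_chart A c p)"
  using chart_at by (simp add: from_chart_transition linear_transition)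

lemma from_chart_eq_0: "c \<in> A \<Longrightarrow> p \<in> chart_dom c \<Longrightarrow> from_chart A c p v = 0 \<longleftrightarrow> v = 0"
  using from_chart_bij(1)[of c p v] from_chart_bij(1)[of c p 0] linear_0[OF linear_from_chart[of c p]] by metis

text \<open>\<open>velocity\<close> reads the curve in the chart chosen at
  \<open>\<alpha> t\<close>, which varies with \<open>t\<close>; the chain rule relates it to one
  fixed chart near \<open>t\<close>.\<close>

lemma velocity_eq:
  assumes c: "c \<in> A" and T: "open T" "t \<in> T" and sub: "\<And>s. s \<in> T \<Longrightarrow> \<alpha> s \<in> chart_dom c"
    and x: "((chart_map c \<circ> \<alpha>) has_vector_derivative v) (at t)"
  shows "velocity A \<alpha> t = from_chart A c (\<alpha> t) v"
proof -
  let ?e = "chart_at A (\<alpha> t)"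
  have "((\<lambda>s. (chart_map ?e \<circ> chart_inv c) ((chart_map c \<circ> \<alpha>) s)) has_vector_derivative from_chart A c (\<alpha> t) v) (at t)"
  proof (rule has_vector_derivative_compose_curve[OF _ x])
    show "((chart_map ?e \<circ> chart_inv c) has_derivative from_chart A c (\<alpha> t)) (at ((chart_map c \<circ> \<alpha>) t))"
      unfolding from_chart_transition o_apply[of "chart_map c"]
      by (rule transition_has_derivative[OF c chart_at(1) sub[OF T(2)] chart_at(2)])
  qed
  then have "((chart_map ?e \<circ> \<alpha>) has_vector_derivative from_chart A c (\<alpha> t) v) (at t)"
    by (rule has_vector_derivative_transform_within_open[OF _ T]) (simp add: chart_inv_map is_chart c sub)
  then show ?thesis unfolding velocity_def by (rule vector_derivative_at)
qed

end

section \<open>Riemannian metrics and geodesics read in charts\<close>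

locale riemannian = atlas A for A :: "('a::{t2_space,second_countable_topology}, 'm::finite) chart set" +
  fixes g :: "('a, 'm) metric_field"
  assumes metric: "riemannian_metric A g"
begin

lemma g_bilinear: "bilinear (g p)" and g_sym: "g p v w = g p w v" and g_pos: "v \<noteq> 0 \<Longrightarrow> g p v v > 0"
  using metric by (auto simp: riemannian_metric_def)

lemma g_matrix:
  assumes c: "c \<in> A" "x \<in> chart_image c"
  shows "g (chart_inv c x) (from_chart A c (chart_inv c x) v) (from_chart A c (chart_inv c x) w) = v \<bullet> (metric_matrix A g c x *v w)"
proof -
  let ?p = "chart_inv c x"
  let ?T = "from_chart A c ?p"
  have p: "?p \<in> chart_dom c" using c by (simp add: chart_inv_dom is_chart)
  have T: "linear ?T" by (rule linear_from_chart[OF c(1) p])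
  have l1: "linear (\<lambda>v. g ?p (?T v) w)" for w
    using linear_compose[OF T, of "\<lambda>v. g ?p v w"] g_bilinear[of ?p] by (simp add: bilinear_def o_def)
  have l2: "linear (\<lambda>w. g ?p v (?T w))" for v
    using linear_compose[OF T, of "g ?p v"] g_bilinear[of ?p] by (simp add: bilinear_def o_def)
  have "g ?p (?T v) (?T w) = (\<Sum>i\<in>UNIV. v $ i * (\<Sum>j\<in>UNIV. w $ j * g ?p (?T (axis i 1)) (?T (axis j 1))))"
    by (subst linear_axis_sum[OF l1], subst linear_axis_sum[OF l2]) simp
  then show ?thesis
    by (simp add: inner_vec_def matrix_vector_mult_def metric_matrix_def mult.commute)
qed

lemma metric_matrix_posdef:
  assumes c: "c \<in> A" "x \<in> chart_image c" shows "posdef (metric_matrix A g c x)"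
proof -
  have p: "chart_inv c x \<in> chart_dom c" using c by (simp add: chart_inv_dom is_chart)
  have "transpose (metric_matrix A g c x) = metric_matrix A g c x"
    by (simp add: transpose_def metric_matrix_def vec_eq_iff g_sym)
  moreover have "v \<bullet> (metric_matrix A g c x *v v) > 0" if "v \<noteq> 0" for v
    using g_pos from_chart_eq_0[OF c(1) p] that by (simp flip: g_matrix[OF c])
  ultimately show ?thesis by (simp add: posdef_def)
qed

lemma smooth_metric_matrix: "c \<in> A \<Longrightarrow> smooth_on (chart_image c) (metric_matrix A g c)"
  using metric by (intro smooth_on_matrix) (auto simp: riemannian_metric_def chart_open is_chart)

end

lemma christoffel_eq_symbol: "christoffel A g c = christoffel_symbol (metric_matrix A g c)"
  by (intro ext) (simp add: christoffel_def christoffel_symbol_def)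

lemma has_vector_derivative_on_open:
  assumes "open I" "\<And>t. t \<in> I \<Longrightarrow> x t = y t" "t \<in> I" "(x has_vector_derivative v) (at t)"
  shows "(y has_vector_derivative v) (at t)"
  using has_vector_derivative_transform_within_open[OF assms(4,1,3)] assms(2) by simp

lemma (in riemannian) geodesic_of_coords:
  assumes c: "c \<in> A" and I: "open I" "is_interval I" and x: "x ` I \<subseteq> chart_image c"
    and geo: "geodesic_coords (metric_matrix A g c) I x v"
  shows "geodesic A g I (chart_inv c \<circ> x)"
proof -
  let ?y = "chart_map c \<circ> (chart_inv c \<circ> x)"
  have y: "x t = ?y t" if "t \<in> I" for t
    using x that c by (auto simp: chart_map_inv is_chart)
  have y': "(?y has_vector_derivative v t) (at t)" if "t \<in> I" for t
    by (rule has_vector_derivative_on_open[OF I(1) y that]) (use geo that in \<open>auto simp: geodesic_coords_def\<close>)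
  have y'': "((\<lambda>s. vector_derivative ?y (at s)) has_vector_derivative
      - (connection_matrix (metric_matrix A g c) (x t) (v t) *v v t)) (at t)" if "t \<in> I" for t
  proof (rule has_vector_derivative_on_open[OF I(1) _ that, of v])
    show "v s = vector_derivative ?y (at s)" if "s \<in> I" for s
      by (rule vector_derivative_at[OF y'[OF that], symmetric])
    show "(v has_vector_derivative - (connection_matrix (metric_matrix A g c) (x t) (v t) *v v t)) (at t)"
      using geo that by (simp add: geodesic_coords_def)
  qed
  have "coord_geodesic A g c I (chart_inv c \<circ> x)"
    unfolding coord_geodesic_def Let_def
  proof (intro conjI ballI allI)
    show "(chart_inv c \<circ> x) ` I \<subseteq> chart_dom c" using x c by (auto intro!: chart_inv_dom simp: is_chart)
    show "smooth_on I ?y"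
      using geo smooth_on_cong[OF I(1), of x ?y, OF y] unfolding geodesic_coords_def by blast
    fix t k assume t: "t \<in> I"
    have "vector_derivative (\<lambda>s. vector_derivative ?y (at s)) (at t) $ k =
      - (\<Sum>j\<in>UNIV. \<Sum>i\<in>UNIV. christoffel_symbol (metric_matrix A g c) k i j (x t) * v t $ i * v t $ j)"
      unfolding vector_derivative_at[OF y''[OF t]]
      by (simp add: matrix_vector_mult_def connection_matrix_def sum_distrib_right)
    also have "\<dots> = - (\<Sum>i\<in>UNIV. \<Sum>j\<in>UNIV. christoffel_symbol (metric_matrix A g c) k i j (x t) * v t $ i * v t $ j)"
      by (subst sum.swap) (rule refl)
    finally show "vector_derivative (\<lambda>s. vector_derivative ?y (at s)) (at t) $ k +
      (\<Sum>i\<in>UNIV. \<Sum>j\<in>UNIV. christoffel A g c k i j (?y t) * vector_derivative ?y (at t) $ i * vector_derivative ?y (at t) $ j) = 0"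
      unfolding christoffel_eq_symbol vector_derivative_at[OF y'[OF t]] y[OF t, symmetric] by simp
  qed
  then show ?thesis using I c unfolding geodesic_def by auto
qed

text \<open>The vectors X \<xi> = K J^T \<xi> are horizontal, and their G-product with w is \<xi>
  \<bullet> J w. With A = J K J^T, conformality at X \<xi> and X \<eta> reads A \<xi> \<bullet> H A
  \<eta> = l^2 (A \<xi> \<bullet> \<eta>), and A is surjective.\<close>

lemma (in submersion_coords) conformal_matrix:
  assumes x: "x \<in> U" and surj: "surj ((*v) (J x))"
    and conf: "\<And>X Y. (\<And>w. J x *v w = 0 \<Longrightarrow> X \<bullet> (G x *v w) = 0) \<Longrightarrow> (\<And>w. J x *v w = 0 \<Longrightarrow> Y \<bullet> (G x *v w) = 0) \<Longrightarrow>
      (J x *v X) \<bullet> (H (\<Phi> x) *v (J x *v Y)) = (l x)\<^sup>2 * (X \<bullet> (G x *v Y))"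
  shows "H (\<Phi> x) ** (J x ** (K x ** transpose (J x))) = mat ((l x)\<^sup>2)" and "surj ((*v) (J x ** (K x ** transpose (J x))))"
proof -
  define X where "X = (\<lambda>\<xi>. K x *v (transpose (J x) *v \<xi>))"
  let ?A = "J x ** (K x ** transpose (J x))"
  have A: "?A *v \<xi> = J x *v X \<xi>" for \<xi>
    by (simp add: X_def matrix_vector_mul_assoc[symmetric] del: transpose_matrix_vector)
  have GX: "G x *v X \<xi> = transpose (J x) *v \<xi>" for \<xi>
    unfolding X_def matrix_vector_mul_assoc[of "G x"] GK[OF x] by simp
  have XG: "w \<bullet> (G x *v X \<xi>) = (J x *v w) \<bullet> \<xi>" for w \<xi>
    unfolding GX by (simp add: matrix_inner_left del: transpose_matrix_vector)
  have hor: "X \<xi> \<bullet> (G x *v w) = 0" if "J x *v w = 0" for \<xi> w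
    using symmetric_matrix_inner[OF transpose_G[OF x], of "X \<xi>" w] XG[of w \<xi>] that by (simp add: inner_commute)
  \<comment> \<open>If A \<xi> = 0, then X \<xi> has length 0, so \<xi> is orthogonal to the range
    of the surjective J.\<close>
  have inj: "inj ((*v) ?A)"
  proof (rule linear_injective_0[THEN iffD2, rule_format])
    show "linear ((*v) ?A)" by simp
  next
    fix \<xi> assume "?A *v \<xi> = 0"
    then have "X \<xi> \<bullet> (G x *v X \<xi>) = 0" using XG[of "X \<xi>" \<xi>] A by simp
    then have "X \<xi> = 0" using Gpd[OF x] unfolding posdef_def by (metis less_irrefl)
    then have "(J x *v w) \<bullet> \<xi> = 0" for w using XG[of w \<xi>] by simp
    moreover obtain w where "\<xi> = J x *v w" using surj by (metis surjD)
    ultimately have "\<xi> \<bullet> \<xi> = 0" by simp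
    then show "\<xi> = 0" by simp
  qed
  then show sA: "surj ((*v) ?A)" by (intro linear_injective_imp_surjective) auto
  have "H (\<Phi> x) *v (?A *v \<eta>) = (l x)\<^sup>2 *\<^sub>R \<eta>" for \<eta>
  proof -
    have "\<zeta> \<bullet> (H (\<Phi> x) *v (?A *v \<eta>) - (l x)\<^sup>2 *\<^sub>R \<eta>) = 0" for \<zeta>
    proof -
      obtain \<xi> where \<xi>: "\<zeta> = ?A *v \<xi>" using sA by (metis surjD)
      show ?thesis
        using conf[of "X \<xi>" "X \<eta>"] hor by (simp add: \<xi> A inner_diff_right XG)
    qed
    from this[of "H (\<Phi> x) *v (?A *v \<eta>) - (l x)\<^sup>2 *\<^sub>R \<eta>"] show ?thesis by simp
  qed
  then show "H (\<Phi> x) ** ?A = mat ((l x)\<^sup>2)"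
    by (simp add: matrix_eq matrix_vector_mul_assoc[symmetric] mat_eq_scaleR[of "(l x)\<^sup>2"] scaleR_matrix_vector_assoc[symmetric])
qed

section \<open>Clairaut conformal submersions of manifolds\<close>

lemma connection_matrix_axis: "connection_matrix G x (axis i 1) $ k $ j = christoffel_symbol G k i j x"
proof -
  have "connection_matrix G x (axis i 1) $ k $ j = (\<Sum>a\<in>UNIV. if a = i then christoffel_symbol G k a j x else 0)"
    unfolding connection_matrix_def vec_lambda_beta by (intro sum.cong refl) (simp add: axis_def)
  then show ?thesis by simp
qed

lemma has_derivative_exp_mult:
  fixes h :: "'a::real_normed_vector \<Rightarrow> real"
  assumes "(h has_derivative h') (at x)"
  shows "((\<lambda>y. exp (k * h y)) has_derivative (\<lambda>u. exp (k * h x) * (k * h' u))) (at x)"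
  by (auto intro!: derivative_eq_intros assms)

text \<open>Besides being a Riemannian metric, \<open>g'\<close> enters through
  \<open>conformal\<close> alone; \<open>clairaut\<close> involves only \<open>F\<close> and
  \<open>g\<close>. The locale can therefore be entered again with a rescaled target metric.\<close>

locale clairaut_manifolds = M: riemannian A g + B: riemannian B g'
  for A :: "('a::{t2_space,second_countable_topology}, 'm::finite) chart set" and g
    and B :: "('b::{t2_space,second_countable_topology}, 'n::finite) chart set" and g' +
  fixes F :: "'a \<Rightarrow> 'b" and dil f :: "'a \<Rightarrow> real"
  assumes conformal: "conformal_submersion A g B g' F dil"
    and smooth_f: "smooth_fun A f"
    and clairaut: "\<And>I \<alpha>. geodesic A g I \<alpha> \<Longrightarrow>
      (\<lambda>t. exp (f (\<alpha> t)) * sin (angle_horizontal A g B F (\<alpha> t) (velocity A \<alpha> t))) constant_on I"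
begin

abbreviation "coord_dom c d \<equiv> chart_map c ` (chart_dom c \<inter> F -` chart_dom d)"

lemma F_smooth: "smooth_map A B F" and F_surj: "surj (differential A B F p)"
  and dil_smooth: "smooth_fun A dil" and dil_pos: "dil p > 0"
  and F_conf: "X \<in> horizontal A g B F p \<Longrightarrow> Y \<in> horizontal A g B F p \<Longrightarrow>
    g' (F p) (differential A B F p X) (differential A B F p Y) = (dil p)\<^sup>2 * g p X Y"
  using conformal by (auto simp: conformal_submersion_def submersion_def)

lemma open_vimage_F: "open W \<Longrightarrow> open (F -` W)"
  using F_smooth by (simp add: smooth_map_def open_vimage)

lemma open_coord_dom: "c \<in> A \<Longrightarrow> d \<in> B \<Longrightarrow> open (coord_dom c d)"
  by (intro open_chart_image_Int open_vimage_F chart_open M.is_chart B.is_chart)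

lemma coord_dom_I: "p \<in> chart_dom c \<Longrightarrow> F p \<in> chart_dom d \<Longrightarrow> chart_map c p \<in> coord_dom c d" by auto

lemma coord_dom_image: "coord_dom c d \<subseteq> chart_image c" by (auto simp: chart_image_def)

lemma local_rep_has_derivative:
  assumes "c \<in> A" "d \<in> B" "x \<in> coord_dom c d"
  shows "(local_rep c d F has_derivative frechet_derivative (local_rep c d F) (at x)) (at x)"
  using F_smooth assms smooth_on_has_derivative by (fastforce simp: smooth_map_def)

text \<open>Two chain rules for the same map, through the chosen charts and through \<open>c\<close>
  and \<open>d\<close>, compared on the open set where all four charts are available.\<close>

lemma differential_from_chart:
  assumes c: "c \<in> A" and d: "d \<in> B" and p: "p \<in> chart_dom c" "F p \<in> chart_dom d"
  shows "differential A B F p (from_chart A c p v) =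
    from_chart B d (F p) (frechet_derivative (local_rep c d F) (at (chart_map c p)) v)"
proof -
  let ?c = "chart_at A p" and ?d = "chart_at B (F p)"
  let ?x = "chart_map c p"
  let ?T = "chart_map c ` (chart_dom c \<inter> (chart_dom ?c \<inter> F -` (chart_dom d \<inter> chart_dom ?d)))"
  have oT: "open ?T"
    by (intro open_chart_image_Int open_Int open_vimage_F chart_open M.is_chart B.is_chart c d M.chart_at B.chart_at)
  have xT: "?x \<in> ?T" using p M.chart_at(2) B.chart_at(2) by auto
  have e1: "(chart_map ?c \<circ> chart_inv c) ?x = chart_map ?c p"
    by (simp add: chart_inv_map M.is_chart c p)
  have "(local_rep ?c ?d F has_derivative differential A B F p) (at ((chart_map ?c \<circ> chart_inv c) ?x))"
    unfolding e1 differential_def by (intro local_rep_has_derivative M.chart_at B.chart_at coord_dom_I)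
  from has_derivative_compose[OF M.transition_has_derivative[OF c M.chart_at(1) p(1) M.chart_at(2)] this]
  have 1: "((\<lambda>x. local_rep ?c ?d F ((chart_map ?c \<circ> chart_inv c) x)) has_derivative
      (\<lambda>v. differential A B F p (from_chart A c p v))) (at ?x)" by (simp add: from_chart_transition)
  have e2: "local_rep c d F ?x = chart_map d (F p)"
    by (simp add: local_rep_def chart_inv_map M.is_chart c p)
  have "((chart_map ?d \<circ> chart_inv d) has_derivative from_chart B d (F p)) (at (local_rep c d F ?x))"
    unfolding e2 from_chart_transition by (intro B.transition_has_derivative B.chart_at d p)
  from has_derivative_compose[OF local_rep_has_derivative[OF c d coord_dom_I[OF p]] this]
  have 2: "((\<lambda>x. (chart_map ?d \<circ> chart_inv d) (local_rep c d F x)) has_derivative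
      (\<lambda>v. from_chart B d (F p) (frechet_derivative (local_rep c d F) (at ?x) v))) (at ?x)" .
  have "((\<lambda>x. local_rep ?c ?d F ((chart_map ?c \<circ> chart_inv c) x)) has_derivative
      (\<lambda>v. from_chart B d (F p) (frechet_derivative (local_rep c d F) (at ?x) v))) (at ?x)"
    by (rule has_derivative_transform_within_open[OF 2 oT xT])
      (auto simp: local_rep_def chart_inv_map M.is_chart B.is_chart c d M.chart_at B.chart_at)
  from has_derivative_unique[OF 1 this] show ?thesis by metis
qed

lemma coords:
  assumes c: "c \<in> A" and d: "d \<in> B"
  shows "submersion_coords (coord_dom c d) (chart_image d) (local_rep c d F) (metric_matrix A g c)
     (metric_matrix B g' d) (dil \<circ> chart_inv c) (f \<circ> chart_inv c)"
proof
  show "open (coord_dom c d)" by (rule open_coord_dom[OF c d])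
  show "open (chart_image d)" by (rule chart_open[OF B.is_chart[OF d]])
  show "local_rep c d F ` coord_dom c d \<subseteq> chart_image d"
    using c by (auto simp: local_rep_def chart_inv_map M.is_chart intro!: chart_map_image)
  show "smooth_on (coord_dom c d) (local_rep c d F)"
    using F_smooth c d by (simp add: smooth_map_def)
  show "smooth_on (coord_dom c d) (metric_matrix A g c)"
    by (rule smooth_on_subset[OF M.smooth_metric_matrix[OF c] coord_dom_image])
  show "smooth_on (chart_image d) (metric_matrix B g' d)" by (rule B.smooth_metric_matrix[OF d])
  show "smooth_on (coord_dom c d) (dil \<circ> chart_inv c)" "smooth_on (coord_dom c d) (f \<circ> chart_inv c)"
    by (rule smooth_on_subset[OF _ coord_dom_image], use dil_smooth smooth_f c in \<open>simp add: smooth_fun_def\<close>)+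
  show "posdef (metric_matrix A g c x)" if "x \<in> coord_dom c d" for x
    using M.metric_matrix_posdef[OF c] that coord_dom_image by blast
  show "posdef (metric_matrix B g' d y)" if "y \<in> chart_image d" for y
    by (rule B.metric_matrix_posdef[OF d that])
  show "(dil \<circ> chart_inv c) x > 0" for x by (simp add: dil_pos)
qed

text \<open>The horizontal part of v is the X in the range of G^-1 J^T with J X = J v. The cosine of
  the angle is the ratio of the lengths of X and v, and conformality expresses the length of X by
  the pulled back metric J^T H J.\<close>

lemma angle_coords:
  assumes c: "c \<in> A" and d: "d \<in> B" and p: "p \<in> chart_dom c" "F p \<in> chart_dom d"
  defines "x \<equiv> chart_map c p"
  defines "J \<equiv> matrix (frechet_derivative (local_rep c d F) (at x))"
    and "G \<equiv> metric_matrix A g c x" and "H \<equiv> metric_matrix B g' d (local_rep c d F x)"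
  shows "H ** (J ** (matrix_inv G ** transpose J)) = mat ((dil p)\<^sup>2)" (is ?conf)
    and "(sin (angle_horizontal A g B F p (from_chart A c p v)))\<^sup>2 =
      1 - v \<bullet> ((transpose J ** (H ** J)) *v v) / ((dil p)\<^sup>2 * (v \<bullet> (G *v v)))" (is ?angle)
proof -
  let ?T = "from_chart A c p" and ?S = "from_chart B d (F p)" and ?D = "differential A B F p"
  interpret C: submersion_coords "coord_dom c d" "chart_image d" "local_rep c d F" "metric_matrix A g c"
    "metric_matrix B g' d" "dil \<circ> chart_inv c" "f \<circ> chart_inv c" by (rule coords[OF c d])
  have xU: "x \<in> coord_dom c d" using p by (auto simp: x_def)
  have xc: "x \<in> chart_image c" using xU coord_dom_image by blast
  have px: "chart_inv c x = p" using p c by (simp add: x_def chart_inv_map M.is_chart)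
  have Fx: "local_rep c d F x = chart_map d (F p)" by (simp add: local_rep_def px)
  have yd: "local_rep c d F x \<in> chart_image d" unfolding Fx by (rule chart_map_image[OF p(2)])
  have Fpx: "chart_inv d (local_rep c d F x) = F p" using p d by (simp add: Fx chart_inv_map B.is_chart)
  have JJ: "J = C.J x" by (simp add: J_def C.J_def)
  have D: "?D (?T w) = ?S (J *v w)" for w
    using differential_from_chart[OF c d p, of w] C.J_mult[OF xU, of w] by (simp add: JJ x_def)
  have gT: "g p (?T v) (?T w) = v \<bullet> (G *v w)" for v w
    using M.g_matrix[OF c xc, of v w] by (simp add: px G_def)
  have gS: "g' (F p) (?S v) (?S w) = v \<bullet> (H *v w)" for v w
    using B.g_matrix[OF d yd, of v w] by (simp add: Fpx H_def)
  have T: "linear ?T" by (rule M.linear_from_chart[OF c p(1)])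
  have Tsurj: "\<exists>w. u = ?T w" for u using M.from_chart_bij(2)[OF c p(1), of u] by metis
  have S0: "?S w = 0 \<longleftrightarrow> w = 0" for w by (rule B.from_chart_eq_0[OF d p(2)])
  have vert: "?T w \<in> vertical A B F p \<longleftrightarrow> J *v w = 0" for w by (simp add: vertical_def D S0)
  have hor: "?T X \<in> horizontal A g B F p \<longleftrightarrow> (\<forall>w. J *v w = 0 \<longrightarrow> X \<bullet> (G *v w) = 0)" for X
    unfolding horizontal_def using Tsurj vert gT by (smt (verit, best) mem_Collect_eq)
  have Jsurj: "surj ((*v) J)"
  proof (rule surjI)
    fix w
    obtain u where "?S w = ?D u" using F_surj by (metis surjD)
    then obtain v where "?S w = ?S (J *v v)" using Tsurj D by metis
    then have "J *v v = w" using B.from_chart_bij(1)[OF d p(2)] by metis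
    then show "J *v (SOME v. J *v v = w) = w" by (rule someI)
  qed
  have cf: "(J *v X) \<bullet> (H *v (J *v Y)) = (dil p)\<^sup>2 * (X \<bullet> (G *v Y))"
    if "\<And>w. J *v w = 0 \<Longrightarrow> X \<bullet> (G *v w) = 0" "\<And>w. J *v w = 0 \<Longrightarrow> Y \<bullet> (G *v w) = 0" for X Y
    using F_conf[of "?T X" p "?T Y"] that by (simp add: hor D gS gT)
  have l: "(dil \<circ> chart_inv c) x = dil p" by (simp add: px)
  have mats: ?conf "surj ((*v) (J ** (matrix_inv G ** transpose J)))"
  proof -
    have cf': "(C.J x *v X) \<bullet> (metric_matrix B g' d (local_rep c d F x) *v (C.J x *v Y)) =
        ((dil \<circ> chart_inv c) x)\<^sup>2 * (X \<bullet> (metric_matrix A g c x *v Y))"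
      if "\<And>w. C.J x *v w = 0 \<Longrightarrow> X \<bullet> (metric_matrix A g c x *v w) = 0"
        "\<And>w. C.J x *v w = 0 \<Longrightarrow> Y \<bullet> (metric_matrix A g c x *v w) = 0" for X Y
      unfolding l using cf[unfolded JJ G_def H_def, OF that] .
    note cm = C.conformal_matrix[OF xU Jsurj[unfolded JJ] cf', unfolded l C.K_def]
    show ?conf unfolding JJ G_def H_def by (rule cm(1))
    show "surj ((*v) (J ** (matrix_inv G ** transpose J)))" unfolding JJ G_def H_def by (rule cm(2))
  qed
  show ?conf by (rule mats(1))
  \<comment> \<open>Surjectivity of J G^-1 J^T yields a horizontal vector with the same image as
    \<open>v\<close>.\<close>
  obtain \<xi> where \<xi>: "J *v v = (J ** (matrix_inv G ** transpose J)) *v \<xi>" using mats(2) by (metis surjD)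
  define X where "X = matrix_inv G *v (transpose J *v \<xi>)"
  have JX: "J *v X = J *v v" by (simp add: \<xi> X_def matrix_vector_mul_assoc[symmetric] del: transpose_matrix_vector)
  have GX: "G *v X = transpose J *v \<xi>"
    unfolding X_def matrix_vector_mul_assoc[of G] using C.GK[OF xU] by (simp add: G_def C.K_def)
  have Gsym: "w \<bullet> (G *v u) = u \<bullet> (G *v w)" for u w
    using gT M.g_sym by metis
  have XG: "X \<bullet> (G *v w) = (J *v w) \<bullet> \<xi>" for w
    unfolding Gsym[of X] GX by (simp add: matrix_inner_left del: transpose_matrix_vector)
  have Xhor: "?T X \<in> horizontal A g B F p" by (simp add: hor XG)
  have Xvert: "J *v (v - X) = 0" by (simp add: matrix_vector_mult_diff_distrib JX)
  have hp: "horizontal_part A g B F p (?T v) = ?T X"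
    unfolding horizontal_part_def
  proof (rule the_equality)
    show "?T X \<in> horizontal A g B F p \<and> ?T v - ?T X \<in> vertical A B F p"
      using Xhor Xvert by (simp add: linear_diff[OF T, symmetric] vert)
    fix h assume h: "h \<in> horizontal A g B F p \<and> ?T v - h \<in> vertical A B F p"
    obtain Y where Y: "h = ?T Y" using Tsurj by blast
    have v1: "J *v (v - Y) = 0" using h by (simp add: Y linear_diff[OF T, symmetric] vert)
    then have v2: "J *v (Y - X) = 0" using Xvert by (simp add: matrix_vector_mult_diff_distrib)
    then have "(Y - X) \<bullet> (G *v (Y - X)) = 0"
      using h Xhor by (simp add: Y hor inner_diff_left)
    then have "g p (?T (Y - X)) (?T (Y - X)) = 0" by (simp add: gT)
    then have "?T (Y - X) = 0" using M.g_pos by (metis less_irrefl)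
    then show "h = ?T X" by (simp add: Y linear_diff[OF T])
  qed
  define P where "P = v \<bullet> ((transpose J ** (H ** J)) *v v)"
  define E where "E = v \<bullet> (G *v v)"
  have l0: "(dil p)\<^sup>2 > 0" by (rule zero_less_power[OF dil_pos])
  have P: "P = (dil p)\<^sup>2 * (X \<bullet> (G *v X))"
  proof -
    have "P = (J *v v) \<bullet> (H *v (J *v v))"
      by (simp add: P_def matrix_inner_left matrix_vector_mul_assoc[symmetric] del: transpose_matrix_vector)
    then show ?thesis using cf[of X X] Xhor by (simp add: JX hor)
  qed
  have pos: "w \<bullet> (G *v w) \<ge> 0" for w
    using C.Gpd[OF xU] unfolding posdef_def G_def by (cases "w = 0") (auto intro: less_imp_le)
  \<comment> \<open>Pythagoras for the horizontal and vertical parts; it keeps the argument of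
    \<open>arccos\<close> at most 1.\<close>
  have "E = X \<bullet> (G *v X) + (v - X) \<bullet> (G *v (v - X))"
    by (simp add: E_def inner_diff_left inner_diff_right matrix_vector_mult_diff_distrib Gsym[of v X] XG JX)
  then have le: "X \<bullet> (G *v X) \<le> E" using pos by simp
  have "angle_horizontal A g B F p (?T v) = arccos (sqrt (X \<bullet> (G *v X)) / sqrt E)"
    unfolding angle_horizontal_def Let_def hp by (simp add: gT E_def)
  \<comment> \<open>For v = 0 the quotient is 0/0 = 0, so the angle is \<pi>/2, and the final
    formula holds with its quotient equal to 0 as well.\<close>
  moreover have "0 \<le> sqrt (X \<bullet> (G *v X)) / sqrt E" "sqrt (X \<bullet> (G *v X)) / sqrt E \<le> 1"
    using le pos[of X] by (auto simp: divide_le_eq_1)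
  ultimately have "(sin (angle_horizontal A g B F p (?T v)))\<^sup>2 = 1 - (sqrt (X \<bullet> (G *v X)) / sqrt E)\<^sup>2"
    by (simp add: sin_squared_eq)
  also have "\<dots> = 1 - (X \<bullet> (G *v X)) / E"
    using le pos[of X] by (simp add: power_divide)
  also have "\<dots> = 1 - P / ((dil p)\<^sup>2 * E)" using l0 by (simp add: P)
  finally show ?angle by (simp add: P_def E_def)
qed

lemma clairaut_in_coords:
  assumes c: "c \<in> A" and d: "d \<in> B"
  shows "clairaut_coords (coord_dom c d) (chart_image d) (local_rep c d F) (metric_matrix A g c)
     (metric_matrix B g' d) (dil \<circ> chart_inv c) (f \<circ> chart_inv c)"
proof -
  interpret C: submersion_coords "coord_dom c d" "chart_image d" "local_rep c d F" "metric_matrix A g c"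
    "metric_matrix B g' d" "dil \<circ> chart_inv c" "f \<circ> chart_inv c" by (rule coords[OF c d])
  have ch: "chart_inv c x \<in> chart_dom c" "F (chart_inv c x) \<in> chart_dom d" "chart_map c (chart_inv c x) = x"
    if "x \<in> coord_dom c d" for x using that c by (auto simp: chart_inv_map M.is_chart)
  show ?thesis
  proof
    fix x assume x: "x \<in> coord_dom c d"
    show "metric_matrix B g' d (local_rep c d F x) ** (C.J x ** (C.K x ** transpose (C.J x))) = mat (((dil \<circ> chart_inv c) x)\<^sup>2)"
      using angle_coords(1)[OF c d ch(1,2)[OF x]] by (simp add: ch(3)[OF x] C.J_def C.K_def)
  next
    fix e :: real and x v
    assume e: "e > 0" and xU: "\<And>t. t \<in> {-e<..<e} \<Longrightarrow> x t \<in> coord_dom c d"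
      and geo: "geodesic_coords (metric_matrix A g c) {-e<..<e} x v"
    let ?I = "{-e<..<e}" and ?\<alpha> = "chart_inv c \<circ> x"
    have "geodesic A g ?I ?\<alpha>"
    proof (rule M.geodesic_of_coords[OF c _ _ _ geo])
      show "x ` ?I \<subseteq> chart_image c" using xU coord_dom_image[of c d] by blast
    qed (auto simp: is_interval_oo)
    from clairaut[OF this] obtain k where
      k: "\<And>t. t \<in> ?I \<Longrightarrow> exp (f (?\<alpha> t)) * sin (angle_horizontal A g B F (?\<alpha> t) (velocity A ?\<alpha> t)) = k"
      unfolding constant_on_def by blast
    \<comment> \<open>Squaring the conserved quantity removes the square roots; the constant becomes
      the square of \<open>k\<close>.\<close>
    have "exp (2 * (f \<circ> chart_inv c) (x t)) * (1 - v t \<bullet> (C.p (x t) *v v t) /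
       (((dil \<circ> chart_inv c) (x t))\<^sup>2 * (v t \<bullet> (metric_matrix A g c (x t) *v v t)))) = k\<^sup>2" if t: "t \<in> ?I" for t
    proof -
      note q = ch[OF xU[OF t]]
      have "((chart_map c \<circ> ?\<alpha>) has_vector_derivative v t) (at t)"
        by (rule has_vector_derivative_on_open[of ?I x]) (use geo t ch(3)[OF xU] in \<open>auto simp: geodesic_coords_def\<close>)
      then have "velocity A ?\<alpha> t = from_chart A c (?\<alpha> t) (v t)"
        by (intro M.velocity_eq[OF c, of ?I]) (use t ch(1)[OF xU] in auto)
      then have "k\<^sup>2 = (exp (f (?\<alpha> t)) * sin (angle_horizontal A g B F (?\<alpha> t) (from_chart A c (?\<alpha> t) (v t))))\<^sup>2"
        using k[OF t] by simp
      also have "\<dots> = exp (2 * f (?\<alpha> t)) * (sin (angle_horizontal A g B F (?\<alpha> t) (from_chart A c (?\<alpha> t) (v t))))\<^sup>2"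
        by (simp add: power_mult_distrib exp_double)
      finally show ?thesis
        using angle_coords(2)[OF c d q(1,2), of "v t"] by (simp add: q(3) C.p_def C.J_def)
    qed
    then show "\<exists>k. \<forall>t\<in>?I. exp (2 * (f \<circ> chart_inv c) (x t)) * (1 - v t \<bullet> (C.p (x t) *v v t) /
       (((dil \<circ> chart_inv c) (x t))\<^sup>2 * (v t \<bullet> (metric_matrix A g c (x t) *v v t)))) = k" by blast
  qed
qed

lemma vertical_derivatives:
  assumes "c \<in> A" "d \<in> B" "x \<in> coord_dom c d" "frechet_derivative (local_rep c d F) (at x) v = 0"
  shows "frechet_derivative (f \<circ> chart_inv c) (at x) v = 0" "frechet_derivative (dil \<circ> chart_inv c) (at x) v = 0"
proof -
  interpret C: clairaut_coords "coord_dom c d" "chart_image d" "local_rep c d F" "metric_matrix A g c"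
    "metric_matrix B g' d" "dil \<circ> chart_inv c" "f \<circ> chart_inv c" by (rule clairaut_in_coords[OF assms(1,2)])
  show "frechet_derivative (f \<circ> chart_inv c) (at x) v = 0" "frechet_derivative (dil \<circ> chart_inv c) (at x) v = 0"
    using C.vertical_derivatives[OF assms(3)] C.J_mult[OF assms(3)] assms(4) by simp_all
qed

text \<open>The special form of \<open>dil\<close> makes its differential k dil df, and
  \<open>eq\<close> turns this into the hypothesis of \<open>tension_eq_0\<close>. The rest matches
  \<open>second_fundamental_form\<close> with the columns of \<open>sff\<close>.\<close>

lemma harmonic:
  assumes k: "\<And>p. dil p = exp (k * f p)"
    and eq: "real CARD('m) - real CARD('n) = (real CARD('n) - 2) * k"
  shows "harmonic_map A g B g' F"
  unfolding harmonic_map_def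
proof (intro conjI allI F_smooth)
  fix p
  let ?c = "chart_at A p" and ?d = "chart_at B (F p)"
  let ?x = "chart_map ?c p" and ?\<Phi> = "local_rep ?c ?d F"
  interpret C: clairaut_coords "coord_dom ?c ?d" "chart_image ?d" ?\<Phi> "metric_matrix A g ?c"
    "metric_matrix B g' ?d" "dil \<circ> chart_inv ?c" "f \<circ> chart_inv ?c"
    by (rule clairaut_in_coords[OF M.chart_at(1) B.chart_at(1)])
  have x: "?x \<in> coord_dom ?c ?d" by (intro coord_dom_I M.chart_at B.chart_at)
  have px: "chart_inv ?c ?x = p" by (intro chart_inv_map M.is_chart M.chart_at)
  have Fx: "?\<Phi> ?x = chart_map ?d (F p)" by (simp add: local_rep_def px)
  have P1: "partial j (\<lambda>z. ?\<Phi> z $ \<gamma>) y = C.J y $ \<gamma> $ j" if "y \<in> coord_dom ?c ?d" for j \<gamma> y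
    using frechet_nth[OF smooth_on_has_derivative[OF C.\<Phi> that], of \<gamma> "axis j 1"]
    by (simp add: partial_def C.J_def matrix_def)
  have P2: "partial i (partial j (\<lambda>z. ?\<Phi> z $ \<gamma>)) ?x = frechet_derivative C.J (at ?x) (axis i 1) $ \<gamma> $ j" for i j \<gamma>
  proof -
    have "((\<lambda>y. C.J y $ \<gamma> $ j) has_derivative (\<lambda>v. frechet_derivative C.J (at ?x) v $ \<gamma> $ j)) (at ?x)"
      by (intro has_derivative_vec_nth C.J_deriv x)
    then have "(partial j (\<lambda>z. ?\<Phi> z $ \<gamma>) has_derivative (\<lambda>v. frechet_derivative C.J (at ?x) v $ \<gamma> $ j)) (at ?x)"
      by (rule has_derivative_transform_within_open[OF _ C.U x]) (simp add: P1)
    from frechet_derivative_at[OF this] show ?thesis unfolding partial_def[of i] by metis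
  qed
  have S: "second_fundamental_form A g B g' F ?c ?d p i j = C.sff ?x (axis i 1) *v axis j 1" for i j
  proof -
    have "(connection_matrix (metric_matrix B g' ?d) (?\<Phi> ?x) (C.J ?x *v axis i 1) ** C.J ?x) $ \<gamma> $ j =
      (\<Sum>\<mu>\<in>UNIV. \<Sum>\<nu>\<in>UNIV. christoffel_symbol (metric_matrix B g' ?d) \<gamma> \<mu> \<nu> (?\<Phi> ?x) * C.J ?x $ \<mu> $ i * C.J ?x $ \<nu> $ j)" for \<gamma>
      unfolding matrix_matrix_mult_def connection_matrix_def matrix_vector_mult_basis column_def
      by (simp add: sum_distrib_right) (rule sum.swap)
    moreover have "(C.J ?x ** connection_matrix (metric_matrix A g ?c) ?x (axis i 1)) $ \<gamma> $ j =
      (\<Sum>k\<in>UNIV. christoffel_symbol (metric_matrix A g ?c) k i j ?x * C.J ?x $ \<gamma> $ k)" for \<gamma>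
      by (simp add: matrix_matrix_mult_def connection_matrix_axis mult.commute)
    ultimately show ?thesis
      by (simp add: second_fundamental_form_def Let_def vec_eq_iff P1[OF x] P2 christoffel_eq_symbol C.sff_def Fx[symmetric]
          matrix_vector_mult_basis column_def)
  qed
  have "(\<Sum>i\<in>UNIV. \<Sum>j\<in>UNIV. (C.K ?x $ i $ j) *\<^sub>R (C.sff ?x (axis i 1) *v axis j 1)) = 0"
  proof (rule C.tension_eq_0[OF x])
    fix u
    have "((\<lambda>y. exp (k * (f \<circ> chart_inv ?c) y)) has_derivative
        (\<lambda>u. exp (k * (f \<circ> chart_inv ?c) ?x) * (k * C.d\<phi> ?x u))) (at ?x)"
      by (rule has_derivative_exp_mult[OF C.phi_has_derivative[OF x]])
    moreover have "(\<lambda>y. exp (k * (f \<circ> chart_inv ?c) y)) = dil \<circ> chart_inv ?c" by (auto simp: k)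
    ultimately have "C.dl ?x = (\<lambda>u. exp (k * (f \<circ> chart_inv ?c) ?x) * (k * C.d\<phi> ?x u))"
      using frechet_derivative_at by metis
    then show "(real CARD('m) - real CARD('n)) * ((dil \<circ> chart_inv ?c) ?x * C.d\<phi> ?x u) = (real CARD('n) - 2) * C.dl ?x u"
      by (simp add: eq k algebra_simps)
  qed
  then show "tension_field A g B g' F p = 0"
    unfolding tension_field_def Let_def S C.K_def .
qed

end

section \<open>Descent to the base\<close>

lemma matrix_linear_mult: "linear f \<Longrightarrow> matrix f *v v = f (v :: real^'n)"
  by (metis matrix_vector_mul(2))

text \<open>Bootstrap from mere differentiability: the derivative of \<open>g\<close> at y is the
  inverse Jacobian of \<open>\<Theta>\<close> at g(y), so it is of class k whenever \<open>g\<close>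
  is.\<close>

lemma smooth_on_inverse_function:
  fixes \<Theta> g :: "real^'m::finite \<Rightarrow> real^'m"
  assumes U: "open U" and V: "open V" and \<Theta>: "smooth_on U \<Theta>" and gU: "g ` V \<subseteq> U"
    and inv: "\<And>y. y \<in> V \<Longrightarrow> \<Theta> (g y) = y" and g: "\<And>y. y \<in> V \<Longrightarrow> (g has_derivative g' y) (at y)"
  shows "smooth_on V g"
proof -
  define M where "M = (\<lambda>x. matrix (frechet_derivative \<Theta> (at x)))"
  have sM: "smooth_on U (\<lambda>x. M x $ i $ j)" for i j
    unfolding M_def matrix_def using smooth_on_nth[OF U smooth_on_frechet_derivative[OF \<Theta>]] by simp
  have Mx: "frechet_derivative \<Theta> (at x) v = M x *v v" if "x \<in> U" for x v
    unfolding M_def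
    by (rule matrix_linear_mult[OF has_derivative_linear[OF smooth_on_has_derivative[OF \<Theta> that]], symmetric])
  have Mg: "M (g y) *v g' y v = v" if "y \<in> V" for y v
  proof -
    have gy: "g y \<in> U" using gU that by auto
    have "((\<lambda>y. \<Theta> (g y)) has_derivative (\<lambda>v. frechet_derivative \<Theta> (at (g y)) (g' y v))) (at y)"
      by (rule has_derivative_compose[OF g[OF that] smooth_on_has_derivative[OF \<Theta> gy]])
    moreover have "((\<lambda>y. \<Theta> (g y)) has_derivative (\<lambda>v. v)) (at y)"
      by (rule has_derivative_transform_within_open[OF has_derivative_ident V that]) (simp add: inv)
    ultimately have "(\<lambda>v. frechet_derivative \<Theta> (at (g y)) (g' y v)) = (\<lambda>v. v)"
      by (rule has_derivative_unique)
    from fun_cong[OF this, of v] show ?thesis by (simp add: Mx gy)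
  qed
  have invM: "invertible (M (g y))" if "y \<in> V" for y
  proof -
    have "matrix (g' y) *v v = g' y v" for v
      by (rule matrix_linear_mult[OF has_derivative_linear[OF g[OF that]]])
    then have "M (g y) ** matrix (g' y) = mat 1"
      by (simp add: matrix_eq matrix_vector_mul_assoc[symmetric] Mg that)
    then show ?thesis using invertible_right_inverse by blast
  qed
  have g'_eq: "g' y v = matrix_inv (M (g y)) *v v" if "y \<in> V" for y v
    using Mg[OF that, of v] matrix_inv_left[OF invM[OF that]] by (metis matrix_vector_mul_assoc matrix_vector_mul_lid)
  \<comment> \<open>Matrix inversion is smooth only where the determinant does not vanish; the open
    set \<open>W\<close> still contains the image of \<open>g\<close>.\<close>
  define W where "W = U \<inter> (\<lambda>x. det (M x)) -` (- {0})"
  have oW: "open W"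
    unfolding W_def by (rule continuous_open_preimage[OF smooth_on_continuous[OF smooth_on_det[OF U sM]] U]) auto
  have gW: "g ` V \<subseteq> W" using gU invM by (auto simp: W_def invertible_det_nz)
  have sI: "smooth_on W (\<lambda>x. matrix_inv (M x) $ i $ j)" for i j
    by (rule smooth_on_matrix_inv[OF oW smooth_on_subset[OF sM]]) (auto simp: W_def invertible_det_nz)
  have "ck_on k V g" for k
  proof (induction k)
    case 0
    show ?case using g by (auto intro!: continuous_at_imp_continuous_on has_derivative_continuous)
  next
    case (Suc k)
    show ?case
    proof (rule ck_on_SucI[OF V g])
      fix v
      have c: "ck_on k V (\<lambda>y. matrix_inv (M (g y)) $ i $ j)" for i j
        by (rule ck_on_compose[OF V oW gW Suc]) (use sI in \<open>simp add: smooth_on_def\<close>)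
      have "ck_on k V (\<lambda>y. matrix_inv (M (g y)) *v v)"
        by (rule ck_on_vec[OF V])
          (simp add: matrix_vector_mult_def ck_on_sum ck_on_mult ck_on_const c V)
      then show "ck_on k V (\<lambda>y. g' y v)"
        using ck_on_cong[OF V, of "\<lambda>y. g' y v" "\<lambda>y. matrix_inv (M (g y)) *v v"] g'_eq by simp
    qed
  qed
  then show ?thesis by (simp add: smooth_on_def)
qed

text \<open>Adding to the identity the lift of the nonlinear part of \<open>\<Phi>\<close> gives a local diffeomorphism
  \<open>\<Theta>\<close> with \<open>\<Phi> = D \<circ> \<Theta>\<close>.\<close>

lemma submersion_straighten:
  fixes \<Phi> :: "real^'m::finite \<Rightarrow> real^'n::finite"
  assumes U: "open U" and \<Phi>: "smooth_on U \<Phi>" and x0: "x0 \<in> U"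
    and surj: "surj (frechet_derivative \<Phi> (at x0))"
  obtains \<Theta> \<Xi> :: "real^'m \<Rightarrow> real^'m" and U' V D R where "open U'" "U' \<subseteq> U" "x0 \<in> U'" "open V" "homeomorphism U' V \<Theta> \<Xi>"
    "smooth_on V \<Xi>" "linear D" "linear R" "\<forall>y. D (R y) = y" "\<forall>x\<in>U. \<Phi> x = D (\<Theta> x)"
proof -
  define D where "D = frechet_derivative \<Phi> (at x0)"
  have linD: "linear D" unfolding D_def using smooth_on_has_derivative[OF \<Phi> x0] has_derivative_linear by blast
  obtain R where R: "linear R" "D \<circ> R = id"
    using linear_surjective_right_inverse[OF linD] surj by (auto simp: D_def)
  have DR: "D (R y) = y" for y using R(2) by (metis comp_apply id_apply)
  have bR: "bounded_linear R" and bD: "bounded_linear D"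
    using R(1) linD by (simp_all add: linear_conv_bounded_linear)
  \<comment> \<open>D R = id gives D (\<Theta> x) = \<Phi> x. The correction R (\<Phi> x - D x) has
    derivative 0 at \<open>x0\<close>, so \<Theta> has the identity as derivative there and the
    inverse function theorem applies.\<close>
  define \<Theta> where "\<Theta> = (\<lambda>x. x + R (\<Phi> x - D x))"
  have s\<Theta>: "smooth_on U \<Theta>"
    unfolding \<Theta>_def
    by (intro smooth_on_add smooth_on_bounded_linear[OF U bR] smooth_on_diff \<Phi> U smooth_on_linear bD bounded_linear_ident)
  \<comment> \<open>The inverse function theorem takes the derivative as a continuous
    operator-valued map; continuity is checked direction by direction.\<close>
  define T where "T = (\<lambda>x. Blinfun (frechet_derivative \<Theta> (at x)))"
  have T: "blinfun_apply (T x) = frechet_derivative \<Theta> (at x)" if "x \<in> U" for x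
    unfolding T_def using smooth_on_has_derivative[OF s\<Theta> that] has_derivative_bounded_linear
    by (intro bounded_linear_Blinfun_apply) blast
  have d\<Theta>: "(\<Theta> has_derivative blinfun_apply (T x)) (at x)" if "x \<in> U" for x
    using smooth_on_has_derivative[OF s\<Theta> that] by (simp add: T that)
  have cT: "continuous_on U T"
  proof (rule continuous_on_blinfun_componentwise)
    fix i :: "real^'m"
    have "continuous_on U (\<lambda>x. frechet_derivative \<Theta> (at x) i)"
      by (rule smooth_on_continuous[OF smooth_on_frechet_derivative[OF s\<Theta>]])
    then show "continuous_on U (\<lambda>x. blinfun_apply (T x) i)" by (simp add: T cong: continuous_on_cong)
  qed
  have "(\<Theta> has_derivative (\<lambda>v. v + R (D v - D v))) (at x0)"
    unfolding \<Theta>_def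
    by (intro has_derivative_add has_derivative_ident bounded_linear.has_derivative[OF bR] has_derivative_diff
        bounded_linear_imp_has_derivative[OF bD]) (use smooth_on_has_derivative[OF \<Phi> x0] in \<open>simp add: D_def\<close>)
  then have "(\<Theta> has_derivative (\<lambda>v. v)) (at x0)" by (simp add: linear_0[OF R(1)])
  with d\<Theta>[OF x0] have "blinfun_apply (T x0) = (\<lambda>v. v)" by (rule has_derivative_unique)
  then have id: "id_blinfun o\<^sub>L T x0 = id_blinfun" by (intro blinfun_eqI) simp
  obtain U' V \<Xi> \<Xi>' where h: "open U'" "U' \<subseteq> U" "x0 \<in> U'" "open V" "homeomorphism U' V \<Theta> \<Xi>"
    and d: "\<And>y. y \<in> V \<Longrightarrow> (\<Xi> has_derivative \<Xi>' y) (at y)"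
    by (rule inverse_function_theorem[OF U d\<Theta> cT x0 id]) (assumption, rule that)
  have "smooth_on V \<Xi>"
    by (rule smooth_on_inverse_function[OF U h(4) s\<Theta> _ _ d]) (use h in \<open>auto simp: homeomorphism_def\<close>)
  moreover have "\<Phi> x = D (\<Theta> x)" for x
    by (simp add: \<Theta>_def linear_add[OF linD] DR)
  ultimately show ?thesis by (intro that[OF h, of D R] linD R(1)) (simp_all add: DR)
qed

text \<open>In straightened coordinates \<open>\<Phi>\<close> is the linear map D, whose fibres meet
  a ball in convex sets. There \<open>h\<close> has zero derivative along the fibres, hence is
  constant on them, and k is the restriction of \<open>h\<close> to an affine section of D.\<close>

lemma factor_through_submersion:
  fixes \<Phi> :: "real^'m::finite \<Rightarrow> real^'n::finite" and h :: "real^'m \<Rightarrow> real"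
  assumes U: "open U" and \<Phi>: "smooth_on U \<Phi>" and x0: "x0 \<in> U"
    and surj: "surj (frechet_derivative \<Phi> (at x0))"
    and h: "smooth_on U h" and vert: "\<And>x v. x \<in> U \<Longrightarrow> frechet_derivative \<Phi> (at x) v = 0 \<Longrightarrow> frechet_derivative h (at x) v = 0"
  obtains U' V' k where "open U'" "x0 \<in> U'" "U' \<subseteq> U" "open V'" "\<Phi> ` U' = V'" "smooth_on V' k"
    "\<forall>x\<in>U'. h x = k (\<Phi> x)"
proof -
  obtain \<Theta> \<Xi> :: "real^'m \<Rightarrow> real^'m" and U1 V D R
    where o: "open U1" "U1 \<subseteq> U" "x0 \<in> U1" "open V" "homeomorphism U1 V \<Theta> \<Xi>"
    and \<Xi>: "smooth_on V \<Xi>" and lin: "linear D" "linear R" and DR': "\<forall>y. D (R y) = y"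
    and \<Phi>D': "\<forall>x\<in>U. \<Phi> x = D (\<Theta> x)"
    by (rule submersion_straighten[OF U \<Phi> x0 surj])
  have DR: "D (R y) = y" for y using DR' by blast
  have \<Phi>D: "\<Phi> x = D (\<Theta> x)" if "x \<in> U" for x using \<Phi>D' that by blast
  define z0 where "z0 = \<Theta> x0"
  have \<Theta>V: "\<Theta> x \<in> V" "\<Xi> (\<Theta> x) = x" if "x \<in> U1" for x using o(5) that by (auto simp: homeomorphism_def)
  have \<Xi>U: "\<Xi> z \<in> U1" "\<Theta> (\<Xi> z) = z" if "z \<in> V" for z using o(5) that by (auto simp: homeomorphism_def)
  obtain r where r: "r > 0" "ball z0 r \<subseteq> V"
    using o(4) \<Theta>V(1)[OF o(3)] by (auto simp: z0_def elim: openE)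
  have \<Phi>\<Xi>: "\<Phi> (\<Xi> z) = D z" if "z \<in> V" for z using \<Phi>D \<Xi>U[OF that] o(2) by auto
  \<comment> \<open>An affine section of D through \<open>z0\<close>.\<close>
  define s where "s = (\<lambda>y. z0 + R (y - D z0))"
  have bR: "bounded_linear R" using lin by (simp add: linear_conv_bounded_linear)
  have bD: "bounded_linear D" using lin by (simp add: linear_conv_bounded_linear)
  have cs: "continuous_on UNIV s"
    unfolding s_def by (intro continuous_intros bounded_linear.continuous_on[OF bR])
  have cD: "continuous_on UNIV D" by (rule linear_continuous_on[OF bD])
  have Ds: "D (s y) = y" for y by (simp add: s_def linear_add[OF lin(1)] DR)
  define V' where "V' = s -` ball z0 r"
  have oV': "open V'" unfolding V'_def by (rule open_vimage[OF open_ball cs])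
  \<comment> \<open>In straightened coordinates, a point of \<open>U'\<close> and the section point
    of its fibre both lie in the ball, so the segment joining them does too.\<close>
  define U' where "U' = U1 \<inter> \<Theta> -` (ball z0 r \<inter> D -` V')"
  have oU': "open U'"
    unfolding U'_def
  proof (rule continuous_open_preimage[OF _ o(1)])
    show "continuous_on U1 \<Theta>" using o(5) by (simp add: homeomorphism_def)
    show "open (ball z0 r \<inter> D -` V')" by (intro open_Int open_ball open_vimage oV' cD)
  qed
  have const: "h (\<Xi> z) = h (\<Xi> w)" if z: "z \<in> ball z0 r" and w: "w \<in> ball z0 r" and D: "D z = D w" for z w
  proof -
    have seg: "z + t *\<^sub>R (w - z) \<in> V" if "t \<in> {0..1}" for t
    proof -
      have "(1 - t) *\<^sub>R z + t *\<^sub>R w \<in> ball z0 r" using that by (intro convexD[OF convex_ball z w]) auto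
      then show ?thesis using r(2) by (auto simp: algebra_simps)
    qed
    have "\<exists>c. \<forall>t\<in>{0..1::real}. h (\<Xi> (z + t *\<^sub>R (w - z))) = c"
    proof (rule has_derivative_zero_constant)
      fix t :: real assume t: "t \<in> {0..1}"
      let ?y = "z + t *\<^sub>R (w - z)"
      have \<Xi>d: "(\<Xi> has_derivative frechet_derivative \<Xi> (at ?y)) (at ?y)"
        by (rule smooth_on_has_derivative[OF \<Xi> seg[OF t]])
      have xU: "\<Xi> ?y \<in> U" using \<Xi>U(1)[OF seg[OF t]] o(2) by auto
      have "((\<lambda>y. \<Phi> (\<Xi> y)) has_derivative (\<lambda>v. frechet_derivative \<Phi> (at (\<Xi> ?y)) (frechet_derivative \<Xi> (at ?y) v))) (at ?y)"
        by (rule has_derivative_compose[OF \<Xi>d smooth_on_has_derivative[OF \<Phi> xU]])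
      moreover have "((\<lambda>y. \<Phi> (\<Xi> y)) has_derivative D) (at ?y)"
        by (rule has_derivative_transform_within_open[OF bounded_linear_imp_has_derivative[OF bD] o(4) seg[OF t]])
          (simp add: \<Phi>\<Xi>)
      ultimately have "(\<lambda>v. frechet_derivative \<Phi> (at (\<Xi> ?y)) (frechet_derivative \<Xi> (at ?y) v)) = D"
        by (rule has_derivative_unique)
      \<comment> \<open>w - z lies in the kernel of D, so the derivative of \<Xi> carries it to a
        vertical vector.\<close>
      from fun_cong[OF this, of "w - z"] have "frechet_derivative h (at (\<Xi> ?y)) (frechet_derivative \<Xi> (at ?y) (w - z)) = 0"
        using vert[OF xU] D by (simp add: linear_diff[OF lin(1)])
      moreover have "((\<lambda>y. h (\<Xi> y)) has_derivative (\<lambda>v. frechet_derivative h (at (\<Xi> ?y)) (frechet_derivative \<Xi> (at ?y) v))) (at ?y)"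
        by (rule has_derivative_compose[OF \<Xi>d smooth_on_has_derivative[OF h xU]])
      moreover have "((\<lambda>t. z + t *\<^sub>R (w - z)) has_vector_derivative w - z) (at t)"
        by (auto intro!: derivative_eq_intros)
      ultimately have "((\<lambda>t. h (\<Xi> (z + t *\<^sub>R (w - z)))) has_vector_derivative 0) (at t)"
        using has_vector_derivative_compose_curve[of "\<lambda>y. h (\<Xi> y)" _ "\<lambda>t. z + t *\<^sub>R (w - z)" t "w - z"] by fastforce
      then show "((\<lambda>t. h (\<Xi> (z + t *\<^sub>R (w - z)))) has_derivative (\<lambda>v. 0)) (at t within {0..1})"
        by (auto simp: has_vector_derivative_def intro: has_derivative_at_withinI)
    qed auto
    then obtain c where "\<And>t. t \<in> {0..1::real} \<Longrightarrow> h (\<Xi> (z + t *\<^sub>R (w - z))) = c" by blast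
    from this[of 0] this[of 1] show ?thesis by simp
  qed
  show ?thesis
  proof (rule that[OF oU' _ _ oV'])
    have Dz: "D z0 = \<Phi> x0" using \<Phi>D[OF x0] by (simp add: z0_def)
    show "x0 \<in> U'" using o(3) r(1) by (simp add: U'_def V'_def s_def z0_def[symmetric] linear_0[OF lin(2)])
    show "U' \<subseteq> U" using o(2) by (auto simp: U'_def)
    show "\<Phi> ` U' = V'"
    proof (intro equalityI subsetI)
      fix y assume "y \<in> \<Phi> ` U'"
      then show "y \<in> V'" using \<Phi>D o(2) by (auto simp: U'_def)
    next
      fix y assume y: "y \<in> V'"
      then have sV: "s y \<in> V" "s y \<in> ball z0 r" using r(2) by (auto simp: V'_def)
      have "\<Xi> (s y) \<in> U'" using \<Xi>U[OF sV(1)] sV(2) y by (simp add: U'_def Ds)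
      moreover have "\<Phi> (\<Xi> (s y)) = y" by (simp add: \<Phi>\<Xi> sV Ds)
      ultimately show "y \<in> \<Phi> ` U'" by force
    qed
    have ss: "smooth_on V' s"
      unfolding s_def
      by (intro smooth_on_add smooth_on_const smooth_on_bounded_linear[OF oV' bR] smooth_on_diff smooth_on_linear
          bounded_linear_ident oV')
    have "smooth_on V' (\<lambda>y. \<Xi> (s y))"
      by (rule smooth_on_compose[OF oV' o(4) _ ss \<Xi>]) (use r(2) in \<open>auto simp: V'_def\<close>)
    then show "smooth_on V' (\<lambda>y. h (\<Xi> (s y)))"
      by (rule smooth_on_compose[OF oV' U _ _ h, rotated])
        (use r(2) \<Xi>U(1) o(2) in \<open>auto simp: V'_def\<close>)
    show "\<forall>x\<in>U'. h x = h (\<Xi> (s (\<Phi> x)))"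
    proof
    fix x assume x: "x \<in> U'"
    then have xz: "\<Theta> x \<in> ball z0 r" "s (D (\<Theta> x)) \<in> ball z0 r" "x \<in> U1" by (auto simp: U'_def V'_def)
    have "h x = h (\<Xi> (\<Theta> x))" using \<Theta>V xz by simp
    also have "\<dots> = h (\<Xi> (s (D (\<Theta> x))))" by (rule const[OF xz(1,2)]) (simp add: Ds)
    finally show "h x = h (\<Xi> (s (\<Phi> x)))" using \<Phi>D xz(3) o(2) by auto
    qed
  qed
qed

section \<open>Functions on the total space that descend to the base\<close>

context clairaut_manifolds
begin

text \<open>An infinitesimal form of constancy along the fibres: the differential vanishes on
  vertical vectors, tested in every pair of charts.\<close>

definition basic :: "('a \<Rightarrow> real) \<Rightarrow> bool" where
  "basic h \<longleftrightarrow> smooth_fun A h \<and> (\<forall>c\<in>A. \<forall>d\<in>B. \<forall>x\<in>coord_dom c d. \<forall>v.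
     frechet_derivative (local_rep c d F) (at x) v = 0 \<longrightarrow> frechet_derivative (h \<circ> chart_inv c) (at x) v = 0)"

lemma surj_local_rep:
  assumes c: "c \<in> A" and d: "d \<in> B" and p: "p \<in> chart_dom c" "F p \<in> chart_dom d"
  shows "surj (frechet_derivative (local_rep c d F) (at (chart_map c p)))"
proof (rule surjI)
  fix w
  obtain u where "from_chart B d (F p) w = differential A B F p u" using F_surj by (metis surjD)
  moreover have "u = from_chart A c p (transition (chart_at A p) c p u)"
    using M.from_chart_bij(2)[OF c p(1)] by simp
  ultimately obtain v where "from_chart B d (F p) w = from_chart B d (F p) (frechet_derivative (local_rep c d F) (at (chart_map c p)) v)"
    using differential_from_chart[OF c d p] by metis
  then have "frechet_derivative (local_rep c d F) (at (chart_map c p)) v = w"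
    using B.from_chart_bij(1)[OF d p(2)] by metis
  then show "frechet_derivative (local_rep c d F) (at (chart_map c p)) (SOME v. frechet_derivative (local_rep c d F) (at (chart_map c p)) v = w) = w"
    by (rule someI)
qed

lemma basic_factor:
  assumes h: "basic h" and c: "c \<in> A" and d: "d \<in> B" and p: "p \<in> chart_dom c" "F p \<in> chart_dom d"
  obtains U' V' k where "open U'" "chart_map c p \<in> U'" "U' \<subseteq> coord_dom c d" "open V'" "local_rep c d F ` U' = V'"
    "smooth_on V' k" "\<forall>x\<in>U'. h (chart_inv c x) = k (local_rep c d F x)"
proof -
  interpret C: submersion_coords "coord_dom c d" "chart_image d" "local_rep c d F" "metric_matrix A g c"
    "metric_matrix B g' d" "dil \<circ> chart_inv c" "f \<circ> chart_inv c" by (rule coords[OF c d])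
  have hs: "smooth_on (coord_dom c d) (h \<circ> chart_inv c)"
    by (rule smooth_on_subset[OF _ coord_dom_image]) (use h c in \<open>simp add: basic_def smooth_fun_def\<close>)
  have v: "frechet_derivative (h \<circ> chart_inv c) (at x) v = 0"
    if "x \<in> coord_dom c d" "frechet_derivative (local_rep c d F) (at x) v = 0" for x v
    using h c d that unfolding basic_def by blast
  show ?thesis
    by (rule factor_through_submersion[OF C.U C.\<Phi> coord_dom_I[OF p] surj_local_rep[OF c d p] hs v], assumption, assumption)
      (rule that, assumption+, simp add: o_def)
qed

text \<open>By \<open>basic_factor\<close> the function is locally a function of \<open>F\<close>,
  hence locally constant on the fibre in the subspace topology; connectedness does the rest.\<close>

lemma basic_constant_on_fibres:
  assumes h: "basic h" and conn: "\<And>b. connected (F -` {b})" and eq: "F p = F q"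
  shows "h p = h q"
proof -
  have "h constant_on (F -` {F p})"
  proof (rule locally_constant_imp_constant[OF conn])
    fix a assume "a \<in> F -` {F p}"
    then have Fa: "F a = F p" by simp
    let ?c = "chart_at A a" and ?d = "chart_at B (F a)"
    obtain U' V' k where U': "open U'" "chart_map ?c a \<in> U'" "U' \<subseteq> coord_dom ?c ?d"
      and k: "\<forall>x\<in>U'. h (chart_inv ?c x) = k (local_rep ?c ?d F x)"
      by (rule basic_factor[OF h M.chart_at(1) B.chart_at(1) M.chart_at(2) B.chart_at(2), of a])
    let ?N = "chart_dom ?c \<inter> chart_map ?c -` U'"
    have ch: "is_chart ?c" by (rule M.is_chart[OF M.chart_at(1)])
    have N: "open ?N"
      by (rule continuous_open_preimage[OF _ chart_open(1)[OF ch] U'(1)])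
        (use ch in \<open>simp add: is_chart_def homeomorphism_def\<close>)
    have hk: "h x = k (chart_map ?d (F x))" if "x \<in> ?N" for x
      using bspec[OF k, of "chart_map ?c x"] that by (simp add: local_rep_def chart_inv_map[OF ch])
    have aN: "a \<in> ?N" using U'(2) M.chart_at(2) by simp
    have 1: "openin (top_of_set (F -` {F p})) (F -` {F p} \<inter> ?N)" using N by (rule openin_open_Int)
    have 2: "h x = h a" if "x \<in> F -` {F p} \<inter> ?N" for x
    proof -
      have "F x = F a" using that Fa by simp
      then show ?thesis using hk[of x] hk[OF aN] that by simp
    qed
    have 3: "a \<in> F -` {F p} \<inter> ?N" using aN Fa by simp
    show "\<exists>T. openin (top_of_set (F -` {F p})) T \<and> a \<in> T \<and> (\<forall>x\<in>T. h x = h a)"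
      by (intro exI conjI ballI) (rule 1, rule 3, rule 2)
  qed
  then obtain k where "\<And>x. x \<in> F -` {F p} \<Longrightarrow> h x = k" unfolding constant_on_def by blast
  then show ?thesis using eq by simp
qed

text \<open>\<open>inv F\<close> may be discontinuous. Near a point the composition with it equals
  the local factor \<open>k\<close>, because \<open>h\<close> does not depend on the preimage
  chosen.\<close>

lemma basic_descends:
  assumes h: "basic h" and conn: "\<And>b. connected (F -` {b})" and surjF: "surj F"
  shows "smooth_fun B (h \<circ> inv F)"
  unfolding smooth_fun_def
proof
  fix d assume d: "d \<in> B"
  show "smooth_on (chart_image d) (h \<circ> inv F \<circ> chart_inv d)"
  proof (rule smooth_on_local)
    fix y assume y: "y \<in> chart_image d"
    let ?p = "inv F (chart_inv d y)"
    let ?c = "chart_at A ?p"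
    have Fp: "F ?p = chart_inv d y" by (rule surj_f_inv_f[OF surjF])
    have p: "?p \<in> chart_dom ?c" "F ?p \<in> chart_dom d"
      using chart_inv_dom[OF B.is_chart[OF d] y] M.chart_at(2) by (simp_all add: Fp)
    have ch: "is_chart ?c" by (rule M.is_chart[OF M.chart_at(1)])
    obtain U' V' k where U': "chart_map ?c ?p \<in> U'" "U' \<subseteq> coord_dom ?c d"
      and V': "open V'" "local_rep ?c d F ` U' = V'" "smooth_on V' k"
      and k: "\<forall>x\<in>U'. h (chart_inv ?c x) = k (local_rep ?c d F x)"
      by (rule basic_factor[OF h M.chart_at(1) d p])
    have "local_rep ?c d F (chart_map ?c ?p) = y"
      using y d by (simp add: local_rep_def chart_inv_map[OF ch p(1)] Fp chart_map_inv B.is_chart)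
    then have yV: "y \<in> V'" using U'(1) V'(2) by force
    have "(h \<circ> inv F \<circ> chart_inv d) z = k z" if z: "z \<in> V'" for z
    proof -
      obtain x where x: "x \<in> U'" "local_rep ?c d F x = z" using z V'(2) by auto
      let ?q = "chart_inv ?c x"
      have q: "F ?q \<in> chart_dom d" using x(1) U'(2) by (auto simp: chart_inv_map[OF ch])
      have "chart_map d (F ?q) = z" using x(2) by (simp add: local_rep_def)
      then have "F ?q = chart_inv d z" using chart_inv_map[OF B.is_chart[OF d] q] by simp
      then have "F (inv F (chart_inv d z)) = F ?q" by (simp add: surj_f_inv_f[OF surjF])
      then have "h (inv F (chart_inv d z)) = h ?q" by (rule basic_constant_on_fibres[OF h conn])
      then show ?thesis using bspec[OF k x(1)] x(2) by simp
    qed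
    then have "smooth_on V' (h \<circ> inv F \<circ> chart_inv d)"
      using smooth_on_cong[OF V'(1), of "h \<circ> inv F \<circ> chart_inv d" k] V'(3) by simp
    then show "\<exists>T. open T \<and> y \<in> T \<and> smooth_on T (h \<circ> inv F \<circ> chart_inv d)" using V'(1) yV by blast
  qed
qed

text \<open>The wanted dilation divided by the present one, which is to become the pull-back of the
  scaling factor. Numerator and denominator both have vanishing vertical derivatives.\<close>

lemma basic_quotient: "basic (\<lambda>p. exp (k * f p) / dil p)"
  unfolding basic_def
proof (intro conjI ballI allI impI)
  have o: "open (chart_image c)" if "c \<in> A" for c by (rule chart_open(2)[OF M.is_chart[OF that]])
  show "smooth_fun A (\<lambda>p. exp (k * f p) / dil p)"
    unfolding smooth_fun_def
  proof
    fix c assume c: "c \<in> A"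
    show "smooth_on (chart_image c) ((\<lambda>p. exp (k * f p) / dil p) \<circ> chart_inv c)"
      unfolding o_def
      by (rule smooth_on_divide[OF o[OF c] smooth_on_exp[OF o[OF c] smooth_on_mult[OF o[OF c] smooth_on_const]]])
        (use smooth_f dil_smooth dil_pos[THEN less_imp_neq, symmetric] c in \<open>simp_all add: smooth_fun_def o_def\<close>)
  qed
  fix c d x v
  assume c: "c \<in> A" and d: "d \<in> B" and x: "x \<in> coord_dom c d" and v: "frechet_derivative (local_rep c d F) (at x) v = 0"
  interpret C: clairaut_coords "coord_dom c d" "chart_image d" "local_rep c d F" "metric_matrix A g c"
    "metric_matrix B g' d" "dil \<circ> chart_inv c" "f \<circ> chart_inv c" by (rule clairaut_in_coords[OF c d])
  let ?f = "f \<circ> chart_inv c" and ?l = "dil \<circ> chart_inv c"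
  have "?l x \<noteq> 0" using C.lpos[OF x] by simp
  from has_derivative_divide'[OF has_derivative_exp_mult[OF C.phi_has_derivative[OF x], of k] C.l_has_derivative[OF x] this]
  have "((\<lambda>y. exp (k * ?f y) / ?l y) has_derivative (\<lambda>u. (exp (k * ?f x) * (k * C.d\<phi> x u) * ?l x - exp (k * ?f x) * C.dl x u) / (?l x * ?l x))) (at x)" .
  from frechet_derivative_at[OF this]
  have "frechet_derivative (\<lambda>y. exp (k * ?f y) / ?l y) (at x) v = (exp (k * ?f x) * (k * C.d\<phi> x v) * ?l x - exp (k * ?f x) * C.dl x v) / (?l x * ?l x)"
    by (rule fun_cong[OF sym])
  moreover have "C.d\<phi> x v = 0" "C.dl x v = 0" using vertical_derivatives[OF c d x v] .
  ultimately show "frechet_derivative ((\<lambda>p. exp (k * f p) / dil p) \<circ> chart_inv c) (at x) v = 0"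
    by (simp add: o_def)
qed

lemma smooth_fun_exp_f: "smooth_fun A (\<lambda>p. exp (k * f p))"
  unfolding smooth_fun_def o_def
proof
  fix c assume c: "c \<in> A"
  have o: "open (chart_image c)" by (rule chart_open(2)[OF M.is_chart[OF c]])
  show "smooth_on (chart_image c) (\<lambda>x. exp (k * f (chart_inv c x)))"
    by (rule smooth_on_exp[OF o smooth_on_mult[OF o smooth_on_const]])
      (use smooth_f c in \<open>simp add: smooth_fun_def o_def\<close>)
qed

end

section \<open>Conformal change of the target metric\<close>

lemma (in riemannian) riemannian_metric_scale:
  assumes \<rho>: "smooth_fun A \<rho>" and pos: "\<And>p. \<rho> p > 0"
  shows "riemannian_metric A (\<lambda>p u v. (\<rho> p)\<^sup>2 * g p u v)"
  unfolding riemannian_metric_def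
proof (intro conjI allI impI ballI)
  fix p
  have b: "linear (\<lambda>v. g p u v)" "linear (\<lambda>v. g p v u)" for u using g_bilinear[of p] by (auto simp: bilinear_def)
  show "bilinear (\<lambda>u v. (\<rho> p)\<^sup>2 * g p u v)"
    unfolding bilinear_def using linear_compose_scale_right[OF b(1), of "(\<rho> p)\<^sup>2"] linear_compose_scale_right[OF b(2), of "(\<rho> p)\<^sup>2"]
    by simp
  show "(\<rho> p)\<^sup>2 * g p v w = (\<rho> p)\<^sup>2 * g p w v" for v w by (simp add: g_sym)
  show "(\<rho> p)\<^sup>2 * g p v v > 0" if "v \<noteq> 0" for v
    using g_pos[OF that] pos by (intro mult_pos_pos zero_less_power)
next
  fix c i j assume c: "c \<in> A"
  have o: "open (chart_image c)" by (rule chart_open(2)[OF is_chart[OF c]])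
  have r: "smooth_on (chart_image c) (\<lambda>x. \<rho> (chart_inv c x))" using \<rho> c by (simp add: smooth_fun_def o_def)
  have m: "smooth_on (chart_image c) (\<lambda>x. metric_matrix A g c x $ i $ j)"
    by (rule smooth_on_nth[OF o smooth_on_nth[OF o smooth_metric_matrix[OF c]]])
  have "smooth_on (chart_image c) (\<lambda>x. \<rho> (chart_inv c x) * \<rho> (chart_inv c x) * metric_matrix A g c x $ i $ j)"
    by (rule smooth_on_mult[OF o smooth_on_mult[OF o r r] m])
  then show "smooth_on (chart_image c) (\<lambda>x. metric_matrix A (\<lambda>p u v. (\<rho> p)\<^sup>2 * g p u v) c x $ i $ j)"
    by (simp add: metric_matrix_def power2_eq_square)
qed

text \<open>The two hypotheses on the map as a whole serve the descent of exp(k f) / dil to the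
  base: connected fibres make it depend on F p only, surjectivity determines it at every point of
  the base.\<close>

theorem corollary20:
  fixes M :: "('a::{t2_space,second_countable_topology}, 'm::finite) chart set"
    and g :: "('a, 'm) metric_field"
    and B :: "('b::{t2_space,second_countable_topology}, 'n::finite) chart set"
    and g' :: "('b, 'n) metric_field"
    and F :: "'a \<Rightarrow> 'b"
    and f :: "'a \<Rightarrow> real"
  assumes "riemannian_manifold M g"
    and "riemannian_manifold B g'"
    and "clairaut_conformal_submersion M g B g' F (\<lambda>p. exp (f p))"
    and surjective: "surj F"
    and connected_fibres: "\<forall>b. connected (F -` {b})"
    and "CARD('n) \<noteq> 2"
  shows "\<exists>\<rho> :: 'b \<Rightarrow> real. smooth_fun B \<rho> \<and> (\<forall>b. \<rho> b > 0) \<and>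
           riemannian_manifold B (\<lambda>b u v. (\<rho> b)\<^sup>2 * g' b u v) \<and>
           harmonic_map M g B (\<lambda>b u v. (\<rho> b)\<^sup>2 * g' b u v) F \<and>
           clairaut_conformal_submersion M g B (\<lambda>b u v. (\<rho> b)\<^sup>2 * g' b u v) F (\<lambda>p. exp (f p))"
proof -
  obtain dil where cs: "conformal_submersion M g B g' F dil" and fs: "smooth_fun M (\<lambda>p. exp (f p))"
    and cl: "\<And>I \<alpha>. geodesic M g I \<alpha> \<Longrightarrow>
      (\<lambda>t. exp (f (\<alpha> t)) * sin (angle_horizontal M g B F (\<alpha> t) (velocity M \<alpha> t))) constant_on I"
    using assms(3) by (auto simp: clairaut_conformal_submersion_def)
  interpret MM: riemannian M g using assms(1) by unfold_locales (simp_all add: riemannian_manifold_def)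
  interpret BB: riemannian B g' using assms(2) by unfold_locales (simp_all add: riemannian_manifold_def)
  \<comment> \<open>Smoothness is given for r = exp f; the logarithm passes to
    \<open>f\<close>.\<close>
  have fsm: "smooth_fun M f"
    unfolding smooth_fun_def
  proof
    fix c assume c: "c \<in> M"
    have "smooth_on (chart_image c) (\<lambda>x. ln (exp (f (chart_inv c x))))"
      by (rule smooth_on_ln[OF chart_open(2)[OF MM.is_chart[OF c]]])
        (use fs c in \<open>simp_all add: smooth_fun_def o_def\<close>)
    then show "smooth_on (chart_image c) (f \<circ> chart_inv c)" by (simp add: o_def)
  qed
  interpret C: clairaut_manifolds M g B g' F dil f
    by unfold_locales (use cs fsm cl in auto)
  define k where "k = (real CARD('m) - real CARD('n)) / (real CARD('n) - 2)"
  define h where "h = (\<lambda>p. exp (k * f p) / dil p)"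
  define \<rho> where "\<rho> = h \<circ> inv F"
  let ?g = "\<lambda>b u v. (\<rho> b)\<^sup>2 * g' b u v"
  have conn: "connected (F -` {b})" for b using connected_fibres by blast
  have h: "C.basic h" unfolding h_def by (rule C.basic_quotient)
  have \<rho>F: "\<rho> (F p) = h p" for p
    unfolding \<rho>_def o_apply by (rule C.basic_constant_on_fibres[OF h conn surj_f_inv_f[OF surjective]])
  have \<rho>s: "smooth_fun B \<rho>" unfolding \<rho>_def by (rule C.basic_descends[OF h conn surjective])
  have \<rho>p: "\<rho> b > 0" for b by (simp add: \<rho>_def h_def C.dil_pos)
  have rm: "riemannian_metric B ?g" by (rule BB.riemannian_metric_scale[OF \<rho>s \<rho>p])
  have cs': "conformal_submersion M g B ?g F (\<lambda>p. exp (k * f p))"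
    unfolding conformal_submersion_def
  proof (intro conjI allI ballI)
    show "submersion M B F" using cs by (simp add: conformal_submersion_def)
    show "smooth_fun M (\<lambda>p. exp (k * f p))" by (rule C.smooth_fun_exp_f)
    fix p X Y assume XY: "X \<in> horizontal M g B F p" "Y \<in> horizontal M g B F p"
    have "dil p \<noteq> 0" using C.dil_pos[of p] by simp
    then show "?g (F p) (differential M B F p X) (differential M B F p Y) = (exp (k * f p))\<^sup>2 * g p X Y"
      by (simp add: C.F_conf[OF XY] \<rho>F h_def power_divide)
  qed simp
  \<comment> \<open>The Clairaut relation \<open>cl\<close> carries over unchanged; only
    conformality had to be established for the new metric.\<close>
  interpret C': clairaut_manifolds M g B ?g F "\<lambda>p. exp (k * f p)" f
    by unfold_locales (use cs' fsm cl rm in auto)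
  have "harmonic_map M g B ?g F"
    by (rule C'.harmonic[of k]) (use assms(6) in \<open>simp_all add: k_def\<close>)
  moreover have "riemannian_manifold B ?g" using assms(2) rm by (simp add: riemannian_manifold_def)
  moreover have "clairaut_conformal_submersion M g B ?g F (\<lambda>p. exp (f p))"
    using cs' fs cl by (auto simp: clairaut_conformal_submersion_def)
  ultimately show ?thesis using \<rho>s \<rho>p by blast
qed

end
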